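(* The following quantum groups are strange: (1) The Kac-Paljutkin quantum group. (2) Its generalizations constructed by Sekine.
   Context: Compact quantum groups $G$ are described by Hopf $C^*$-algebras $C(G)$ in the sense of Woronowicz. $G$ is classical if $C(G)$ is commutative. A subgroup $H\subset G$ is given by a surjective morphism of Hopf $C^*$-algebras $C(G)\to C(H)$. For a discrete group $\Lambda$, the group dual $\widehat{\Lambda}$ is given by $C(\widehat{\Lambda})=C^*(\Lambda)$ with $\Delta(g)=g\otimes g$; it is classical if and only if $\Lambda$ is abelian. A compact quantum group $G$ is called strange if it is non-classical and all its group dual subgroups $\widehat{\Lambda}\subset G$ are classical. The Kac-Paljutkin quantum group is the finite quantum group whose function algebra is the unique (up to isomorphism) 8-dimensional Hopf $C^*$-algebra which is neither commutative nor cocommutative; as an algebra it is $\mathbb C^4\oplus M_2(\mathbb C)$. Sekine's generalizations are the finite quantum groups $G$ with $C(G)=A_k$, where the parameter $k$ is a positive integer and the Hopf $C^*$-algebra $A_k$ is as follows. As a $C^*$-algebra, $A_k=\bigoplus_{i,j\in\mathbb Z_k}\mathbb C d_{i,j}\oplus M_k(\mathbb C)$, where the $d_{i,j}$ are minimal central projections and $e_{i,j}$ ($i,j\in\mathbb Z_k$) are the matrix units of $M_k(\mathbb C)$. With $\eta$ a primitive $k$-th root of unity, and all indices taken modulo $k$, the comultiplication is $$\Delta(d_{i,j})=\sum_{m,n\in\mathbb Z_k}d_{m,n}\otimes d_{i-m,j-n}+\frac1k\sum_{m,n\in\mathbb Z_k}\eta^{i(m-n)}e_{m,n}\otimes e_{m+j,n+j},$$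 $$\Delta(e_{i,j})=\sum_{m,n\in\mathbb Z_k}\eta^{m(i-j)}d_{-m,-n}\otimes e_{i-n,j-n}+\sum_{m,n\in\mathbb Z_k}\eta^{m(j-i)}e_{i-n,j-n}\otimes d_{m,n}.$$
   Formalization: Sekine's quantum groups are taken only for k ≥ 3, since the claim fails for k = 1 (A_1 is commutative, so G is classical) and for k = 2 (A_2 is cocommutative and noncommutative, so G is itself a non-classical group dual). *)

theory Defs
  imports "HOL-Analysis.Analysis" "HOL-Library.Function_Algebras" "HOL-Algebra.Group"
begin

text \<open>
  C*-algebras are realised concretely, as norm closed *-subalgebras of the algebra of bounded
  operators on a Hilbert space. By Gelfand--Naimark this is no restriction, and the Hilbert space can
  be taken to be the space of square summable families over an index type \<open>'i\<close>. With this choice the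
  tensor product of C*-algebras that underlies compact quantum groups, the spatial (minimal) one, is
  literally the closed span of the operators \<open>a \<otimes> b\<close> on the Hilbert space over \<open>'i \<times> 'j\<close>.

  Addition and subtraction of vectors and operators are the pointwise ones of
  \<^theory>\<open>HOL-Library.Function_Algebras\<close>; the product of operators is composition.
\<close>

type_synonym 'i vec = "'i \<Rightarrow> complex"
type_synonym 'i oper = "'i vec \<Rightarrow> 'i vec"


section \<open>Bounded operators\<close>

definition l2 :: "'i vec set" where
  "l2 = {x. (\<lambda>i. (cmod (x i))\<^sup>2) summable_on UNIV}"

definition l2norm :: "'i vec \<Rightarrow> real" where
  "l2norm x = sqrt (infsum (\<lambda>i. (cmod (x i))\<^sup>2) UNIV)"

definition l2inner :: "'i vec \<Rightarrow> 'i vec \<Rightarrow> complex" where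
  "l2inner x y = infsum (\<lambda>i. cnj (x i) * y i) UNIV"

text \<open>Operators are total functions, normalised to vanish outside \<^const>\<open>l2\<close>, so that equality of
  operators is equality of functions.\<close>

definition bounded_oper :: "'i oper \<Rightarrow> bool" where
  "bounded_oper T \<longleftrightarrow>
     (\<forall>x\<in>l2. T x \<in> l2) \<and>
     (\<forall>x\<in>l2. \<forall>y\<in>l2. T (x + y) = T x + T y) \<and>
     (\<forall>c. \<forall>x\<in>l2. T (\<lambda>i. c * x i) = (\<lambda>i. c * T x i)) \<and>
     (\<exists>C. \<forall>x\<in>l2. l2norm (T x) \<le> C * l2norm x) \<and>
     (\<forall>x. x \<notin> l2 \<longrightarrow> T x = 0)"

definition opnorm :: "'i oper \<Rightarrow> real" where
  "opnorm T = Sup {l2norm (T x) | x. x \<in> l2 \<and> l2norm x \<le> 1}"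

definition is_adjoint :: "'i oper \<Rightarrow> 'i oper \<Rightarrow> bool" where
  "is_adjoint T S \<longleftrightarrow> (\<forall>x\<in>l2. \<forall>y\<in>l2. l2inner (T x) y = l2inner x (S y))"

definition adj :: "'i oper \<Rightarrow> 'i oper" where
  "adj T = (THE S. bounded_oper S \<and> is_adjoint T S)"

definition oscale :: "complex \<Rightarrow> 'i oper \<Rightarrow> 'i oper" where
  "oscale c T = (\<lambda>x i. c * T x i)"

global_interpretation ops: vector_space oscale
  by standard (auto simp: oscale_def fun_eq_iff algebra_simps)

definition norm_closure :: "'i oper set \<Rightarrow> 'i oper set" where
  "norm_closure S =
     {T. bounded_oper T \<and> (\<exists>X. (\<forall>n::nat. X n \<in> S) \<and> (\<lambda>n. opnorm (X n - T)) \<longlonglongrightarrow> 0)}"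

text \<open>\<open>(T \<otimes> S) x\<close> applies \<open>S\<close> to the second variable of \<open>x\<close> and then \<open>T\<close> to the first one.\<close>

definition otensor :: "'i oper \<Rightarrow> 'j oper \<Rightarrow> ('i \<times> 'j) oper"  (infixr \<open>\<otimes>\<^sub>o\<close> 75) where
  "T \<otimes>\<^sub>o S = (\<lambda>x. if x \<in> l2
       then (\<lambda>(i, j). T (\<lambda>i'. S (\<lambda>j'. x (i', j')) j) i) else 0)"

text \<open>Conjugation with the unitaries that identify \<open>(H \<otimes> H) \<otimes> H\<close> with \<open>H \<otimes> (H \<otimes> H)\<close>
  and flip \<open>H \<otimes> H\<close>.\<close>

definition oassoc :: "(('i \<times> 'i) \<times> 'i) oper \<Rightarrow> ('i \<times> 'i \<times> 'i) oper" where
  "oassoc T = (\<lambda>x (i, j, k). T (\<lambda>((i', j'), k'). x (i', j', k')) ((i, j), k))"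

definition oflip :: "('i \<times> 'i) oper \<Rightarrow> ('i \<times> 'i) oper" where
  "oflip T = (\<lambda>x (i, j). T (\<lambda>(i', j'). x (j', i')) (j, i))"


section \<open>Unital C*-algebras\<close>

text \<open>The unit of the algebra is not required to be the identity operator of the ambient
  Hilbert space.\<close>

definition is_unit_of :: "'i oper set \<Rightarrow> 'i oper \<Rightarrow> bool" where
  "is_unit_of A e \<longleftrightarrow> e \<in> A \<and> (\<forall>a\<in>A. e \<circ> a = a \<and> a \<circ> e = a)"

definition unit_of :: "'i oper set \<Rightarrow> 'i oper" where
  "unit_of A = (THE e. is_unit_of A e)"

definition cstar_algebra :: "'i oper set \<Rightarrow> bool" where
  "cstar_algebra A \<longleftrightarrow>
     (\<forall>a\<in>A. bounded_oper a) \<and>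
     ops.subspace A \<and>
     (\<forall>a\<in>A. \<forall>b\<in>A. a \<circ> b \<in> A) \<and>
     (\<forall>a\<in>A. \<exists>b\<in>A. is_adjoint a b) \<and>
     norm_closure A \<subseteq> A \<and>
     (\<exists>e. is_unit_of A e)"

definition ctensor :: "'i oper set \<Rightarrow> 'j oper set \<Rightarrow> ('i \<times> 'j) oper set"  (infixr \<open>\<otimes>\<^sub>C\<close> 75) where
  "A \<otimes>\<^sub>C B = norm_closure (ops.span {a \<otimes>\<^sub>o b | a b. a \<in> A \<and> b \<in> B})"

definition star_hom :: "'i oper set \<Rightarrow> 'j oper set \<Rightarrow> ('i oper \<Rightarrow> 'j oper) \<Rightarrow> bool" where
  "star_hom A B f \<longleftrightarrow>
     (\<forall>a\<in>A. f a \<in> B) \<and>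
     (\<forall>a\<in>A. \<forall>b\<in>A. f (a + b) = f a + f b) \<and>
     (\<forall>c. \<forall>a\<in>A. f (oscale c a) = oscale c (f a)) \<and>
     (\<forall>a\<in>A. \<forall>b\<in>A. f (a \<circ> b) = f a \<circ> f b) \<and>
     (\<forall>a\<in>A. f (adj a) = adj (f a)) \<and>
     f (unit_of A) = unit_of B"

text \<open>\<open>F\<close> is the tensor product \<open>f \<otimes> g : A \<otimes> B \<rightarrow> C \<otimes> D\<close>; being a *-homomorphism it is automatically
  continuous, hence determined by its values on elementary tensors.\<close>

definition is_tensor_hom ::
  "'i oper set \<Rightarrow> 'j oper set \<Rightarrow> 'k oper set \<Rightarrow> 'l oper set \<Rightarrow> ('i oper \<Rightarrow> 'k oper) \<Rightarrow>
   ('j oper \<Rightarrow> 'l oper) \<Rightarrow> (('i \<times> 'j) oper \<Rightarrow> ('k \<times> 'l) oper) \<Rightarrow> bool" where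
  "is_tensor_hom A B C D f g F \<longleftrightarrow>
     star_hom (A \<otimes>\<^sub>C B) (C \<otimes>\<^sub>C D) F \<and> (\<forall>a\<in>A. \<forall>b\<in>B. F (a \<otimes>\<^sub>o b) = f a \<otimes>\<^sub>o g b)"


section \<open>Compact quantum groups\<close>

text \<open>A quantum group \<open>G\<close> is given by \<open>alg G = C(G)\<close> and its comultiplication. The axioms are those
  of Woronowicz: a unital *-homomorphism \<open>\<Delta> : A \<rightarrow> A \<otimes> A\<close> with \<open>(\<Delta> \<otimes> id) \<Delta> = (id \<otimes> \<Delta>) \<Delta>\<close> such that
  \<open>\<Delta>(A) (A \<otimes> 1)\<close> and \<open>\<Delta>(A) (1 \<otimes> A)\<close> have dense span in \<open>A \<otimes> A\<close>.\<close>

record 'i quantum_group =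
  alg :: "'i oper set"
  comult :: "'i oper \<Rightarrow> ('i \<times> 'i) oper"

definition coassociative :: "'i quantum_group \<Rightarrow> bool" where
  "coassociative G \<longleftrightarrow> (let A = alg G; \<Delta> = comult G in
     \<exists>F F'. is_tensor_hom A A (A \<otimes>\<^sub>C A) A \<Delta> (\<lambda>a. a) F \<and>
            is_tensor_hom A A A (A \<otimes>\<^sub>C A) (\<lambda>a. a) \<Delta> F' \<and>
            (\<forall>a\<in>A. oassoc (F (\<Delta> a)) = F' (\<Delta> a)))"

definition cancellation :: "'i quantum_group \<Rightarrow> bool" where
  "cancellation G \<longleftrightarrow> (let A = alg G; \<Delta> = comult G in
     norm_closure (ops.span {\<Delta> a \<circ> (b \<otimes>\<^sub>o unit_of A) | a b. a \<in> A \<and> b \<in> A}) = A \<otimes>\<^sub>C A \<and>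
     norm_closure (ops.span {\<Delta> a \<circ> (unit_of A \<otimes>\<^sub>o b) | a b. a \<in> A \<and> b \<in> A}) = A \<otimes>\<^sub>C A)"

definition compact_quantum_group :: "'i quantum_group \<Rightarrow> bool" where
  "compact_quantum_group G \<longleftrightarrow>
     cstar_algebra (alg G) \<and>
     star_hom (alg G) (alg G \<otimes>\<^sub>C alg G) (comult G) \<and>
     coassociative G \<and> cancellation G"

definition classical :: "'i quantum_group \<Rightarrow> bool" where
  "classical G \<longleftrightarrow> (\<forall>a\<in>alg G. \<forall>b\<in>alg G. a \<circ> b = b \<circ> a)"

definition cocommutative :: "'i quantum_group \<Rightarrow> bool" where
  "cocommutative G \<longleftrightarrow> (\<forall>a\<in>alg G. oflip (comult G a) = comult G a)"

text \<open>\<open>\<pi> : C(G) \<rightarrow> C(H)\<close> exhibits \<open>H\<close> as a subgroup of \<open>G\<close>.\<close>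

definition quantum_subgroup ::
  "'i quantum_group \<Rightarrow> 'j quantum_group \<Rightarrow> ('i oper \<Rightarrow> 'j oper) \<Rightarrow> bool" where
  "quantum_subgroup G H \<pi> \<longleftrightarrow>
     compact_quantum_group G \<and> compact_quantum_group H \<and>
     star_hom (alg G) (alg H) \<pi> \<and> \<pi> ` alg G = alg H \<and>
     (\<exists>P. is_tensor_hom (alg G) (alg G) (alg H) (alg H) \<pi> \<pi> P \<and>
          (\<forall>a\<in>alg G. P (comult G a) = comult H (\<pi> a)))"


section \<open>Group duals\<close>

text \<open>The group algebra of the discrete group \<open>\<Lambda>\<close>: finitely supported functions on its carrier.\<close>

definition group_algebra :: "'g monoid \<Rightarrow> ('g \<Rightarrow> complex) set" where
  "group_algebra \<Lambda> = {c. finite {g. c g \<noteq> 0} \<and> {g. c g \<noteq> 0} \<subseteq> carrier \<Lambda>}"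

definition gconv :: "'g monoid \<Rightarrow> ('g \<Rightarrow> complex) \<Rightarrow> ('g \<Rightarrow> complex) \<Rightarrow> 'g \<Rightarrow> complex" where
  "gconv \<Lambda> c d = (\<lambda>g. if g \<in> carrier \<Lambda>
     then (\<Sum>h | c h \<noteq> 0. c h * d (inv\<^bsub>\<Lambda>\<^esub> h \<otimes>\<^bsub>\<Lambda>\<^esub> g)) else 0)"

definition gstar :: "'g monoid \<Rightarrow> ('g \<Rightarrow> complex) \<Rightarrow> 'g \<Rightarrow> complex" where
  "gstar \<Lambda> c = (\<lambda>g. if g \<in> carrier \<Lambda> then cnj (c (inv\<^bsub>\<Lambda>\<^esub> g)) else 0)"

definition cstar_seminorm :: "'g monoid \<Rightarrow> (('g \<Rightarrow> complex) \<Rightarrow> real) \<Rightarrow> bool" where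
  "cstar_seminorm \<Lambda> p \<longleftrightarrow>
     (\<forall>c\<in>group_algebra \<Lambda>. 0 \<le> p c) \<and>
     (\<forall>c\<in>group_algebra \<Lambda>. \<forall>d\<in>group_algebra \<Lambda>. p (c + d) \<le> p c + p d) \<and>
     (\<forall>z. \<forall>c\<in>group_algebra \<Lambda>. p (\<lambda>g. z * c g) = cmod z * p c) \<and>
     (\<forall>c\<in>group_algebra \<Lambda>. \<forall>d\<in>group_algebra \<Lambda>. p (gconv \<Lambda> c d) \<le> p c * p d) \<and>
     (\<forall>c\<in>group_algebra \<Lambda>. p (gconv \<Lambda> (gstar \<Lambda> c) c) = (p c)\<^sup>2)"

text \<open>\<open>A\<close>, with the unitaries \<open>u g\<close>, is the full group C*-algebra of \<open>\<Lambda>\<close>: the completion of the group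
  algebra for its largest C*-seminorm.\<close>

definition group_cstar_algebra :: "'g monoid \<Rightarrow> 'j oper set \<Rightarrow> ('g \<Rightarrow> 'j oper) \<Rightarrow> bool" where
  "group_cstar_algebra \<Lambda> A u \<longleftrightarrow>
     group \<Lambda> \<and> cstar_algebra A \<and>
     (\<forall>g\<in>carrier \<Lambda>. u g \<in> A) \<and>
     u \<one>\<^bsub>\<Lambda>\<^esub> = unit_of A \<and>
     (\<forall>g\<in>carrier \<Lambda>. \<forall>h\<in>carrier \<Lambda>. u (g \<otimes>\<^bsub>\<Lambda>\<^esub> h) = u g \<circ> u h) \<and>
     (\<forall>g\<in>carrier \<Lambda>. u (inv\<^bsub>\<Lambda>\<^esub> g) = adj (u g)) \<and>
     norm_closure (ops.span (u ` carrier \<Lambda>)) = A \<and>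
     (\<forall>p. cstar_seminorm \<Lambda> p \<longrightarrow>
        (\<forall>c\<in>group_algebra \<Lambda>. p c \<le> opnorm (\<Sum>g | c g \<noteq> 0. oscale (c g) (u g))))"

definition group_dual :: "'g monoid \<Rightarrow> ('g \<Rightarrow> 'j oper) \<Rightarrow> 'j quantum_group \<Rightarrow> bool" where
  "group_dual \<Lambda> u H \<longleftrightarrow>
     compact_quantum_group H \<and> group_cstar_algebra \<Lambda> (alg H) u \<and>
     (\<forall>g\<in>carrier \<Lambda>. comult H (u g) = u g \<otimes>\<^sub>o u g)"

text \<open>A formula cannot quantify over types, so the types that \<open>\<Lambda>\<close> and the Hilbert space of its
  group C*-algebra live on are parameters; statements are meant to be polymorphic in them.\<close>

definition strange :: "'g itself \<Rightarrow> 'j itself \<Rightarrow> 'i quantum_group \<Rightarrow> bool" where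
  "strange tg tj G \<longleftrightarrow>
     compact_quantum_group G \<and> \<not> classical G \<and>
     (\<forall>(\<Lambda> :: 'g monoid) (u :: 'g \<Rightarrow> 'j oper) H \<pi>.
        group_dual \<Lambda> u H \<and> quantum_subgroup G H \<pi> \<longrightarrow> classical H)"


section \<open>The Kac--Paljutkin and Sekine quantum groups\<close>

text \<open>\<^const>\<open>ops.dim\<close> is 0 on infinite-dimensional spaces.\<close>

definition kac_paljutkin :: "'i quantum_group \<Rightarrow> bool" where
  "kac_paljutkin G \<longleftrightarrow>
     compact_quantum_group G \<and> ops.dim (alg G) = 8 \<and> \<not> classical G \<and> \<not> cocommutative G"

text \<open>Matrix units and matrix entries with respect to the standard basis.\<close>

definition munit :: "'i \<Rightarrow> 'i \<Rightarrow> 'i oper" where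
  "munit p q = (\<lambda>x. if x \<in> l2 then (\<lambda>i. if i = p then x q else 0) else 0)"

definition entry :: "'i oper \<Rightarrow> 'i \<Rightarrow> 'i \<Rightarrow> complex" where
  "entry T p q = T (\<lambda>i. if i = q then 1 else 0) p"

text \<open>\<open>A\<^sub>k\<close> acts block diagonally, \<open>\<oplus> \<complex> d\<^sub>i\<^sub>j\<close> on the basis vectors \<open>Inl (i, j)\<close> and the
  \<open>k \<times> k\<close> matrices on the basis vectors \<open>Inr i\<close>. The cyclic group of order \<open>k\<close> is \<open>{0..<k}\<close>;
  indices are reduced modulo \<open>k\<close>.\<close>

type_synonym sek = "int \<times> int + int"

definition Zk :: "nat \<Rightarrow> int set" where
  "Zk k = {0..<int k}"

definition sek_d :: "nat \<Rightarrow> int \<Rightarrow> int \<Rightarrow> sek oper" where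
  "sek_d k i j = munit (Inl (i mod int k, j mod int k)) (Inl (i mod int k, j mod int k))"

definition sek_e :: "nat \<Rightarrow> int \<Rightarrow> int \<Rightarrow> sek oper" where
  "sek_e k i j = munit (Inr (i mod int k)) (Inr (j mod int k))"

definition sek_alg :: "nat \<Rightarrow> sek oper set" where
  "sek_alg k = ops.span ({sek_d k i j | i j. i \<in> Zk k \<and> j \<in> Zk k} \<union>
                         {sek_e k i j | i j. i \<in> Zk k \<and> j \<in> Zk k})"

definition primitive_root_of_unity :: "nat \<Rightarrow> complex \<Rightarrow> bool" where
  "primitive_root_of_unity k \<eta> \<longleftrightarrow> 0 < k \<and> \<eta> ^ k = 1 \<and> (\<forall>m. 0 < m \<and> m < k \<longrightarrow> \<eta> ^ m \<noteq> 1)"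

definition sek_comult_d :: "nat \<Rightarrow> complex \<Rightarrow> int \<Rightarrow> int \<Rightarrow> (sek \<times> sek) oper" where
  "sek_comult_d k \<eta> i j =
     (\<Sum>m\<in>Zk k. \<Sum>n\<in>Zk k. sek_d k m n \<otimes>\<^sub>o sek_d k (i - m) (j - n)) +
     oscale (1 / of_nat k) (\<Sum>m\<in>Zk k. \<Sum>n\<in>Zk k.
       oscale (\<eta> powi (i * (m - n))) (sek_e k m n \<otimes>\<^sub>o sek_e k (m + j) (n + j)))"

definition sek_comult_e :: "nat \<Rightarrow> complex \<Rightarrow> int \<Rightarrow> int \<Rightarrow> (sek \<times> sek) oper" where
  "sek_comult_e k \<eta> i j =
     (\<Sum>m\<in>Zk k. \<Sum>n\<in>Zk k.
       oscale (\<eta> powi (m * (i - j))) (sek_d k (- m) (- n) \<otimes>\<^sub>o sek_e k (i - n) (j - n))) +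
     (\<Sum>m\<in>Zk k. \<Sum>n\<in>Zk k.
       oscale (\<eta> powi (m * (j - i))) (sek_e k (i - n) (j - n) \<otimes>\<^sub>o sek_d k m n))"

text \<open>The linear extension of the two formulas above.\<close>

definition sek_comult :: "nat \<Rightarrow> complex \<Rightarrow> sek oper \<Rightarrow> (sek \<times> sek) oper" where
  "sek_comult k \<eta> T =
     (\<Sum>i\<in>Zk k. \<Sum>j\<in>Zk k. oscale (entry T (Inl (i, j)) (Inl (i, j))) (sek_comult_d k \<eta> i j)) +
     (\<Sum>i\<in>Zk k. \<Sum>j\<in>Zk k. oscale (entry T (Inr i) (Inr j)) (sek_comult_e k \<eta> i j))"

text \<open>The quantum group is classical for \<open>k = 1\<close>. For \<open>k = 2\<close> both formulas are invariant under the flip,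
  so that \<open>A\<^sub>2\<close>, which contains \<open>M\<^sub>2(\<complex>)\<close>, is the group algebra of a non-abelian group of order 8 and
  is not strange. From \<open>k = 3\<close> on, \<open>A\<^sub>k\<close> is neither commutative nor cocommutative.\<close>

definition sekine :: "nat \<Rightarrow> complex \<Rightarrow> sek quantum_group" where
  "sekine k \<eta> = \<lparr>alg = sek_alg k, comult = sek_comult k \<eta>\<rparr>"

end

theory Submission
  imports Defs
begin

text \<open>
  Let \<open>\<pi> : C(G) \<rightarrow> C\<^sup>*(\<Lambda>)\<close> be a group dual subgroup of a finite quantum group \<open>G\<close>, and \<open>A = C(G)\<close>. The images of the
  elements of \<open>\<Lambda>\<close> are group-like, hence linearly independent; since the quotient is finite-dimensional they form
  a finite group \<open>\<Gamma>\<close> which is a basis of it. The coaction \<open>(id \<otimes> \<pi>) \<Delta>\<close> grades \<open>A\<close> by \<open>\<Gamma>\<close>: coassociativity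
  makes the components the ranges of orthogonal idempotents, and the two cancellation properties show that the
  components add up to \<open>A\<close> and that each of them generates \<open>A\<close> as a right module. If one component is spanned by a
  single vector, that vector is right invertible, so the trivial component consists of scalars, and then every
  component is one-dimensional. As the components are non-zero, this happens as soon as \<open>dim A < 2 |\<Gamma>|\<close>. In that
  case homogeneous preimages of the elements of \<open>\<Gamma>\<close> are a basis of \<open>A\<close> consisting of group-like elements, and \<open>G\<close>
  is cocommutative (\<open>cocommutative_if_small\<close>).

  Neither the Kac--Paljutkin quantum group nor, for \<open>k \<ge> 3\<close>, the one of Sekine is cocommutative, so it remains to see
  that a non-classical group dual subgroup would be too large. If \<open>\<Gamma>\<close> is not commutative it has at least the five
  elements \<open>1, v, w, vw, wv\<close>, and \<open>8 < 2 \<cdot> 5\<close>. For \<open>A\<^sub>k\<close>, of dimension \<open>2 k\<^sup>2\<close>, a non-commutative quotient contains a copy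
  of the simple algebra \<open>M\<^sub>k(\<complex>)\<close>; the character of the group algebra with value 1 on \<open>\<Gamma>\<close> vanishes on \<open>M\<^sub>k(\<complex>)\<close> but not
  on the unit, so \<open>|\<Gamma>| > k\<^sup>2\<close> (\<open>sekine_card_Gamma\<close>).

  The remaining part is that \<open>A\<^sub>k\<close> is a compact quantum group. Algebras of matrices with a prescribed finite support
  turn everything into identities between matrix entries: the entries of \<open>\<Delta>\<close> are explicit
  (\<open>comult_dd\<close>, \<open>comult_de\<close>, \<open>comult_ed\<close>, \<open>comult_ee\<close>), and multiplicativity, coassociativity and cancellation follow
  from index shifts modulo \<open>k\<close> and the orthogonality of the characters of \<open>\<int>\<^sub>k\<close>.
\<close>

section \<open>Square summable families\<close>

lemma l2_boundI:
  assumes "\<And>F. finite F \<Longrightarrow> (\<Sum>i\<in>F. (cmod (x i))\<^sup>2) \<le> K"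
  shows "x \<in> l2" and "infsum (\<lambda>i. (cmod (x i))\<^sup>2) UNIV \<le> K"
proof -
  have "bdd_above (sum (\<lambda>i. (cmod (x i))\<^sup>2) ` {F. F \<subseteq> UNIV \<and> finite F})"
    using assms by (intro bdd_aboveI[of _ K]) auto
  then have s: "(\<lambda>i. (cmod (x i))\<^sup>2) summable_on UNIV"
    by (intro nonneg_bdd_above_summable_on) auto
  then show "x \<in> l2" by (simp add: l2_def)
  show "infsum (\<lambda>i. (cmod (x i))\<^sup>2) UNIV \<le> K"
    using s assms by (intro infsum_le_finite_sums) auto
qed

lemma l2_sum_le:
  assumes "x \<in> l2" "finite F"
  shows "(\<Sum>i\<in>F. (cmod (x i))\<^sup>2) \<le> (l2norm x)\<^sup>2"
proof -
  have "(\<Sum>i\<in>F. (cmod (x i))\<^sup>2) \<le> infsum (\<lambda>i. (cmod (x i))\<^sup>2) UNIV"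
    using assms by (intro finite_sum_le_infsum) (auto simp: l2_def)
  then show ?thesis by (simp add: l2norm_def infsum_nonneg)
qed

lemma l2norm_nonneg [simp]: "0 \<le> l2norm x"
  by (simp add: l2norm_def infsum_nonneg)

lemma l2norm_leI:
  assumes "\<And>F. finite F \<Longrightarrow> (\<Sum>i\<in>F. (cmod (x i))\<^sup>2) \<le> K\<^sup>2" "0 \<le> K"
  shows "x \<in> l2" "l2norm x \<le> K"
proof -
  show "x \<in> l2" by (rule l2_boundI(1)) (fact assms(1))
  show "l2norm x \<le> K" unfolding l2norm_def
    using l2_boundI(2)[of x "K\<^sup>2"] assms by (simp add: real_le_lsqrt infsum_nonneg)
qed

lemma l2_zero [simp]: "0 \<in> l2" and l2norm_zero [simp]: "l2norm 0 = 0"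
  using l2norm_leI[of 0 0] by (auto intro: order_antisym)

lemma l2_add:
  assumes "x \<in> l2" "y \<in> l2"
  shows "x + y \<in> l2" "l2norm (x + y) \<le> l2norm x + l2norm y"
proof -
  have "(\<Sum>i\<in>F. (cmod ((x + y) i))\<^sup>2) \<le> (l2norm x + l2norm y)\<^sup>2" if F: "finite F" for F
  proof -
    have "L2_set (\<lambda>i. cmod ((x + y) i)) F \<le> L2_set (\<lambda>i. cmod (x i) + cmod (y i)) F"
      by (intro L2_set_mono) (auto simp: norm_triangle_ineq)
    also have "\<dots> \<le> L2_set (\<lambda>i. cmod (x i)) F + L2_set (\<lambda>i. cmod (y i)) F"
      by (rule L2_set_triangle_ineq)
    also have "\<dots> \<le> l2norm x + l2norm y"
      unfolding L2_set_def using l2_sum_le[OF assms(1) F] l2_sum_le[OF assms(2) F]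
      by (intro add_mono real_le_lsqrt) (auto simp: sum_nonneg)
    finally show ?thesis
      using power_mono[of "L2_set (\<lambda>i. cmod ((x + y) i)) F" _ 2]
      by (simp add: L2_set_def sum_nonneg)
  qed
  then show "x + y \<in> l2" "l2norm (x + y) \<le> l2norm x + l2norm y"
    using l2norm_leI[of "x + y" "l2norm x + l2norm y"] by auto
qed

lemma l2_scale:
  assumes "x \<in> l2"
  shows "(\<lambda>i. c * x i) \<in> l2" "l2norm (\<lambda>i. c * x i) = cmod c * l2norm x"
proof -
  have s: "(\<lambda>i. (cmod (x i))\<^sup>2) summable_on UNIV" using assms by (simp add: l2_def)
  then show "(\<lambda>i. c * x i) \<in> l2"
    by (simp add: l2_def norm_mult power_mult_distrib summable_on_cmult_right)
  show "l2norm (\<lambda>i. c * x i) = cmod c * l2norm x"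
    using s by (simp add: l2norm_def norm_mult power_mult_distrib infsum_cmult_right real_sqrt_mult)
qed

lemma l2_minus: "x \<in> l2 \<Longrightarrow> - x \<in> l2"
  using l2_scale(1)[of x "-1"] by (simp add: fun_Compl_def)

lemma l2_diff: "x \<in> l2 \<Longrightarrow> y \<in> l2 \<Longrightarrow> x - y \<in> l2"
  using l2_add(1)[of x "- y"] l2_minus by auto

lemma cmod_le_l2norm: "x \<in> l2 \<Longrightarrow> cmod (x i) \<le> l2norm x"
  using l2_sum_le[of x "{i}"] by (auto intro: power2_le_imp_le)

lemma l2_finite_support:
  assumes "finite F" "\<And>i. i \<notin> F \<Longrightarrow> x i = 0"
  shows "x \<in> l2"
proof -
  have "{i \<in> UNIV. (cmod (x i))\<^sup>2 \<noteq> 0} \<subseteq> F" using assms(2) by auto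
  then show ?thesis
    unfolding l2_def using finite_subset[OF _ assms(1)]
    by (auto intro!: finite_nonzero_values_imp_summable_on)
qed

section \<open>Bounded operators\<close>

lemma bounded_oper_props:
  assumes "bounded_oper T"
  shows bdd_l2: "x \<in> l2 \<Longrightarrow> T x \<in> l2"
    and bdd_add: "x \<in> l2 \<Longrightarrow> y \<in> l2 \<Longrightarrow> T (x + y) = T x + T y"
    and bdd_scale: "x \<in> l2 \<Longrightarrow> T (\<lambda>i. c * x i) = (\<lambda>i. c * T x i)"
    and bdd_outside: "x \<notin> l2 \<Longrightarrow> T x = 0"
  using assms by (auto simp: bounded_oper_def)

lemma bdd_in_l2: "bounded_oper T \<Longrightarrow> T x \<in> l2"
  by (metis bdd_l2 bdd_outside l2_zero)

lemma bdd_zero: "bounded_oper T \<Longrightarrow> T 0 = 0"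
  using bdd_scale[of T 0 0] by (simp add: zero_fun_def[symmetric])

lemma bdd_diff:
  assumes "bounded_oper T" "x \<in> l2" "y \<in> l2" shows "T (x - y) = T x - T y"
proof -
  have "T x = T ((x - y) + y)" by simp
  also have "\<dots> = T (x - y) + T y" by (rule bdd_add[OF assms(1) l2_diff[OF assms(2,3)] assms(3)])
  finally show ?thesis by simp
qed

lemma bdd_bound:
  assumes "bounded_oper T"
  obtains C where "0 \<le> C" "\<And>x. l2norm (T x) \<le> C * l2norm x"
proof -
  obtain C where C: "\<And>x. x \<in> l2 \<Longrightarrow> l2norm (T x) \<le> C * l2norm x"
    using assms unfolding bounded_oper_def by blast
  have "l2norm (T x) \<le> max C 0 * l2norm x" for x
  proof (cases "x \<in> l2")
    case True
    then have "l2norm (T x) \<le> C * l2norm x" by (rule C)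
    also have "\<dots> \<le> max C 0 * l2norm x" by (intro mult_right_mono) auto
    finally show ?thesis .
  qed (simp add: bdd_outside[OF assms])
  then show ?thesis using that[of "max C 0"] by auto
qed

lemma bounded_operI:
  assumes "\<And>x. x \<in> l2 \<Longrightarrow> T x \<in> l2"
    "\<And>x y. x \<in> l2 \<Longrightarrow> y \<in> l2 \<Longrightarrow> T (x + y) = T x + T y"
    "\<And>c x. x \<in> l2 \<Longrightarrow> T (\<lambda>i. c * x i) = (\<lambda>i. c * T x i)"
    "\<And>x. x \<in> l2 \<Longrightarrow> l2norm (T x) \<le> C * l2norm x"
    "\<And>x. x \<notin> l2 \<Longrightarrow> T x = 0"
  shows "bounded_oper T"
  unfolding bounded_oper_def using assms by blast

lemma bounded_oper_add:
  assumes S: "bounded_oper S" and T: "bounded_oper T" shows "bounded_oper (S + T)"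
proof -
  obtain C where C: "\<And>x. l2norm (S x) \<le> C * l2norm x" using bdd_bound[OF S] by blast
  obtain D where D: "\<And>x. l2norm (T x) \<le> D * l2norm x" using bdd_bound[OF T] by blast
  have "l2norm (S x + T x) \<le> (C + D) * l2norm x" for x
    using l2_add(2)[OF bdd_in_l2[OF S] bdd_in_l2[OF T], of x x] C[of x] D[of x]
    by (simp add: algebra_simps)
  then show ?thesis
    using S T by (intro bounded_operI[where C = "C + D"])
      (auto simp: bounded_oper_props l2_add algebra_simps fun_eq_iff)
qed

lemma bounded_oper_scale:
  assumes S: "bounded_oper S" shows "bounded_oper (oscale c S)"
proof -
  obtain C where C: "\<And>x. l2norm (S x) \<le> C * l2norm x" using bdd_bound[OF S] by blast
  have "l2norm (oscale c S x) \<le> (cmod c * C) * l2norm x" for x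
    using mult_left_mono[OF C[of x], of "cmod c"] l2_scale(2)[OF bdd_in_l2[OF S], of c x]
    by (simp add: oscale_def mult.assoc)
  then show ?thesis
    by (intro bounded_operI[where C = "cmod c * C"])
      (simp_all add: bdd_in_l2[OF S] bdd_outside[OF S] bdd_add[OF S] bdd_scale[OF S] l2_scale oscale_def,
       simp_all add: algebra_simps fun_eq_iff)
qed

lemma bounded_oper_zero: "bounded_oper 0"
  by (rule bounded_operI[where C = 0]) (auto simp: zero_fun_def[symmetric])

lemma bounded_oper_comp:
  assumes S: "bounded_oper S" and T: "bounded_oper T" shows "bounded_oper (S \<circ> T)"
proof -
  obtain C where C0: "0 \<le> C" and C: "\<And>x. l2norm (S x) \<le> C * l2norm x" using bdd_bound[OF S] by blast
  obtain D where D: "\<And>x. l2norm (T x) \<le> D * l2norm x" using bdd_bound[OF T] by blast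
  have "l2norm (S (T x)) \<le> (C * D) * l2norm x" for x
    using C[of "T x"] mult_left_mono[OF D[of x] C0] by (simp add: mult.assoc)
  then show ?thesis
    by (intro bounded_operI[where C = "C * D"])
      (auto simp: bdd_zero[OF S] bdd_l2[OF S] bdd_l2[OF T] bdd_outside[OF T] bdd_add[OF S] bdd_add[OF T]
        bdd_scale[OF S] bdd_scale[OF T])
qed

lemma bounded_oper_subspace: "ops.subspace {T. bounded_oper T}"
  by (auto simp: ops.subspace_def bounded_oper_add bounded_oper_scale bounded_oper_zero)

lemma bounded_oper_span:
  assumes "\<And>T. T \<in> S \<Longrightarrow> bounded_oper T" "T \<in> ops.span S" shows "bounded_oper T"
  using ops.span_minimal[OF _ bounded_oper_subspace, of S] assms by auto

lemma oper_comp_add: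
  assumes "bounded_oper T" "bounded_oper a" "bounded_oper b"
  shows "T \<circ> (a + b) = (T \<circ> a) + (T \<circ> b)"
  using assms by (auto simp: fun_eq_iff bdd_add[OF assms(1)] bdd_in_l2)

lemma oper_comp_scale:
  assumes "bounded_oper T" "bounded_oper a"
  shows "T \<circ> oscale c a = oscale c (T \<circ> a)"
  using assms by (auto simp: fun_eq_iff oscale_def bdd_scale bdd_in_l2)

lemma scale_comp: "oscale c a \<circ> T = oscale c (a \<circ> T)"
  and add_comp: "(a + b) \<circ> T = (a \<circ> T) + (b \<circ> T)"
  by (auto simp: oscale_def fun_eq_iff)

subsection \<open>Matrix coefficients\<close>

definition ket :: "'i \<Rightarrow> 'i vec" where
  "ket p = (\<lambda>i. if i = p then 1 else 0)"

lemma ket_l2 [simp]: "ket p \<in> l2"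
  by (rule l2_finite_support[of "{p}"]) (auto simp: ket_def)

lemma bdd_ket_expansion_finite:
  assumes "bounded_oper T" "finite F"
  shows "T (\<lambda>i. if i \<in> F then x i else 0) = (\<lambda>i. \<Sum>p\<in>F. x p * T (ket p) i)"
  using assms(2)
proof (induction F rule: finite_induct)
  case empty
  then show ?case using bdd_zero[OF assms(1)] by (simp add: zero_fun_def)
next
  case (insert q F)
  let ?t = "\<lambda>F i. if i \<in> F then x i else 0"
  have t: "?t F \<in> l2"
    using insert.hyps by (intro l2_finite_support[of F]) auto
  have "?t (insert q F) = (\<lambda>i. x q * ket q i) + ?t F"
    using insert.hyps by (auto simp: ket_def fun_eq_iff)
  then have "T (?t (insert q F)) = T (\<lambda>i. x q * ket q i) + T (?t F)"
    using bdd_add[OF assms(1) l2_scale(1)[OF ket_l2] t] by simp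
  also have "\<dots> = (\<lambda>i. x q * T (ket q) i) + (\<lambda>i. \<Sum>p\<in>F. x p * T (ket p) i)"
    by (simp only: bdd_scale[OF assms(1) ket_l2] insert.IH)
  finally show ?case using insert.hyps by (simp add: plus_fun_def)
qed

text \<open>Matrix coefficients determine a bounded operator: the finite truncations of \<open>x\<close> converge to \<open>x\<close>
  in norm, and on a truncation the formula is linearity. This is what later reduces identities between
  operators on a tensor product to elementary tensors of basis vectors.\<close>

lemma bdd_has_sum:
  assumes T: "bounded_oper T" and x: "x \<in> l2"
  shows "((\<lambda>p. x p * T (ket p) i) has_sum T x i) UNIV"
proof -
  obtain C where C0: "0 \<le> C" and C: "\<And>x. l2norm (T x) \<le> C * l2norm x" using bdd_bound[OF T] by blast
  let ?n = "\<lambda>i. (cmod (x i))\<^sup>2"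
  let ?t = "\<lambda>F i. if i \<in> F then x i else 0"
  have s: "?n summable_on UNIV" using x by (simp add: l2_def)
  have tl: "?t F \<in> l2" if "finite F" for F using that by (intro l2_finite_support[of F]) auto
  have bound: "cmod ((\<Sum>p\<in>F. x p * T (ket p) i) - T x i) \<le> C * sqrt (infsum ?n UNIV - sum ?n F)"
    if F: "finite F" for F
  proof -
    have "(l2norm (x - ?t F))\<^sup>2 = infsum (\<lambda>i. if i \<in> F then 0 else ?n i) UNIV"
      unfolding l2norm_def
      by (simp add: infsum_nonneg) (intro infsum_cong, auto)
    also have "\<dots> = infsum ?n (UNIV - F)"
      by (rule infsum_cong_neutral) auto
    also have "\<dots> = infsum ?n UNIV - sum ?n F"
      using F s by (subst infsum_Diff) auto
    finally have n: "l2norm (x - ?t F) = sqrt (infsum ?n UNIV - sum ?n F)"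
      by (metis l2norm_nonneg real_sqrt_unique)
    have "(\<Sum>p\<in>F. x p * T (ket p) i) - T x i = - T (x - ?t F) i"
      using bdd_ket_expansion_finite[OF T F, of x] bdd_diff[OF T x tl[OF F]] by simp
    then have "cmod ((\<Sum>p\<in>F. x p * T (ket p) i) - T x i) \<le> l2norm (T (x - ?t F))"
      using cmod_le_l2norm[OF bdd_in_l2[OF T], of "x - ?t F" i] by simp
    also have "\<dots> \<le> C * l2norm (x - ?t F)" by (rule C)
    finally show ?thesis using n by simp
  qed
  have "((\<lambda>F. sum ?n F) \<longlongrightarrow> infsum ?n UNIV) (finite_subsets_at_top UNIV)"
    using has_sum_infsum[OF s] by (simp add: has_sum_def)
  then have "((\<lambda>F. C * sqrt (infsum ?n UNIV - sum ?n F)) \<longlongrightarrow> C * sqrt (infsum ?n UNIV - infsum ?n UNIV))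
     (finite_subsets_at_top UNIV)"
    by (intro tendsto_intros)
  then have "((\<lambda>F. C * sqrt (infsum ?n UNIV - sum ?n F)) \<longlongrightarrow> 0) (finite_subsets_at_top UNIV)"
    by simp
  then have "((\<lambda>F. (\<Sum>p\<in>F. x p * T (ket p) i) - T x i) \<longlongrightarrow> 0) (finite_subsets_at_top UNIV)"
    by (rule Lim_null_comparison[rotated])
       (auto intro!: eventually_finite_subsets_at_top_weakI bound)
  then show ?thesis
    unfolding has_sum_def by (simp add: LIM_zero_iff)
qed

lemma oper_eqI:
  assumes "bounded_oper S" "bounded_oper T" "\<And>p i. S (ket p) i = T (ket p) i"
  shows "S = T"
proof (rule ext)
  fix x show "S x = T x"
  proof (cases "x \<in> l2")
    case True
    then have "((\<lambda>p. x p * T (ket p) i) has_sum S x i) UNIV" for i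
      using bdd_has_sum[OF assms(1) True, of i] assms(3) by simp
    then show ?thesis using bdd_has_sum[OF assms(2) True] by (auto simp: fun_eq_iff intro: has_sum_unique)
  qed (use assms in \<open>simp add: bdd_outside\<close>)
qed

lemma l2inner_ket: "l2inner (ket p) y = y p"
proof -
  have "l2inner (ket p) y = infsum (\<lambda>i. y i) {p}"
    unfolding l2inner_def by (rule infsum_cong_neutral) (auto simp: ket_def)
  then show ?thesis by simp
qed

lemma adjoint_unique:
  assumes "bounded_oper S" "is_adjoint T S" "bounded_oper S'" "is_adjoint T S'"
  shows "S = S'"
proof (rule oper_eqI[OF assms(1,3)])
  fix p i
  have "S (ket p) i = l2inner (T (ket i)) (ket p)"
    using assms(2) by (simp add: is_adjoint_def l2inner_ket)
  then show "S (ket p) i = S' (ket p) i"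
    using assms(4) by (simp add: is_adjoint_def l2inner_ket)
qed

lemma adj_eqI: "bounded_oper S \<Longrightarrow> is_adjoint T S \<Longrightarrow> adj T = S"
  unfolding adj_def by (rule the_equality) (auto intro: adjoint_unique)

section \<open>Tensor products of operators\<close>

text \<open>\<open>1 \<otimes> S\<close> and \<open>T \<otimes> 1\<close>. An operator \<open>T \<otimes>\<^sub>o S\<close> is their product, and each of them is bounded because
  applying \<open>S\<close> to every slice of \<open>x\<close> scales the sum of the squared norms of the slices by at most
  a constant.\<close>

definition leg2 :: "'j oper \<Rightarrow> ('i \<times> 'j) oper" where
  "leg2 S x = (if x \<in> l2 then (\<lambda>(i, j). S (\<lambda>j'. x (i, j')) j) else 0)"

definition leg1 :: "'i oper \<Rightarrow> ('i \<times> 'j) oper" where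
  "leg1 T x = (if x \<in> l2 then (\<lambda>(i, j). T (\<lambda>i'. x (i', j)) i) else 0)"

definition swapv :: "('i \<times> 'j) vec \<Rightarrow> ('j \<times> 'i) vec" where
  "swapv x = (\<lambda>(i, j). x (j, i))"

lemma swapv_l2 [simp]: "swapv x \<in> l2 \<longleftrightarrow> x \<in> l2"
  and l2norm_swapv [simp]: "l2norm (swapv x) = l2norm x"
proof -
  have b: "bij_betw prod.swap (UNIV :: ('a \<times> 'b) set) UNIV" by (simp add: bij_betw_def)
  have e: "(\<lambda>i. (cmod (swapv x i))\<^sup>2) = (\<lambda>i. (\<lambda>i. (cmod (x i))\<^sup>2) (prod.swap i))"
    by (auto simp: swapv_def fun_eq_iff)
  show "swapv x \<in> l2 \<longleftrightarrow> x \<in> l2"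
    unfolding l2_def mem_Collect_eq e by (subst summable_on_reindex_bij_betw) (auto simp: bij_betw_def)
  show "l2norm (swapv x) = l2norm x"
    unfolding l2norm_def e by (subst infsum_reindex_bij_betw) (auto simp: bij_betw_def)
qed

lemma l2_slice2:
  fixes x :: "('a \<times> 'b) vec"
  assumes "x \<in> l2" shows "(\<lambda>j. x (i, j)) \<in> l2"
    and "finite G \<Longrightarrow> (\<Sum>i\<in>G. (l2norm (\<lambda>j. x (i, j)))\<^sup>2) \<le> (l2norm x)\<^sup>2"
proof -
  let ?n = "\<lambda>p. (cmod (x p))\<^sup>2"
  have s: "?n summable_on UNIV" using assms by (simp add: l2_def)
  have sl: "(\<lambda>j. ?n (i, j)) summable_on UNIV" for i
  proof -
    have "?n summable_on ({i} \<times> UNIV)" using s by (rule summable_on_subset_banach) auto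
    moreover have "{i} \<times> UNIV = Pair i ` (UNIV :: 'b set)" by auto
    ultimately have "?n summable_on Pair i ` (UNIV :: 'b set)" by metis
    then have "(?n \<circ> Pair i) summable_on UNIV"
      by (subst (asm) summable_on_reindex) (auto simp: inj_on_def)
    then show ?thesis by (simp add: o_def)
  qed
  then show "(\<lambda>j. x (i, j)) \<in> l2" by (simp add: l2_def)
  show "(\<Sum>i\<in>G. (l2norm (\<lambda>j. x (i, j)))\<^sup>2) \<le> (l2norm x)\<^sup>2" if "finite G"
  proof -
    have sg: "?n summable_on (G \<times> UNIV)" using s by (rule summable_on_subset_banach) auto
    have "(\<Sum>i\<in>G. (l2norm (\<lambda>j. x (i, j)))\<^sup>2) = infsum (\<lambda>i. infsum (\<lambda>j. ?n (i, j)) UNIV) G"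
      using that by (simp add: l2norm_def infsum_nonneg)
    also have "\<dots> = infsum ?n (G \<times> UNIV)"
      by (rule infsum_Sigma_banach[OF sg])
    also have "\<dots> \<le> infsum ?n UNIV"
      by (rule infsum_mono_neutral[OF sg s]) auto
    finally show ?thesis by (simp add: l2norm_def infsum_nonneg)
  qed
qed

lemma bounded_leg2:
  assumes S: "bounded_oper S" shows "bounded_oper (leg2 S :: ('i \<times> 'j) oper)"
proof -
  obtain C where C0: "0 \<le> C" and C: "\<And>x. l2norm (S x) \<le> C * l2norm x" using bdd_bound[OF S] by blast
  have main: "leg2 S x \<in> l2 \<and> l2norm (leg2 S x) \<le> C * l2norm x" if x: "x \<in> l2" for x :: "('i \<times> 'j) vec"
  proof -
    have "(\<Sum>p\<in>F. (cmod (leg2 S x p))\<^sup>2) \<le> (C * l2norm x)\<^sup>2" if F: "finite F" for F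
    proof -
      let ?G = "fst ` F" and ?H = "snd ` F"
      have "(\<Sum>p\<in>F. (cmod (leg2 S x p))\<^sup>2) \<le> (\<Sum>p\<in>?G \<times> ?H. (cmod (leg2 S x p))\<^sup>2)"
        using F by (intro sum_mono2) (auto simp: rev_image_eqI)
      also have "\<dots> = (\<Sum>i\<in>?G. \<Sum>j\<in>?H. (cmod (S (\<lambda>j'. x (i, j')) j))\<^sup>2)"
        using x by (simp add: sum.cartesian_product leg2_def case_prod_beta)
      also have "\<dots> \<le> (\<Sum>i\<in>?G. (l2norm (S (\<lambda>j'. x (i, j'))))\<^sup>2)"
        using F by (intro sum_mono l2_sum_le bdd_in_l2[OF S]) auto
      also have "\<dots> \<le> (\<Sum>i\<in>?G. (C * l2norm (\<lambda>j'. x (i, j')))\<^sup>2)"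
        by (intro sum_mono power_mono C) auto
      also have "\<dots> = C\<^sup>2 * (\<Sum>i\<in>?G. (l2norm (\<lambda>j'. x (i, j')))\<^sup>2)"
        by (simp add: sum_distrib_left power_mult_distrib)
      also have "\<dots> \<le> C\<^sup>2 * (l2norm x)\<^sup>2"
        using F by (intro mult_left_mono l2_slice2(2)[OF x]) auto
      finally show ?thesis by (simp add: power_mult_distrib)
    qed
    then show ?thesis using l2norm_leI[of "leg2 S x" "C * l2norm x"] C0 by auto
  qed
  show ?thesis
  proof (rule bounded_operI[where C = C])
    fix x y :: "('i \<times> 'j) vec" assume xy: "x \<in> l2" "y \<in> l2"
    show "leg2 S (x + y) = leg2 S x + leg2 S y"
      using xy l2_add(1)[OF xy]
        bdd_add[OF S l2_slice2(1)[OF xy(1)] l2_slice2(1)[OF xy(2)]]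
      by (auto simp: leg2_def fun_eq_iff plus_fun_def)
  next
    fix c and x :: "('i \<times> 'j) vec" assume x: "x \<in> l2"
    show "leg2 S (\<lambda>i. c * x i) = (\<lambda>i. c * leg2 S x i)"
      using x l2_scale(1)[OF x, of c] bdd_scale[OF S l2_slice2(1)[OF x]]
      by (auto simp: leg2_def fun_eq_iff)
  qed (use main in \<open>auto simp: leg2_def\<close>)
qed

lemma leg1_swap: "leg1 T x = swapv (leg2 T (swapv x))"
  by (auto simp: leg1_def leg2_def swapv_def[of "\<lambda>_. _"] fun_eq_iff)
     (auto simp: swapv_def)

text \<open>The flip of the two tensor factors is isometric and exchanges the two legs, so that only one of them
  needs an estimate.\<close>

lemma bounded_leg1:
  assumes T: "bounded_oper T" shows "bounded_oper (leg1 T :: ('i \<times> 'j) oper)"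
proof -
  have B: "bounded_oper (leg2 T :: ('j \<times> 'i) oper)" by (rule bounded_leg2[OF T])
  obtain C where C: "\<And>x. l2norm ((leg2 T :: ('j \<times> 'i) oper) x) \<le> C * l2norm x" using bdd_bound[OF B] by blast
  have sa: "swapv (x + y) = swapv x + swapv y" for x y :: "('a \<times> 'b) vec"
    by (auto simp: swapv_def)
  have ss: "swapv (\<lambda>i. c * x i) = (\<lambda>i. c * swapv x i)" for c and x :: "('a \<times> 'b) vec"
    by (auto simp: swapv_def)
  show ?thesis
  proof (rule bounded_operI[where C = C])
    show "leg1 T x \<in> l2" for x :: "('i \<times> 'j) vec" by (simp add: leg1_swap bdd_in_l2[OF B])
    show "l2norm (leg1 T x) \<le> C * l2norm x" for x :: "('i \<times> 'j) vec"
      using C[of "swapv x"] by (simp add: leg1_swap)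
    show "leg1 T (x + y) = leg1 T x + leg1 T y" if "x \<in> l2" "y \<in> l2" for x y :: "('i \<times> 'j) vec"
      using that by (simp add: leg1_swap sa bdd_add[OF B])
    show "leg1 T (\<lambda>i. c * x i) = (\<lambda>i. c * leg1 T x i)" if "x \<in> l2" for c and x :: "('i \<times> 'j) vec"
      using that by (simp add: leg1_swap ss bdd_scale[OF B])
  qed (auto simp: leg1_def)
qed

lemma otensor_legs:
  assumes "bounded_oper S" "bounded_oper T" shows "T \<otimes>\<^sub>o S = leg1 T \<circ> leg2 S"
proof
  fix x :: "('b \<times> 'a) vec"
  show "(T \<otimes>\<^sub>o S) x = (leg1 T \<circ> leg2 S) x"
  proof (cases "x \<in> l2")
    case True
    then have "leg2 S x \<in> l2" by (rule bdd_l2[OF bounded_leg2[OF assms(1)]])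
    then show ?thesis using True by (auto simp: otensor_def leg1_def leg2_def)
  next
    case False
    then show ?thesis
      using bdd_zero[OF bounded_leg1[OF assms(2)]]
      by (simp add: otensor_def leg2_def)
  qed
qed

lemma bounded_otensor:
  assumes "bounded_oper S" "bounded_oper T" shows "bounded_oper (T \<otimes>\<^sub>o S)"
  using assms by (simp add: otensor_legs bounded_oper_comp bounded_leg1 bounded_leg2)

definition tvec :: "'i vec \<Rightarrow> 'j vec \<Rightarrow> ('i \<times> 'j) vec" where
  "tvec x y = (\<lambda>(i, j). x i * y j)"

lemma ket_pair: "ket (p, q) = tvec (ket p) (ket q)"
  by (auto simp: ket_def tvec_def)

lemma tvec_l2:
  assumes x: "x \<in> l2" and y: "y \<in> l2" shows "tvec x y \<in> l2"
proof (rule l2_boundI(1)[where K = "(l2norm x)\<^sup>2 * (l2norm y)\<^sup>2"])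
  fix F :: "('a \<times> 'b) set" assume F: "finite F"
  have "(\<Sum>p\<in>F. (cmod (tvec x y p))\<^sup>2) \<le> (\<Sum>p\<in>fst ` F \<times> snd ` F. (cmod (tvec x y p))\<^sup>2)"
    using F by (intro sum_mono2) (auto simp: rev_image_eqI)
  also have "\<dots> = (\<Sum>i\<in>fst ` F. (cmod (x i))\<^sup>2) * (\<Sum>j\<in>snd ` F. (cmod (y j))\<^sup>2)"
    by (simp add: sum_product sum.cartesian_product tvec_def case_prod_beta norm_mult power_mult_distrib)
  also have "\<dots> \<le> (l2norm x)\<^sup>2 * (l2norm y)\<^sup>2"
    using F by (intro mult_mono l2_sum_le x y) (auto simp: sum_nonneg)
  finally show "(\<Sum>p\<in>F. (cmod (tvec x y p))\<^sup>2) \<le> (l2norm x)\<^sup>2 * (l2norm y)\<^sup>2" .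
qed

lemma leg2_tvec:
  assumes "bounded_oper S" "x \<in> l2" "y \<in> l2" shows "leg2 S (tvec x y) = tvec x (S y)"
  using assms bdd_scale[OF assms(1,3)] by (simp add: leg2_def tvec_l2) (simp add: tvec_def fun_eq_iff)

lemma leg1_tvec:
  assumes "bounded_oper T" "x \<in> l2" "y \<in> l2" shows "leg1 T (tvec x y) = tvec (T x) y"
proof -
  have "swapv (tvec x y) = tvec y x" "swapv (tvec y (T x)) = tvec (T x) y"
    by (auto simp: swapv_def tvec_def)
  then show ?thesis using assms by (simp add: leg1_swap leg2_tvec)
qed

lemma otensor_tvec:
  assumes "bounded_oper S" "bounded_oper T" "x \<in> l2" "y \<in> l2"
  shows "(T \<otimes>\<^sub>o S) (tvec x y) = tvec (T x) (S y)"
  using assms by (simp add: otensor_legs leg1_tvec leg2_tvec bdd_in_l2)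

text \<open>On an elementary tensor of basis vectors both sides are elementary tensors again, and bounded
  operators that agree there are equal.\<close>

lemma otensor_comp:
  assumes "bounded_oper a" "bounded_oper b" "bounded_oper c" "bounded_oper d"
  shows "(a \<otimes>\<^sub>o b) \<circ> (c \<otimes>\<^sub>o d) = (a \<circ> c) \<otimes>\<^sub>o (b \<circ> d)"
proof (rule oper_eqI)
  fix p i show "((a \<otimes>\<^sub>o b) \<circ> (c \<otimes>\<^sub>o d)) (ket p) i = ((a \<circ> c) \<otimes>\<^sub>o (b \<circ> d)) (ket p) i"
    using assms by (cases p) (simp add: ket_pair otensor_tvec bdd_in_l2 bounded_oper_comp)
qed (simp_all add: assms bounded_otensor bounded_oper_comp)

lemma tvec_apply: "tvec x y (i, j) = x i * y j"
  by (simp add: tvec_def)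

lemma oscale_apply: "oscale c T x i = c * T x i"
  by (simp add: oscale_def)

lemma tvec_linear:
  "tvec (x + x') y = tvec x y + tvec x' y" "tvec x (y + y') = tvec x y + tvec x y'"
  "tvec (\<lambda>i. c * x i) y = (\<lambda>p. c * tvec x y p)" "tvec x (\<lambda>i. c * y i) = (\<lambda>p. c * tvec x y p)"
  by (auto simp: tvec_def fun_eq_iff algebra_simps)

lemma otensor_linear:
  assumes "bounded_oper a" "bounded_oper a'" "bounded_oper b" "bounded_oper b'"
  shows "(a + a') \<otimes>\<^sub>o b = (a \<otimes>\<^sub>o b) + (a' \<otimes>\<^sub>o b)"
    and "a \<otimes>\<^sub>o (b + b') = (a \<otimes>\<^sub>o b) + (a \<otimes>\<^sub>o b')"
    and "oscale c a \<otimes>\<^sub>o b = oscale c (a \<otimes>\<^sub>o b)"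
    and "a \<otimes>\<^sub>o oscale c b = oscale c (a \<otimes>\<^sub>o b)"
proof -
  note simps = assms bounded_otensor bounded_oper_add bounded_oper_scale otensor_tvec ket_pair tvec_linear
  show "(a + a') \<otimes>\<^sub>o b = (a \<otimes>\<^sub>o b) + (a' \<otimes>\<^sub>o b)"
    by (rule oper_eqI) (auto simp: simps)
  show "a \<otimes>\<^sub>o (b + b') = (a \<otimes>\<^sub>o b) + (a \<otimes>\<^sub>o b')"
    by (rule oper_eqI) (auto simp: simps)
  show "oscale c a \<otimes>\<^sub>o b = oscale c (a \<otimes>\<^sub>o b)"
    by (rule oper_eqI) (auto simp: simps oscale_apply tvec_apply)
  show "a \<otimes>\<^sub>o oscale c b = oscale c (a \<otimes>\<^sub>o b)"
    by (rule oper_eqI) (auto simp: simps oscale_apply tvec_apply)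
qed

lemma otensor_zero:
  assumes "bounded_oper a" shows "0 \<otimes>\<^sub>o a = 0" "a \<otimes>\<^sub>o 0 = 0"
  using otensor_linear(3,4)[OF assms assms assms assms, of 0]
    otensor_linear(3)[OF bounded_oper_zero bounded_oper_zero assms assms, of 0]
    otensor_linear(4)[OF assms assms bounded_oper_zero bounded_oper_zero, of 0] by simp_all

lemma oflip_eq: "oflip T = swapv \<circ> T \<circ> swapv"
  by (auto simp: oflip_def swapv_def fun_eq_iff case_prod_beta')

lemma bounded_oflip: assumes "bounded_oper T" shows "bounded_oper (oflip T)"
proof -
  obtain C where C: "\<And>x. l2norm (T x) \<le> C * l2norm x" using bdd_bound[OF assms] by blast
  have sa: "swapv (x + y) = swapv x + swapv y" for x y :: "('a \<times> 'b) vec"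
    by (auto simp: swapv_def)
  have ss: "swapv (\<lambda>i. c * x i) = (\<lambda>i. c * swapv x i)" for c and x :: "('a \<times> 'b) vec"
    by (auto simp: swapv_def)
  have s0: "swapv (0 :: ('a \<times> 'b) vec) = 0" by (auto simp: swapv_def)
  show ?thesis
  proof (rule bounded_operI[where C = C])
    show "l2norm (oflip T x) \<le> C * l2norm x" for x using C[of "swapv x"] by (simp add: oflip_eq)
    show "oflip T (x + y) = oflip T x + oflip T y" if "x \<in> l2" "y \<in> l2" for x y
      using that by (simp add: oflip_eq sa bdd_add[OF assms])
    show "oflip T (\<lambda>i. c * x i) = (\<lambda>i. c * oflip T x i)" if "x \<in> l2" for x c
      using that by (simp add: oflip_eq ss bdd_scale[OF assms])
    show "oflip T x = 0" if "x \<notin> l2" for x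
      using that by (simp add: oflip_eq bdd_outside[OF assms] s0)
  qed (simp add: oflip_eq bdd_in_l2[OF assms])
qed

lemma oflip_otensor:
  assumes "bounded_oper a" "bounded_oper b" shows "oflip (a \<otimes>\<^sub>o b) = b \<otimes>\<^sub>o a"
proof (rule oper_eqI)
  have sw: "swapv (tvec x y) = tvec y x" for x y :: "'a vec" by (auto simp: swapv_def tvec_def)
  fix p i show "oflip (a \<otimes>\<^sub>o b) (ket p) i = (b \<otimes>\<^sub>o a) (ket p) i"
    using assms by (cases p) (simp add: oflip_eq ket_pair sw otensor_tvec)
qed (simp_all add: assms bounded_otensor bounded_oflip)

lemma oflip_linear: "oflip (S + T) = oflip S + oflip T" "oflip (oscale c T) = oscale c (oflip T)"
  by (auto simp: oflip_def oscale_def fun_eq_iff)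

lemma oassoc_linear: "oassoc (S + T) = oassoc S + oassoc T" "oassoc (oscale c T) = oscale c (oassoc T)"
  by (auto simp: oassoc_def oscale_def fun_eq_iff)

lemma l2_assoc:
  "(\<lambda>((i, j), k). x (i, j, k)) \<in> l2 \<longleftrightarrow> x \<in> l2"
proof -
  let ?h = "\<lambda>((i, j), k). (i, j, k)"
  have b: "bij_betw ?h UNIV UNIV"
    by (rule bij_betwI[where g = "\<lambda>(i, j, k). ((i, j), k)"]) auto
  have e: "(\<lambda>p. (cmod ((\<lambda>((i, j), k). x (i, j, k)) p))\<^sup>2) = (\<lambda>p. (\<lambda>p. (cmod (x p))\<^sup>2) (?h p))"
    by (auto simp: fun_eq_iff)
  show ?thesis unfolding l2_def mem_Collect_eq e
    by (rule summable_on_reindex_bij_betw[OF b])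
qed

text \<open>Both sides apply \<open>c\<close>, \<open>b\<close> and \<open>a\<close> in this order to the three variables. The only point is that the
  slices met on the way are square summable, since \<open>\<otimes>\<^sub>o\<close> is cut off outside \<^const>\<open>l2\<close>.\<close>

lemma oassoc_otensor:
  assumes a: "bounded_oper a" and b: "bounded_oper b" and c: "bounded_oper c"
  shows "oassoc ((a \<otimes>\<^sub>o b) \<otimes>\<^sub>o c) = a \<otimes>\<^sub>o (b \<otimes>\<^sub>o c)"
proof (rule ext)
  fix x :: "('a \<times> 'a \<times> 'a) vec"
  let ?x = "\<lambda>((i, j), k). x (i, j, k)"
  show "oassoc ((a \<otimes>\<^sub>o b) \<otimes>\<^sub>o c) x = (a \<otimes>\<^sub>o (b \<otimes>\<^sub>o c)) x"
  proof (cases "x \<in> l2")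
    case True
    then have x': "?x \<in> l2" by (simp add: l2_assoc)
    have "leg2 c ?x \<in> l2" by (rule bdd_in_l2[OF bounded_leg2[OF c]])
    then have "swapv (leg2 c ?x) \<in> l2" by simp
    then have sl: "(\<lambda>p. swapv (leg2 c ?x) (k, p)) \<in> l2" for k by (rule l2_slice2(1))
    have "(\<lambda>(i', j'). c (\<lambda>k'. x (i', j', k')) k) = (\<lambda>p. swapv (leg2 c ?x) (k, p))" for k
      using x' by (simp add: swapv_def leg2_def fun_eq_iff)
    with sl have sl: "(\<lambda>(i', j'). c (\<lambda>k'. x (i', j', k')) k) \<in> l2" for k by simp
    have sr: "(\<lambda>p. x (i, p)) \<in> l2" for i using l2_slice2(1)[OF True] .
    show ?thesis using True x' sl sl[unfolded case_prod_beta'] sr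
      by (auto simp: oassoc_def otensor_def fun_eq_iff case_prod_beta)
  next
    case False
    then have "?x \<notin> l2" by (simp add: l2_assoc)
    then show ?thesis using False by (auto simp: oassoc_def otensor_def fun_eq_iff)
  qed
qed

section \<open>Finite-dimensional spaces of operators\<close>

lemma bounded_oper_diff: "bounded_oper S \<Longrightarrow> bounded_oper T \<Longrightarrow> bounded_oper (S - T)"
  using ops.subspace_diff[OF bounded_oper_subspace] by auto

lemma opnorm_bound:
  assumes T: "bounded_oper T" and x: "x \<in> l2"
  shows "l2norm (T x) \<le> opnorm T * l2norm x"
proof (cases "l2norm x = 0")
  case True
  then have "x = 0" using cmod_le_l2norm[OF x] by (auto simp: fun_eq_iff)
  then show ?thesis by (simp add: bdd_zero[OF T])
next
  case False
  then have pos: "0 < l2norm x" using l2norm_nonneg[of x] by linarith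
  obtain C where C0: "0 \<le> C" and C: "\<And>x. l2norm (T x) \<le> C * l2norm x" using bdd_bound[OF T] by blast
  have bdd: "bdd_above {l2norm (T x) |x. x \<in> l2 \<and> l2norm x \<le> 1}"
  proof (rule bdd_aboveI[of _ C], clarify)
    fix y :: "'a vec" assume "l2norm y \<le> 1"
    then have "C * l2norm y \<le> C * 1" using C0 by (intro mult_left_mono)
    then show "l2norm (T y) \<le> C" using C[of y] by simp
  qed
  let ?y = "\<lambda>i. of_real (1 / l2norm x) * x i"
  have "l2norm ?y = 1"
    using pos by (simp only: l2_scale[OF x] norm_of_real) simp
  moreover have "?y \<in> l2" by (rule l2_scale[OF x])
  ultimately have "l2norm (T ?y) \<le> opnorm T"
    unfolding opnorm_def by (intro cSup_upper[OF _ bdd]) (auto intro!: exI[of _ ?y])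
  moreover have "l2norm (T ?y) = l2norm (T x) / l2norm x"
    using pos by (simp only: bdd_scale[OF T x] l2_scale[OF bdd_in_l2[OF T]] norm_of_real) simp
  ultimately show ?thesis using pos by (simp add: divide_le_eq)
qed

lemma opnorm_conv_pointwise:
  assumes X: "\<And>n. bounded_oper (X n)" and T: "bounded_oper T"
    and lim: "(\<lambda>n. opnorm (X n - T)) \<longlonglongrightarrow> 0"
  shows "(\<lambda>n. X n x i) \<longlonglongrightarrow> T x i"
proof (cases "x \<in> l2")
  case True
  have le: "cmod (X n x i - T x i) \<le> opnorm (X n - T) * l2norm x" for n
  proof -
    have b: "bounded_oper (X n - T)" by (intro bounded_oper_diff X T)
    have "cmod ((X n - T) x i) \<le> l2norm ((X n - T) x)"
      by (rule cmod_le_l2norm[OF bdd_in_l2[OF b]])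
    also have "\<dots> \<le> opnorm (X n - T) * l2norm x" by (rule opnorm_bound[OF b True])
    finally show ?thesis by simp
  qed
  have "eventually (\<lambda>n. cmod (X n x i - T x i) \<le> opnorm (X n - T) * l2norm x) sequentially"
    using le by (rule eventuallyI)
  moreover have "(\<lambda>n. opnorm (X n - T) * l2norm x) \<longlonglongrightarrow> 0"
    using tendsto_mult_left_zero[OF lim] .
  ultimately have "(\<lambda>n. X n x i - T x i) \<longlonglongrightarrow> 0"
    by (rule Lim_null_comparison)
  then show ?thesis by (simp add: LIM_zero_iff)
qed (simp add: bdd_outside[OF X] bdd_outside[OF T])

lemma norm_closure_superset:
  assumes "\<And>T. T \<in> S \<Longrightarrow> bounded_oper T" shows "S \<subseteq> norm_closure S"
proof
  fix T assume T: "T \<in> S"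
  have "{l2norm ((0 :: 'a oper) x) |x. x \<in> l2 \<and> l2norm x \<le> 1} = {0}"
    by (auto intro: exI[of _ 0])
  then have "opnorm (0 :: 'a oper) = 0" by (simp add: opnorm_def)
  then show "T \<in> norm_closure S"
    unfolding norm_closure_def using T assms by (auto intro!: exI[of _ "\<lambda>_. T"])
qed

text \<open>The linear functionals spanned by the matrix coefficients \<open>T \<mapsto> T y j\<close>. They are defined on all
  operators, continuous for pointwise convergence, and have slice maps given by an explicit formula;
  on a finite-dimensional space of bounded operators every linear functional is of this form.\<close>

inductive_set evalf :: "('i oper \<Rightarrow> complex) set" where
  zero: "(\<lambda>T. 0) \<in> evalf"
| coeff: "y \<in> l2 \<Longrightarrow> (\<lambda>T. T y j) \<in> evalf"
| add: "\<phi> \<in> evalf \<Longrightarrow> \<psi> \<in> evalf \<Longrightarrow> (\<lambda>T. \<phi> T + \<psi> T) \<in> evalf"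
| scale: "\<phi> \<in> evalf \<Longrightarrow> (\<lambda>T. c * \<phi> T) \<in> evalf"

lemma evalf_add: "\<phi> \<in> evalf \<Longrightarrow> \<phi> (S + T) = \<phi> S + \<phi> T"
  by (induction rule: evalf.induct) (auto simp: algebra_simps)

lemma evalf_scale: "\<phi> \<in> evalf \<Longrightarrow> \<phi> (oscale c T) = c * \<phi> T"
  by (induction rule: evalf.induct) (auto simp: algebra_simps oscale_apply)

lemma evalf_0: "\<phi> \<in> evalf \<Longrightarrow> \<phi> 0 = 0"
  by (induction rule: evalf.induct) auto

lemma evalf_sum: "\<phi> \<in> evalf \<Longrightarrow> \<phi> (\<Sum>a\<in>A. F a) = (\<Sum>a\<in>A. \<phi> (F a))"
  by (induction A rule: infinite_finite_induct) (auto simp: evalf_add evalf_0)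

lemma evalf_closed_sum:
  "(\<And>a. a \<in> A \<Longrightarrow> \<phi> a \<in> evalf) \<Longrightarrow> (\<lambda>T. \<Sum>a\<in>A. c a * \<phi> a T) \<in> evalf"
proof (induction A rule: infinite_finite_induct)
  case (insert a A)
  have "(\<lambda>T. c a * \<phi> a T + (\<Sum>a\<in>A. c a * \<phi> a T)) \<in> evalf"
    using insert by (intro evalf.add evalf.scale) auto
  then show ?case using insert.hyps by simp
qed (auto intro: evalf.zero)

lemma evalf_tendsto:
  assumes "\<phi> \<in> evalf" "\<And>x i. (\<lambda>n. X n x i) \<longlonglongrightarrow> T x i"
  shows "(\<lambda>n. \<phi> (X n)) \<longlonglongrightarrow> \<phi> T"
  using assms(1) by (induction rule: evalf.induct) (auto intro!: tendsto_intros assms(2))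

text \<open>By induction on the basis: the component of the new vector \<open>u\<close> transversal to the span of the others
  is a non-zero operator, hence has a non-zero matrix coefficient, and this coefficient separates \<open>u\<close>
  from them.\<close>

lemma dual_basis:
  assumes "finite S" "ops.independent S" "\<And>s. s \<in> S \<Longrightarrow> bounded_oper s"
  shows "\<exists>\<phi>. \<forall>s\<in>S. \<phi> s \<in> evalf \<and> (\<forall>t\<in>S. \<phi> s t = (if t = s then 1 else 0))"
  using assms
proof (induction S rule: finite_induct)
  case (insert u S)
  have u: "u \<notin> ops.span S" and ind: "ops.independent S"
    using insert.prems(1) insert.hyps(2) by (metis ops.independent_insert)+
  have "\<exists>\<phi>. \<forall>s\<in>S. \<phi> s \<in> evalf \<and> (\<forall>t\<in>S. \<phi> s t = (if t = s then 1 else 0))"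
    by (rule insert.IH[OF ind insert.prems(2)]) simp
  then obtain \<phi> where "\<forall>s\<in>S. \<phi> s \<in> evalf \<and> (\<forall>t\<in>S. \<phi> s t = (if t = s then 1 else 0))"
    by (rule exE)
  then have \<phi>: "\<And>s. s \<in> S \<Longrightarrow> \<phi> s \<in> evalf"
      "\<And>s t. s \<in> S \<Longrightarrow> t \<in> S \<Longrightarrow> \<phi> s t = (if t = s then 1 else 0)"
    by auto
  define r where "r T = T - (\<Sum>s\<in>S. oscale (\<phi> s T) s)" for T
  have rS: "r t = 0" if "t \<in> S" for t
  proof -
    have "(\<Sum>s\<in>S. oscale (\<phi> s t) s) = (\<Sum>s\<in>S. if s = t then oscale 1 t else 0)"
      using that \<phi> by (intro sum.cong) auto
    then show ?thesis using that insert.hyps by (simp add: r_def)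
  qed
  have "r u \<noteq> 0"
  proof
    assume "r u = 0"
    then have "u = (\<Sum>s\<in>S. oscale (\<phi> s u) s)" by (simp add: r_def)
    moreover have "(\<Sum>s\<in>S. oscale (\<phi> s u) s) \<in> ops.span S"
      by (intro ops.span_sum ops.span_scale ops.span_base)
    ultimately show False using u by simp
  qed
  moreover have "bounded_oper (r u)"
    unfolding r_def using insert.prems(2)
    by (intro bounded_oper_diff bounded_oper_span[of S "\<Sum>s\<in>S. oscale (\<phi> s u) s"]
        ops.span_sum ops.span_scale ops.span_base) auto
  ultimately have "\<exists>y. y \<in> l2 \<and> r u y \<noteq> 0"
    by (metis bdd_outside ext zero_fun_apply)
  then obtain y j where yj: "y \<in> l2" "r u y j \<noteq> 0"
    by (metis ext zero_fun_apply)
  have comp: "(\<Sum>a\<in>A. F a) y j = (\<Sum>a\<in>A. F a y j)" for A and F :: "'a oper \<Rightarrow> 'a oper"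
    by (induction A rule: infinite_finite_induct) auto
  define \<psi> where "\<psi> T = r T y j / r u y j" for T
  have "\<psi> = (\<lambda>T. (1 / r u y j) * (T y j + (\<Sum>s\<in>S. (- s y j) * \<phi> s T)))"
    unfolding \<psi>_def by (rule ext) (simp add: r_def[of T for T] comp oscale_apply sum_negf mult.commute)
  moreover have "(\<lambda>T. (1 / r u y j) * (T y j + (\<Sum>s\<in>S. (- s y j) * \<phi> s T))) \<in> evalf"
    using \<phi>(1) yj(1) by (intro evalf.scale evalf.add evalf.coeff evalf_closed_sum)
  ultimately have \<psi>e: "\<psi> \<in> evalf" by simp
  have \<psi>u: "\<psi> u = 1" and \<psi>S: "\<And>t. t \<in> S \<Longrightarrow> \<psi> t = 0"
    using yj rS by (auto simp: \<psi>_def)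
  define \<omega> where "\<omega> s = (if s = u then \<psi> else (\<lambda>T. \<phi> s T + (- \<phi> s u) * \<psi> T))" for s
  have \<omega>u: "\<omega> u = \<psi>" by (simp add: \<omega>_def)
  have \<omega>S: "\<omega> s = (\<lambda>T. \<phi> s T + (- \<phi> s u) * \<psi> T)" if "s \<in> S" for s
    using that insert.hyps(2) by (auto simp: \<omega>_def)
  have "\<omega> s \<in> evalf" if "s \<in> insert u S" for s
    using that
  proof
    assume "s \<in> S"
    then show ?thesis unfolding \<omega>S[OF \<open>s \<in> S\<close>]
      by (intro evalf.add[OF \<phi>(1) evalf.scale[OF \<psi>e]])
  qed (simp add: \<omega>u \<psi>e)
  moreover have "\<omega> s t = (if t = s then 1 else 0)" if st: "s \<in> insert u S" "t \<in> insert u S" for s t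
  proof -
    consider "s = u" "t = u" | "s = u" "t \<in> S" | "s \<in> S" "t = u" | "s \<in> S" "t \<in> S" using st by blast
    then show ?thesis
      by cases (use insert.hyps(2) \<psi>u \<psi>S \<phi>(2) in \<open>auto simp: \<omega>u \<omega>S\<close>)
  qed
  ultimately show ?case by (intro exI[of _ \<omega>] ballI conjI)
qed simp

lemma span_expand_dual:
  assumes "finite S" "T \<in> ops.span S" "\<And>s. s \<in> S \<Longrightarrow> \<phi> s \<in> evalf"
    "\<And>s t. s \<in> S \<Longrightarrow> t \<in> S \<Longrightarrow> \<phi> s t = (if t = s then 1 else 0)"
  shows "T = (\<Sum>s\<in>S. oscale (\<phi> s T) s)"
proof -
  obtain c where T: "T = (\<Sum>s\<in>S. oscale (c s) s)"
    using assms(1,2) by (auto simp: ops.span_finite)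
  have "\<phi> s T = c s" if "s \<in> S" for s
  proof -
    have "\<phi> s T = (\<Sum>t\<in>S. c t * \<phi> s t)"
      using assms(3)[OF that] by (simp add: T evalf_sum evalf_scale)
    also have "\<dots> = (\<Sum>t\<in>S. if t = s then c s else 0)"
      using that assms(4) by (intro sum.cong) auto
    finally show ?thesis using that assms(1) by simp
  qed
  then have e: "(\<Sum>s\<in>S. oscale (\<phi> s T) s) = (\<Sum>s\<in>S. oscale (c s) s)" by (intro sum.cong) auto
  show ?thesis by (rule trans[OF T e[symmetric]])
qed

lemma finite_basis_of_subspace:
  assumes "ops.subspace V" "finite S" "V \<subseteq> ops.span S"
  obtains B where "finite B" "ops.independent B" "V = ops.span B" "card B \<le> card S"
proof -
  obtain B where B: "B \<subseteq> V" "ops.independent B" "V \<subseteq> ops.span B"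
    using ops.maximal_independent_subset by blast
  have "finite B \<and> card B \<le> card S"
    using ops.independent_span_bound[OF assms(2) B(2)] B(1) assms(3) by blast
  moreover have "ops.span B \<subseteq> V" using B(1) assms(1) by (rule ops.span_minimal)
  ultimately show ?thesis using that B by blast
qed

text \<open>Norm convergence implies convergence of all matrix coefficients, hence of the coordinates with
  respect to a basis whose dual basis consists of such functionals; so the limit has the same expansion.
  Thus for finite-dimensional algebras all closures in the definition of a compact quantum group
  disappear.\<close>

lemma norm_closure_findim:
  assumes V: "ops.subspace V" "finite S" "V \<subseteq> ops.span S"
    and bdd: "\<And>T. T \<in> V \<Longrightarrow> bounded_oper T"
  shows "norm_closure V = V"
proof
  show "V \<subseteq> norm_closure V" using norm_closure_superset[of V] bdd by blast
  obtain B where B: "finite B" "ops.independent B" "V = ops.span B"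
    using finite_basis_of_subspace[OF V] by blast
  have "bounded_oper s" if "s \<in> B" for s using that B(3) bdd ops.span_base by auto
  then have "\<exists>\<phi>. \<forall>s\<in>B. \<phi> s \<in> evalf \<and> (\<forall>t\<in>B. \<phi> s t = (if t = s then 1 else 0))"
    by (rule dual_basis[OF B(1,2)])
  then obtain \<phi> where "\<forall>s\<in>B. \<phi> s \<in> evalf \<and> (\<forall>t\<in>B. \<phi> s t = (if t = s then 1 else 0))"
    by (rule exE)
  then have \<phi>: "\<And>s. s \<in> B \<Longrightarrow> \<phi> s \<in> evalf"
      "\<And>s t. s \<in> B \<Longrightarrow> t \<in> B \<Longrightarrow> \<phi> s t = (if t = s then 1 else 0)"
    by auto
  show "norm_closure V \<subseteq> V"
  proof
    fix T assume "T \<in> norm_closure V"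
    then obtain X where T: "bounded_oper T" and X: "\<And>n. X n \<in> V" "(\<lambda>n. opnorm (X n - T)) \<longlonglongrightarrow> 0"
      unfolding norm_closure_def by blast
    have lim: "(\<lambda>n. X n x i) \<longlonglongrightarrow> T x i" for x i
      using opnorm_conv_pointwise[of X T] bdd X T by blast
    have comp: "(\<Sum>a\<in>A. F a) x i = (\<Sum>a\<in>A. F a x i)" for A x i and F :: "'a oper \<Rightarrow> 'a oper"
      by (induction A rule: infinite_finite_induct) auto
    have "T x i = (\<Sum>s\<in>B. oscale (\<phi> s T) s) x i" for x i
    proof (rule LIMSEQ_unique[OF lim])
      have "X n x i = (\<Sum>s\<in>B. \<phi> s (X n) * s x i)" for n
      proof -
        have "X n = (\<Sum>s\<in>B. oscale (\<phi> s (X n)) s)"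
          using X(1)[of n, unfolded B(3)] span_expand_dual[OF B(1), of "X n" \<phi>] \<phi> by blast
        then have "X n x i = (\<Sum>s\<in>B. oscale (\<phi> s (X n)) s) x i" by simp
        then show ?thesis by (simp only: comp oscale_apply)
      qed
      moreover have "(\<lambda>n. \<Sum>s\<in>B. \<phi> s (X n) * s x i) \<longlonglongrightarrow> (\<Sum>s\<in>B. \<phi> s T * s x i)"
      proof (rule tendsto_sum)
        fix s assume "s \<in> B"
        then have "(\<lambda>n. \<phi> s (X n)) \<longlonglongrightarrow> \<phi> s T"
          using evalf_tendsto[of "\<phi> s" X T] \<phi>(1) lim by blast
        then show "(\<lambda>n. \<phi> s (X n) * s x i) \<longlonglongrightarrow> \<phi> s T * s x i"
          by (rule tendsto_mult_right)
      qed
      ultimately show "(\<lambda>n. X n x i) \<longlonglongrightarrow> (\<Sum>s\<in>B. oscale (\<phi> s T) s) x i"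
        by (simp add: comp oscale_apply)
    qed
    then have "(\<Sum>s\<in>B. oscale (\<phi> s T) s) = T" by (auto intro!: ext)
    moreover have "(\<Sum>s\<in>B. oscale (\<phi> s T) s) \<in> V"
      unfolding B(3) by (intro ops.span_sum ops.span_scale ops.span_base)
    ultimately show "T \<in> V" by (simp only:)
  qed
qed

lemma findim_functional_evalf:
  fixes \<phi> :: "'i oper \<Rightarrow> complex"
  assumes "finite S" "\<And>s. s \<in> S \<Longrightarrow> bounded_oper s"
    and add: "\<And>a b. a \<in> ops.span S \<Longrightarrow> b \<in> ops.span S \<Longrightarrow> \<phi> (a + b) = \<phi> a + \<phi> b"
    and scale: "\<And>c a. a \<in> ops.span S \<Longrightarrow> \<phi> (oscale c a) = c * \<phi> a"
  obtains \<psi> where "\<psi> \<in> evalf" "\<And>T. T \<in> ops.span S \<Longrightarrow> \<psi> T = \<phi> T"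
proof -
  obtain B where B: "finite B" "ops.independent B" "ops.span S = ops.span B"
    by (rule finite_basis_of_subspace[OF ops.subspace_span assms(1) order_refl])
  have "bounded_oper s" if "s \<in> B" for s
    using that B(3) ops.span_base bounded_oper_span[OF assms(2)] by metis
  then have "\<exists>\<theta>. \<forall>s\<in>B. \<theta> s \<in> evalf \<and> (\<forall>t\<in>B. \<theta> s t = (if t = s then 1 else 0))"
    by (rule dual_basis[OF B(1,2)])
  then obtain \<theta> where "\<forall>s\<in>B. \<theta> s \<in> evalf \<and> (\<forall>t\<in>B. \<theta> s t = (if t = s then 1 else 0))"
    by (rule exE)
  then have \<theta>: "\<And>s. s \<in> B \<Longrightarrow> \<theta> s \<in> evalf"
      "\<And>s t. s \<in> B \<Longrightarrow> t \<in> B \<Longrightarrow> \<theta> s t = (if t = s then 1 else 0)"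
    by auto
  have z: "\<phi> 0 = 0" using scale[of 0 0] ops.span_zero[of S] by simp
  have sum: "\<phi> (\<Sum>a\<in>A. F a) = (\<Sum>a\<in>A. \<phi> (F a))" if "\<And>a. a \<in> A \<Longrightarrow> F a \<in> ops.span S"
    for A and F :: "'i oper \<Rightarrow> 'i oper"
    using that by (induction A rule: infinite_finite_induct) (auto simp: z add ops.span_sum)
  show ?thesis
  proof (rule that[of "\<lambda>T. \<Sum>s\<in>B. \<phi> s * \<theta> s T"])
    show "(\<lambda>T. \<Sum>s\<in>B. \<phi> s * \<theta> s T) \<in> evalf" using \<theta> by (intro evalf_closed_sum)
    fix T assume T: "T \<in> ops.span S"
    have b: "s \<in> ops.span S" if "s \<in> B" for s using that B(3) ops.span_base by auto
    have "T \<in> ops.span B" using T B(3) by simp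
    then have "T = (\<Sum>s\<in>B. oscale (\<theta> s T) s)"
      using span_expand_dual[OF B(1), of T \<theta>] \<theta> by blast
    then have "\<phi> T = \<phi> (\<Sum>s\<in>B. oscale (\<theta> s T) s)" by (rule arg_cong)
    also have "\<dots> = (\<Sum>s\<in>B. \<phi> (oscale (\<theta> s T) s))"
      using b by (intro sum ops.span_scale)
    also have "\<dots> = (\<Sum>s\<in>B. \<phi> s * \<theta> s T)"
      using b by (intro sum.cong) (simp_all add: scale mult.commute)
    finally show "(\<Sum>s\<in>B. \<phi> s * \<theta> s T) = \<phi> T" by simp
  qed
qed

subsection \<open>Slice maps\<close>

text \<open>The slice map \<open>id \<otimes> \<phi>\<close>. It is linear on all operators, not only on a tensor product of algebras,
  which spares a choice of bases.\<close>

definition is_slice :: "('j oper \<Rightarrow> complex) \<Rightarrow> (('i \<times> 'j) oper \<Rightarrow> 'i oper) \<Rightarrow> bool" where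
  "is_slice \<phi> L \<longleftrightarrow> (\<forall>S T. L (S + T) = L S + L T) \<and> (\<forall>c T. L (oscale c T) = oscale c (L T)) \<and>
     (\<forall>a b. bounded_oper a \<and> bounded_oper b \<longrightarrow> L (a \<otimes>\<^sub>o b) = oscale (\<phi> b) a)"

text \<open>For the coefficient \<open>T \<mapsto> T y j\<close> the slice of \<open>T\<close> sends \<open>x\<close> to the partial function \<open>i \<mapsto> T (x \<otimes> y) (i, j)\<close>;
  linear combinations of functionals have the corresponding combinations of slices.\<close>

lemma slice_exists:
  fixes \<phi> :: "'j oper \<Rightarrow> complex"
  assumes "\<phi> \<in> evalf" shows "\<exists>L :: ('i \<times> 'j) oper \<Rightarrow> 'i oper. is_slice \<phi> L"
  using assms
proof (induction rule: evalf.induct)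
  case zero
  then show ?case by (intro exI[of _ "\<lambda>_. 0"]) (auto simp: is_slice_def oscale_def fun_eq_iff)
next
  case (coeff y j)
  let ?L = "\<lambda>(T :: ('i \<times> 'j) oper) (x :: 'i vec) i. if x \<in> l2 then T (tvec x y) (i, j) else 0"
  have "is_slice (\<lambda>T. T y j) ?L"
    unfolding is_slice_def
  proof (intro conjI allI impI)
    fix a :: "'i oper" and b :: "'j oper" assume "bounded_oper a \<and> bounded_oper b"
    then show "?L (a \<otimes>\<^sub>o b) = oscale (b y j) a"
      using coeff by (auto simp: fun_eq_iff otensor_tvec tvec_apply oscale_apply bdd_outside)
  qed (auto simp: fun_eq_iff oscale_apply)
  then show ?case by blast
next
  case (add \<phi> \<psi>)
  then obtain L M where "is_slice \<phi> (L :: ('i \<times> 'j) oper \<Rightarrow> _)" "is_slice \<psi> (M :: ('i \<times> 'j) oper \<Rightarrow> _)" by blast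
  then show ?case
    by (intro exI[of _ "\<lambda>T. L T + M T"]) (auto simp: is_slice_def fun_eq_iff oscale_apply algebra_simps)
next
  case (scale \<phi> c)
  then obtain L where "is_slice \<phi> (L :: ('i \<times> 'j) oper \<Rightarrow> _)" by blast
  then show ?case
    by (intro exI[of _ "\<lambda>T. oscale c (L T)"]) (auto simp: is_slice_def fun_eq_iff oscale_apply algebra_simps)
qed

subsection \<open>Tensor products of finite-dimensional spaces\<close>

definition findim :: "'i oper set \<Rightarrow> bool" where
  "findim A \<longleftrightarrow> (\<exists>S. finite S \<and> A = ops.span S \<and> (\<forall>s\<in>S. bounded_oper s))"

lemma findim_bdd: "findim A \<Longrightarrow> a \<in> A \<Longrightarrow> bounded_oper a"
  unfolding findim_def using bounded_oper_span by metis

lemma findim_subspace: "findim A \<Longrightarrow> ops.subspace A"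
  unfolding findim_def by auto

lemma findim_norm_closure:
  assumes "findim A" "V \<subseteq> A" "ops.subspace V" shows "norm_closure V = V"
proof -
  obtain S where S: "finite S" "A = ops.span S" using assms(1) by (auto simp: findim_def)
  show ?thesis
  proof (rule norm_closure_findim[OF assms(3) S(1)])
    show "V \<subseteq> ops.span S" using assms(2) S(2) by simp
    show "bounded_oper T" if "T \<in> V" for T using that assms(2) findim_bdd[OF assms(1)] by blast
  qed
qed

lemma otensor_in_span:
  assumes bdd: "\<And>s. s \<in> S \<Longrightarrow> bounded_oper s" "\<And>t. t \<in> S' \<Longrightarrow> bounded_oper t"
    and a: "a \<in> ops.span S" and b: "b \<in> ops.span S'"
  shows "a \<otimes>\<^sub>o b \<in> ops.span ((\<lambda>(s, t). s \<otimes>\<^sub>o t) ` (S \<times> S'))" (is "_ \<in> ops.span ?W")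
proof -
  have 1: "s \<otimes>\<^sub>o b \<in> ops.span ?W" if s: "s \<in> S" for s
  proof -
    have "ops.span S' \<subseteq> {b. bounded_oper b \<and> s \<otimes>\<^sub>o b \<in> ops.span ?W}"
    proof (rule ops.span_minimal)
      show "S' \<subseteq> {b. bounded_oper b \<and> s \<otimes>\<^sub>o b \<in> ops.span ?W}"
        using bdd s by (auto intro!: ops.span_base)
      show "ops.subspace {b. bounded_oper b \<and> s \<otimes>\<^sub>o b \<in> ops.span ?W}"
        unfolding ops.subspace_def using bdd(1)[OF s]
        by (auto simp: otensor_linear otensor_zero bounded_oper_zero bounded_oper_add bounded_oper_scale
              ops.span_zero ops.span_add ops.span_scale)
    qed
    then show ?thesis using b by blast
  qed
  have bb: "bounded_oper b" by (rule bounded_oper_span[OF bdd(2) b])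
  have "ops.span S \<subseteq> {a. bounded_oper a \<and> a \<otimes>\<^sub>o b \<in> ops.span ?W}"
  proof (rule ops.span_minimal)
    show "S \<subseteq> {a. bounded_oper a \<and> a \<otimes>\<^sub>o b \<in> ops.span ?W}"
      using bdd 1 by auto
    show "ops.subspace {a. bounded_oper a \<and> a \<otimes>\<^sub>o b \<in> ops.span ?W}"
      unfolding ops.subspace_def using bb
      by (auto simp: otensor_linear otensor_zero bounded_oper_zero bounded_oper_add bounded_oper_scale
            ops.span_zero ops.span_add ops.span_scale)
  qed
  then show ?thesis using a by blast
qed

lemma ctensor_findim_span:
  assumes "finite S" "finite S'" "\<And>s. s \<in> S \<Longrightarrow> bounded_oper s" "\<And>t. t \<in> S' \<Longrightarrow> bounded_oper t"
  shows "ops.span S \<otimes>\<^sub>C ops.span S' = ops.span ((\<lambda>(s, t). s \<otimes>\<^sub>o t) ` (S \<times> S'))"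
proof -
  let ?W = "(\<lambda>(s, t). s \<otimes>\<^sub>o t) ` (S \<times> S')"
  let ?E = "{a \<otimes>\<^sub>o b |a b. a \<in> ops.span S \<and> b \<in> ops.span S'}"
  have "?E \<subseteq> ops.span ?W"
    using otensor_in_span[of S S'] assms(3,4) by blast
  then have "ops.span ?E \<subseteq> ops.span ?W" by (intro ops.span_minimal ops.subspace_span)
  moreover have "?W \<subseteq> ?E" by (auto intro: ops.span_base)
  then have "ops.span ?W \<subseteq> ops.span ?E" by (rule ops.span_mono)
  ultimately have e: "ops.span ?E = ops.span ?W" by (rule antisym)
  have "findim (ops.span ?W)"
    unfolding findim_def using assms by (intro exI[of _ ?W]) (auto simp: bounded_otensor)
  then show ?thesis
    unfolding ctensor_def e by (intro findim_norm_closure[of "ops.span ?W"]) auto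
qed

lemma ctensor_findim:
  assumes A: "findim A" and B: "findim B"
  shows "findim (A \<otimes>\<^sub>C B)" "A \<otimes>\<^sub>C B = ops.span {a \<otimes>\<^sub>o b |a b. a \<in> A \<and> b \<in> B}"
proof -
  obtain S where S: "finite S" "A = ops.span S" "\<And>s. s \<in> S \<Longrightarrow> bounded_oper s"
    using A unfolding findim_def by metis
  obtain S' where S': "finite S'" "B = ops.span S'" "\<And>s. s \<in> S' \<Longrightarrow> bounded_oper s"
    using B unfolding findim_def by metis
  let ?W = "(\<lambda>(s, t). s \<otimes>\<^sub>o t) ` (S \<times> S')"
  have e: "A \<otimes>\<^sub>C B = ops.span ?W"
    unfolding S(2) S'(2) using S S' by (intro ctensor_findim_span)
  show f: "findim (A \<otimes>\<^sub>C B)"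
    unfolding e findim_def using S S' by (intro exI[of _ ?W]) (auto simp: bounded_otensor)
  have "{a \<otimes>\<^sub>o b |a b. a \<in> A \<and> b \<in> B} \<subseteq> ops.span ?W"
    unfolding S(2) S'(2) using otensor_in_span[of S S'] S(3) S'(3) by blast
  then have "{a \<otimes>\<^sub>o b |a b. a \<in> A \<and> b \<in> B} \<subseteq> A \<otimes>\<^sub>C B" using e by simp
  then have sub: "ops.span {a \<otimes>\<^sub>o b |a b. a \<in> A \<and> b \<in> B} \<subseteq> A \<otimes>\<^sub>C B"
    by (intro ops.span_minimal findim_subspace[OF f])
  show "A \<otimes>\<^sub>C B = ops.span {a \<otimes>\<^sub>o b |a b. a \<in> A \<and> b \<in> B}"
    unfolding ctensor_def by (rule findim_norm_closure[OF f sub ops.subspace_span])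
qed

lemma otensor_in_ctensor:
  assumes "findim A" "findim B" "a \<in> A" "b \<in> B" shows "a \<otimes>\<^sub>o b \<in> A \<otimes>\<^sub>C B"
  unfolding ctensor_findim(2)[OF assms(1,2)] using assms(3,4) by (auto intro!: ops.span_base)

text \<open>Linear identities on a tensor product of finite-dimensional algebras need only be checked on
  elementary tensors.\<close>

lemma ctensor_induct [consumes 3, case_names tensor zero add scale]:
  assumes "findim A" "findim B" "T \<in> A \<otimes>\<^sub>C B"
    and "\<And>a b. a \<in> A \<Longrightarrow> b \<in> B \<Longrightarrow> P (a \<otimes>\<^sub>o b)" "P 0"
    and "\<And>S T. S \<in> A \<otimes>\<^sub>C B \<Longrightarrow> T \<in> A \<otimes>\<^sub>C B \<Longrightarrow> P S \<Longrightarrow> P T \<Longrightarrow> P (S + T)"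
    and "\<And>c T. T \<in> A \<otimes>\<^sub>C B \<Longrightarrow> P T \<Longrightarrow> P (oscale c T)"
  shows "P T"
proof -
  have sub: "ops.subspace (A \<otimes>\<^sub>C B)" by (rule findim_subspace[OF ctensor_findim(1)[OF assms(1,2)]])
  have "ops.span {a \<otimes>\<^sub>o b |a b. a \<in> A \<and> b \<in> B} \<subseteq> {T \<in> A \<otimes>\<^sub>C B. P T}"
  proof (rule ops.span_minimal)
    show "{a \<otimes>\<^sub>o b |a b. a \<in> A \<and> b \<in> B} \<subseteq> {T \<in> A \<otimes>\<^sub>C B. P T}"
      using assms(4) otensor_in_ctensor[OF assms(1,2)] by blast
    show "ops.subspace {T \<in> A \<otimes>\<^sub>C B. P T}"
      using sub assms(5-7) unfolding ops.subspace_def by blast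
  qed
  then show ?thesis using assms(3) ctensor_findim(2)[OF assms(1,2)] by blast
qed

lemma unit_of_eqI: assumes "is_unit_of A e" shows "unit_of A = e"
  unfolding unit_of_def using assms
  by (intro the_equality) (auto simp: is_unit_of_def)

lemma is_unit_of_ctensor:
  assumes A: "findim A" and B: "findim B" and e: "is_unit_of A e" and f: "is_unit_of B f"
  shows "is_unit_of (A \<otimes>\<^sub>C B) (e \<otimes>\<^sub>o f)"
proof -
  have eA: "e \<in> A" and fB: "f \<in> B" using e f by (auto simp: is_unit_of_def)
  have bd: "bounded_oper e" "bounded_oper f" "bounded_oper (e \<otimes>\<^sub>o f)"
    using findim_bdd[OF A eA] findim_bdd[OF B fB] by (auto intro: bounded_otensor)
  have "(e \<otimes>\<^sub>o f) \<circ> T = T \<and> T \<circ> (e \<otimes>\<^sub>o f) = T" if "T \<in> A \<otimes>\<^sub>C B" for T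
    using A B that
  proof (induction rule: ctensor_induct)
    case (tensor a b)
    then show ?case using e f findim_bdd[OF A] findim_bdd[OF B] bd
      by (simp add: otensor_comp is_unit_of_def)
  next
    case zero
    then show ?case using bdd_zero[OF bd(3)] by (auto simp: fun_eq_iff zero_fun_def[symmetric])
  next
    case (add S T)
    then have "bounded_oper S" "bounded_oper T"
      using findim_bdd[OF ctensor_findim(1)[OF A B]] by auto
    then show ?case using add by (simp only: oper_comp_add[OF bd(3)] add_comp)
  next
    case (scale c T)
    then have "bounded_oper T"
      using findim_bdd[OF ctensor_findim(1)[OF A B]] by auto
    then show ?case using scale by (simp only: oper_comp_scale[OF bd(3)] scale_comp)
  qed
  then show ?thesis using otensor_in_ctensor[OF A B eA fB] by (simp add: is_unit_of_def)
qed

section \<open>Linear maps between spaces of operators\<close>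

definition lin_on :: "'i oper set \<Rightarrow> ('i oper \<Rightarrow> 'j oper) \<Rightarrow> bool" where
  "lin_on A f \<longleftrightarrow> (\<forall>a\<in>A. \<forall>b\<in>A. f (a + b) = f a + f b) \<and>
     (\<forall>c. \<forall>a\<in>A. f (oscale c a) = oscale c (f a))"

lemma lin_onD:
  assumes "lin_on X f"
  shows "a \<in> X \<Longrightarrow> b \<in> X \<Longrightarrow> f (a + b) = f a + f b" "a \<in> X \<Longrightarrow> f (oscale c a) = oscale c (f a)"
  using assms unfolding lin_on_def by blast+

lemma lin_on_zero:
  assumes "ops.subspace A" "lin_on A f" shows "f 0 = 0"
proof -
  have "0 \<in> A" using assms(1) by (rule ops.subspace_0)
  then have "f (oscale 0 0) = oscale 0 (f 0)" using assms(2) unfolding lin_on_def by blast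
  then show ?thesis by simp
qed

lemma lin_on_sum:
  assumes "ops.subspace A" "lin_on A f" "\<And>x. x \<in> X \<Longrightarrow> F x \<in> A"
  shows "f (\<Sum>x\<in>X. F x) = (\<Sum>x\<in>X. f (F x))"
  using assms(3)
proof (induction X rule: infinite_finite_induct)
  case (insert x X)
  then have "(\<Sum>x\<in>X. F x) \<in> A" using assms(1) by (intro ops.subspace_sum) auto
  moreover have "F x \<in> A" using insert.prems by simp
  ultimately have "f (F x + (\<Sum>x\<in>X. F x)) = f (F x) + f (\<Sum>x\<in>X. F x)"
    using assms(2) unfolding lin_on_def by blast
  moreover have "f (\<Sum>x\<in>X. F x) = (\<Sum>x\<in>X. f (F x))" using insert by blast
  ultimately show ?case by (simp only: sum.insert[OF insert.hyps(1,2)])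
qed (simp_all add: lin_on_zero[OF assms(1,2)])

lemma cstar_algebraD:
  assumes "cstar_algebra A"
  shows "a \<in> A \<Longrightarrow> bounded_oper a" "ops.subspace A" "a \<in> A \<Longrightarrow> b \<in> A \<Longrightarrow> a \<circ> b \<in> A"
    "is_unit_of A (unit_of A)"
proof -
  show "is_unit_of A (unit_of A)"
    using assms unit_of_eqI unfolding cstar_algebra_def by metis
qed (use assms in \<open>auto simp: cstar_algebra_def\<close>)

lemma star_homD:
  assumes "star_hom A B f"
  shows "lin_on A f" "a \<in> A \<Longrightarrow> f a \<in> B" "a \<in> A \<Longrightarrow> b \<in> A \<Longrightarrow> f (a \<circ> b) = f a \<circ> f b"
    "f (unit_of A) = unit_of B"
  using assms by (auto simp: star_hom_def lin_on_def)

section \<open>Group dual subgroups of finite quantum groups\<close>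

text \<open>A group dual subgroup \<open>\<pi> : C(G) \<rightarrow> C\<^sup>*(\<Lambda>)\<close> of a finite quantum group. Excluding the zero algebra ensures that
  the images of the elements of \<open>\<Lambda>\<close> are non-zero.\<close>

locale group_dual_subgroup =
  fixes \<Lambda> :: "'g monoid" and u :: "'g \<Rightarrow> 'j oper" and H :: "'j quantum_group"
    and G :: "'i quantum_group" and \<pi> :: "'i oper \<Rightarrow> 'j oper"
  assumes dual: "group_dual \<Lambda> u H" and sub: "quantum_subgroup G H \<pi>"
    and fin: "findim (alg G)" and nontrivial: "unit_of (alg H) \<noteq> 0"
begin

abbreviation "A \<equiv> alg G"
abbreviation "B \<equiv> alg H"
abbreviation "\<Delta> \<equiv> comult G"
abbreviation "\<Delta>' \<equiv> comult H"
abbreviation "\<Gamma> \<equiv> u ` carrier \<Lambda>"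
abbreviation "eA \<equiv> unit_of A"
abbreviation "eB \<equiv> unit_of B"

lemma G_cqg: "compact_quantum_group G" and H_cqg: "compact_quantum_group H"
  and pi_hom: "star_hom A B \<pi>" and pi_surj: "\<pi> ` A = B"
  using sub by (auto simp: quantum_subgroup_def)

lemma A_cstar: "cstar_algebra A" and Delta_hom: "star_hom A (A \<otimes>\<^sub>C A) \<Delta>"
  using G_cqg by (auto simp: compact_quantum_group_def)

lemma B_cstar: "cstar_algebra B" and Delta'_hom: "star_hom B (B \<otimes>\<^sub>C B) \<Delta>'"
  using H_cqg by (auto simp: compact_quantum_group_def)

lemmas A_bdd = cstar_algebraD(1)[OF A_cstar]
  and A_sub = cstar_algebraD(2)[OF A_cstar]
  and A_comp = cstar_algebraD(3)[OF A_cstar]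
  and A_unit = cstar_algebraD(4)[OF A_cstar]
  and B_bdd = cstar_algebraD(1)[OF B_cstar]
  and B_sub = cstar_algebraD(2)[OF B_cstar]
  and B_comp = cstar_algebraD(3)[OF B_cstar]
  and B_unit = cstar_algebraD(4)[OF B_cstar]
  and pi_lin = star_homD(1)[OF pi_hom]
  and pi_in = star_homD(2)[OF pi_hom]
  and pi_comp = star_homD(3)[OF pi_hom]
  and pi_unit = star_homD(4)[OF pi_hom]
  and Delta_lin = star_homD(1)[OF Delta_hom]
  and Delta_in = star_homD(2)[OF Delta_hom]
  and Delta_comp = star_homD(3)[OF Delta_hom]
  and Delta_unit = star_homD(4)[OF Delta_hom]
  and Delta'_lin = star_homD(1)[OF Delta'_hom]

lemma eA_in: "eA \<in> A" and eB_in: "eB \<in> B"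
  and eA_left: "a \<in> A \<Longrightarrow> eA \<circ> a = a" and eA_right: "a \<in> A \<Longrightarrow> a \<circ> eA = a"
  and eB_left: "b \<in> B \<Longrightarrow> eB \<circ> b = b" and eB_right: "b \<in> B \<Longrightarrow> b \<circ> eB = b"
  using A_unit B_unit by (auto simp: is_unit_of_def)

lemma pi_add: "a \<in> A \<Longrightarrow> b \<in> A \<Longrightarrow> \<pi> (a + b) = \<pi> a + \<pi> b"
  and pi_scale: "a \<in> A \<Longrightarrow> \<pi> (oscale c a) = oscale c (\<pi> a)"
  using pi_lin by (auto simp: lin_on_def)

lemma Delta_add: "a \<in> A \<Longrightarrow> b \<in> A \<Longrightarrow> \<Delta> (a + b) = \<Delta> a + \<Delta> b"
  and Delta_scale: "a \<in> A \<Longrightarrow> \<Delta> (oscale c a) = oscale c (\<Delta> a)"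
  using Delta_lin by (auto simp: lin_on_def)

lemma A_add: "a \<in> A \<Longrightarrow> b \<in> A \<Longrightarrow> a + b \<in> A" and A_scale: "a \<in> A \<Longrightarrow> oscale c a \<in> A"
  and A_0: "0 \<in> A"
  using A_sub by (auto simp: ops.subspace_def)

lemma findim_B: "findim B"
proof -
  obtain S where S: "finite S" "A = ops.span S" using fin by (auto simp: findim_def)
  have "ops.span (\<pi> ` S) \<subseteq> B"
    using S pi_in ops.span_base by (intro ops.span_minimal B_sub) auto
  moreover have "\<pi> a \<in> ops.span (\<pi> ` S)" if "a \<in> A" for a
  proof -
    have "ops.span S \<subseteq> {a \<in> A. \<pi> a \<in> ops.span (\<pi> ` S)}"
    proof (rule ops.span_minimal)
      show "S \<subseteq> {a \<in> A. \<pi> a \<in> ops.span (\<pi> ` S)}"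
        using S(2) by (auto intro: ops.span_base)
      show "ops.subspace {a \<in> A. \<pi> a \<in> ops.span (\<pi> ` S)}"
        unfolding ops.subspace_def
        by (auto simp: A_0 A_add A_scale pi_add pi_scale lin_on_zero[OF A_sub pi_lin]
            ops.span_zero ops.span_add ops.span_scale)
    qed
    then show ?thesis using that S(2) by blast
  qed
  then have "\<pi> ` A \<subseteq> ops.span (\<pi> ` S)" by (rule image_subsetI)
  then have "B \<subseteq> ops.span (\<pi> ` S)" by (simp only: pi_surj)
  ultimately have "B = ops.span (\<pi> ` S)" by (rule antisym[rotated])
  moreover have "bounded_oper s" if s: "s \<in> \<pi> ` S" for s
  proof -
    obtain x where x: "x \<in> S" "s = \<pi> x" using s by blast
    then have "x \<in> A" unfolding S(2) by (intro ops.span_base)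
    then show ?thesis using x(2) pi_in B_bdd by blast
  qed
  ultimately show ?thesis unfolding findim_def using S(1) by blast
qed

lemma Lambda_group: "group \<Lambda>" and u_in: "g \<in> carrier \<Lambda> \<Longrightarrow> u g \<in> B"
  and u_one: "u \<one>\<^bsub>\<Lambda>\<^esub> = eB"
  and u_mult: "g \<in> carrier \<Lambda> \<Longrightarrow> h \<in> carrier \<Lambda> \<Longrightarrow> u (g \<otimes>\<^bsub>\<Lambda>\<^esub> h) = u g \<circ> u h"
  and u_closure: "norm_closure (ops.span (u ` carrier \<Lambda>)) = B"
  and u_Delta: "g \<in> carrier \<Lambda> \<Longrightarrow> \<Delta>' (u g) = u g \<otimes>\<^sub>o u g"
  using dual by (auto simp: group_dual_def group_cstar_algebra_def)

lemma Gamma_in: "v \<in> \<Gamma> \<Longrightarrow> v \<in> B" and Gamma_Delta: "v \<in> \<Gamma> \<Longrightarrow> \<Delta>' v = v \<otimes>\<^sub>o v"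
  by (auto simp: u_in u_Delta)

lemma Gamma_bdd: "v \<in> \<Gamma> \<Longrightarrow> bounded_oper v"
  using Gamma_in B_bdd by blast

lemma Gamma_one: "eB \<in> \<Gamma>"
proof -
  have "\<one>\<^bsub>\<Lambda>\<^esub> \<in> carrier \<Lambda>"
    using group.is_monoid[OF Lambda_group] by (rule monoid.one_closed)
  then show ?thesis unfolding u_one[symmetric] by (rule imageI)
qed

lemma Gamma_comp:
  assumes "v \<in> \<Gamma>" "w \<in> \<Gamma>" shows "v \<circ> w \<in> \<Gamma>"
proof -
  obtain g h where g: "g \<in> carrier \<Lambda>" "v = u g" and h: "h \<in> carrier \<Lambda>" "w = u h"
    using assms by blast
  have "v \<circ> w = u (g \<otimes>\<^bsub>\<Lambda>\<^esub> h)" using g h by (simp only: u_mult)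
  moreover have "g \<otimes>\<^bsub>\<Lambda>\<^esub> h \<in> carrier \<Lambda>"
    using monoid.m_closed[OF group.is_monoid[OF Lambda_group]] g h by blast
  ultimately show ?thesis by blast
qed

lemma Gamma_inv:
  assumes "v \<in> \<Gamma>"
  obtains w where "w \<in> \<Gamma>" "v \<circ> w = eB" "w \<circ> v = eB"
proof -
  obtain g where g: "g \<in> carrier \<Lambda>" "v = u g" using assms by blast
  have i: "inv\<^bsub>\<Lambda>\<^esub> g \<in> carrier \<Lambda>" using g group.inv_closed[OF Lambda_group] by blast
  show ?thesis
  proof (rule that)
    show "u (inv\<^bsub>\<Lambda>\<^esub> g) \<in> \<Gamma>" using i by (rule imageI)
    show "v \<circ> u (inv\<^bsub>\<Lambda>\<^esub> g) = eB"
      using u_mult[OF g(1) i] group.r_inv[OF Lambda_group g(1)] u_one g(2) by metis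
    show "u (inv\<^bsub>\<Lambda>\<^esub> g) \<circ> v = eB"
      using u_mult[OF i g(1)] group.l_inv[OF Lambda_group g(1)] u_one g(2) by metis
  qed
qed

lemma Gamma_nonzero: "v \<in> \<Gamma> \<Longrightarrow> v \<noteq> 0"
proof
  assume "v \<in> \<Gamma>" "v = 0"
  then obtain w where "v \<circ> w = eB" using Gamma_inv by blast
  then have "eB = 0" using \<open>v = 0\<close> by (auto simp: fun_eq_iff)
  then show False using nontrivial by simp
qed

lemma Gamma_cancel:
  assumes "v \<in> \<Gamma>" "x \<in> B" "y \<in> B" "v \<circ> x = v \<circ> y" shows "x = y"
proof -
  obtain w where "w \<circ> v = eB" using Gamma_inv[OF assms(1)] by blast
  then show ?thesis using assms eB_left by (metis comp_assoc)
qed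

text \<open>The classical argument for group-like elements: if \<open>v = \<Sum> c\<^sub>s s\<close> then
  \<open>\<Sum> c\<^sub>s (v \<otimes> s) = v \<otimes> v = \<Sum> c\<^sub>s (s \<otimes> s)\<close>, and slicing the second leg with the coordinate of \<open>s\<close> gives
  \<open>c\<^sub>s v = c\<^sub>s s\<close>, so that all \<open>c\<^sub>s\<close> vanish when \<open>v\<close> is not one of the \<open>s\<close>.\<close>

lemma Gamma_indep_finite:
  assumes "finite F" "F \<subseteq> \<Gamma>" shows "ops.independent F"
  using assms
proof (induction F rule: finite_induct)
  case (insert v F)
  then have F: "ops.independent F" "F \<subseteq> \<Gamma>" and v: "v \<in> \<Gamma>" by auto
  have "v \<notin> ops.span F"
  proof
    assume vF: "v \<in> ops.span F"
    have "\<exists>\<phi>. \<forall>s\<in>F. \<phi> s \<in> evalf \<and> (\<forall>t\<in>F. \<phi> s t = (if t = s then 1 else 0))"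
      using F Gamma_bdd by (intro dual_basis[OF insert.hyps(1) F(1)]) blast
    then obtain \<phi> where "\<forall>s\<in>F. \<phi> s \<in> evalf \<and> (\<forall>t\<in>F. \<phi> s t = (if t = s then 1 else 0))"
      by (rule exE)
    then have \<phi>: "\<And>s. s \<in> F \<Longrightarrow> \<phi> s \<in> evalf"
        "\<And>s t. s \<in> F \<Longrightarrow> t \<in> F \<Longrightarrow> \<phi> s t = (if t = s then 1 else 0)"
      by auto
    have ve: "v = (\<Sum>s\<in>F. oscale (\<phi> s v) s)"
      using span_expand_dual[OF insert.hyps(1) vF, of \<phi>] \<phi> by blast
    have FB: "t \<in> B" if "t \<in> F" for t using that F(2) Gamma_in by blast
    have "\<Delta>' v = \<Delta>' (\<Sum>s\<in>F. oscale (\<phi> s v) s)" using ve by (rule arg_cong)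
    also have "\<dots> = (\<Sum>s\<in>F. \<Delta>' (oscale (\<phi> s v) s))"
      using FB B_sub by (intro lin_on_sum[OF B_sub Delta'_lin]) (auto simp: ops.subspace_scale)
    also have "\<dots> = (\<Sum>s\<in>F. oscale (\<phi> s v) (s \<otimes>\<^sub>o s))"
      using FB Delta'_lin F(2) Gamma_Delta by (intro sum.cong) (auto simp: lin_on_def)
    finally have vv: "v \<otimes>\<^sub>o v = (\<Sum>s\<in>F. oscale (\<phi> s v) (s \<otimes>\<^sub>o s))"
      using Gamma_Delta[OF v] by simp
    have "\<phi> s v = 0" if s: "s \<in> F" for s
    proof -
      obtain L :: "('j \<times> 'j) oper \<Rightarrow> 'j oper" where L: "is_slice (\<phi> s) L"
        using slice_exists[OF \<phi>(1)[OF s]] by blast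
      have L_lin: "lin_on UNIV L" using L by (auto simp: lin_on_def is_slice_def)
      have "oscale (\<phi> s v) v = L (v \<otimes>\<^sub>o v)"
        using L Gamma_bdd[OF v] by (simp add: is_slice_def)
      also have "\<dots> = (\<Sum>t\<in>F. L (oscale (\<phi> t v) (t \<otimes>\<^sub>o t)))"
        unfolding vv by (rule lin_on_sum[OF ops.subspace_UNIV L_lin]) simp
      also have "\<dots> = (\<Sum>t\<in>F. if t = s then oscale (\<phi> s v) s else 0)"
        using L B_bdd FB \<phi>(2)[OF s] by (intro sum.cong) (auto simp: is_slice_def)
      also have "\<dots> = oscale (\<phi> s v) s" using s insert.hyps(1) by simp
      finally have "oscale (\<phi> s v) v = oscale (\<phi> s v) s" .
      then show ?thesis using s insert.hyps(2) by (auto simp: ops.scale_cancel_left)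
    qed
    then have "(\<Sum>s\<in>F. oscale (\<phi> s v) s) = 0" by simp
    then show False using ve Gamma_nonzero[OF v] by simp
  qed
  then show ?case using F(1) insert.hyps(2) by (metis ops.independent_insert)
qed (rule ops.independent_empty)

lemma Gamma_finite: "finite \<Gamma>"
proof -
  obtain S where S: "finite S" "B = ops.span S" using findim_B by (auto simp: findim_def)
  have "finite \<Gamma> \<and> card \<Gamma> \<le> card S"
  proof (rule finite_if_finite_subsets_card_bdd)
    fix F assume F: "F \<subseteq> \<Gamma>" "finite F"
    have "F \<subseteq> ops.span S" using F(1) Gamma_in S(2) by blast
    then show "card F \<le> card S"
      using ops.independent_span_bound[OF S(1) Gamma_indep_finite[OF F(2,1)]] by simp
  qed
  then show ?thesis by simp
qed

lemma Gamma_indep: "ops.independent \<Gamma>"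
  by (rule Gamma_indep_finite[OF Gamma_finite order_refl])

lemma Gamma_span: "ops.span \<Gamma> = B"
proof -
  have "ops.span \<Gamma> \<subseteq> B" using Gamma_in by (intro ops.span_minimal B_sub) blast
  then show ?thesis using findim_norm_closure[OF findim_B _ ops.subspace_span] u_closure by metis
qed

end

section \<open>The grading of the algebra by the group\<close>

lemma is_sliceD:
  assumes "is_slice \<phi> L"
  shows "L (S + T) = L S + L T" "L (oscale c T) = oscale c (L T)" "L 0 = 0"
    "bounded_oper a \<Longrightarrow> bounded_oper b \<Longrightarrow> L (a \<otimes>\<^sub>o b) = oscale (\<phi> b) a"
    "lin_on UNIV L"
proof -
  show "L (S + T) = L S + L T" "L (oscale c T) = oscale c (L T)"
    "bounded_oper a \<Longrightarrow> bounded_oper b \<Longrightarrow> L (a \<otimes>\<^sub>o b) = oscale (\<phi> b) a"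
    using assms unfolding is_slice_def by blast+
  show l: "lin_on UNIV L" using assms unfolding is_slice_def lin_on_def by blast
  show "L 0 = 0" by (rule lin_on_zero[OF ops.subspace_UNIV l])
qed

context group_dual_subgroup
begin

text \<open>Coordinates on \<open>C(H)\<close> with respect to the basis \<open>\<Gamma>\<close>. The choice picks functionals spanned by matrix
  coefficients, so that they have slice maps.\<close>

definition coord :: "'j oper \<Rightarrow> 'j oper \<Rightarrow> complex" where
  "coord = (SOME \<phi>. \<forall>s\<in>\<Gamma>. \<phi> s \<in> evalf \<and> (\<forall>t\<in>\<Gamma>. \<phi> s t = (if t = s then 1 else 0)))"

lemma coord: "\<forall>s\<in>\<Gamma>. coord s \<in> evalf \<and> (\<forall>t\<in>\<Gamma>. coord s t = (if t = s then 1 else 0))"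
proof -
  have "\<exists>\<phi>. \<forall>s\<in>\<Gamma>. \<phi> s \<in> evalf \<and> (\<forall>t\<in>\<Gamma>. \<phi> s t = (if t = s then 1 else 0))"
    by (rule dual_basis[OF Gamma_finite Gamma_indep]) (rule Gamma_bdd)
  then show ?thesis unfolding coord_def by (rule someI_ex)
qed

lemma coord_evalf: "s \<in> \<Gamma> \<Longrightarrow> coord s \<in> evalf"
  and coord_Gamma: "s \<in> \<Gamma> \<Longrightarrow> t \<in> \<Gamma> \<Longrightarrow> coord s t = (if t = s then 1 else 0)"
  using coord by blast+

lemma coord_expand:
  assumes "b \<in> B" shows "b = (\<Sum>s\<in>\<Gamma>. oscale (coord s b) s)"
  using span_expand_dual[OF Gamma_finite, of b coord] coord_evalf coord_Gamma assms Gamma_span by blast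

lemma Delta'_expand:
  assumes "b \<in> B" shows "\<Delta>' b = (\<Sum>s\<in>\<Gamma>. oscale (coord s b) (s \<otimes>\<^sub>o s))"
proof -
  have "\<Delta>' b = \<Delta>' (\<Sum>s\<in>\<Gamma>. oscale (coord s b) s)" using coord_expand[OF assms] by (rule arg_cong)
  also have "\<dots> = (\<Sum>s\<in>\<Gamma>. \<Delta>' (oscale (coord s b) s))"
    by (intro lin_on_sum[OF B_sub Delta'_lin] ops.subspace_scale[OF B_sub] Gamma_in)
  also have "\<dots> = (\<Sum>s\<in>\<Gamma>. oscale (coord s b) (s \<otimes>\<^sub>o s))"
  proof (rule sum.cong[OF refl])
    fix s assume "s \<in> \<Gamma>"
    then show "\<Delta>' (oscale (coord s b) s) = oscale (coord s b) (s \<otimes>\<^sub>o s)"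
      using Delta'_lin Gamma_in[of s] Gamma_Delta[of s] unfolding lin_on_def by metis
  qed
  finally show ?thesis .
qed

lemma coord_comp:
  assumes g: "g \<in> \<Gamma>" and x: "x \<in> B" and y: "y \<in> B"
  shows "coord g (x \<circ> y) = (\<Sum>h\<in>\<Gamma>. \<Sum>k\<in>\<Gamma>. if h \<circ> k = g then coord h x * coord k y else 0)"
proof -
  let ?m = "\<lambda>a. a \<circ> y"
  have l1: "lin_on UNIV (\<lambda>a. a \<circ> y)" unfolding lin_on_def by (simp only: add_comp scale_comp) blast
  have l2: "lin_on B (\<lambda>a. h \<circ> a)" if "h \<in> \<Gamma>" for h
    unfolding lin_on_def
    using oper_comp_add[OF Gamma_bdd[OF that]] oper_comp_scale[OF Gamma_bdd[OF that]] B_bdd by blast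
  have "x \<circ> y = (\<Sum>h\<in>\<Gamma>. oscale (coord h x) h) \<circ> y"
    using coord_expand[OF x] by (rule arg_cong[where f = ?m])
  also have "\<dots> = (\<Sum>h\<in>\<Gamma>. oscale (coord h x) h \<circ> y)"
    by (rule lin_on_sum[OF ops.subspace_UNIV l1]) simp
  finally have xy: "x \<circ> y = (\<Sum>h\<in>\<Gamma>. oscale (coord h x) (h \<circ> y))" by (simp only: scale_comp)
  have hy: "h \<circ> y = (\<Sum>k\<in>\<Gamma>. oscale (coord k y) (h \<circ> k))" if h: "h \<in> \<Gamma>" for h
  proof -
    have "h \<circ> y = h \<circ> (\<Sum>k\<in>\<Gamma>. oscale (coord k y) k)"
      using coord_expand[OF y] by (rule arg_cong)
    also have "\<dots> = (\<Sum>k\<in>\<Gamma>. h \<circ> oscale (coord k y) k)"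
      by (intro lin_on_sum[OF B_sub l2[OF h]] ops.subspace_scale[OF B_sub] Gamma_in)
    also have "\<dots> = (\<Sum>k\<in>\<Gamma>. oscale (coord k y) (h \<circ> k))"
      by (intro sum.cong refl oper_comp_scale Gamma_bdd h)
    finally show ?thesis .
  qed
  have "coord g (x \<circ> y) = (\<Sum>h\<in>\<Gamma>. coord h x * coord g (h \<circ> y))"
    unfolding xy by (simp only: evalf_sum[OF coord_evalf[OF g]] evalf_scale[OF coord_evalf[OF g]])
  also have "\<dots> = (\<Sum>h\<in>\<Gamma>. \<Sum>k\<in>\<Gamma>. if h \<circ> k = g then coord h x * coord k y else 0)"
  proof (rule sum.cong[OF refl])
    fix h assume h: "h \<in> \<Gamma>"
    have "coord g (h \<circ> y) = (\<Sum>k\<in>\<Gamma>. coord k y * coord g (h \<circ> k))"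
      unfolding hy[OF h] by (simp only: evalf_sum[OF coord_evalf[OF g]] evalf_scale[OF coord_evalf[OF g]])
    also have "\<dots> = (\<Sum>k\<in>\<Gamma>. if h \<circ> k = g then coord k y else 0)"
      using coord_Gamma[OF g Gamma_comp[OF h]] by (intro sum.cong) auto
    finally show "coord h x * coord g (h \<circ> y) = (\<Sum>k\<in>\<Gamma>. if h \<circ> k = g then coord h x * coord k y else 0)"
      by (simp add: sum_distrib_left if_distrib cong: if_cong)
  qed
  finally show ?thesis .
qed

text \<open>The functional \<open>coord g \<circ> \<pi>\<close> on \<open>A\<close>, again replaced by a combination of matrix coefficients.\<close>

definition cf :: "'j oper \<Rightarrow> 'i oper \<Rightarrow> complex" where
  "cf g = (SOME \<psi>. \<psi> \<in> evalf \<and> (\<forall>a\<in>A. \<psi> a = coord g (\<pi> a)))"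

lemma cf: assumes g: "g \<in> \<Gamma>" shows "cf g \<in> evalf \<and> (\<forall>a\<in>A. cf g a = coord g (\<pi> a))"
proof -
  obtain S where S: "finite S" "A = ops.span S" "\<And>s. s \<in> S \<Longrightarrow> bounded_oper s"
    using fin unfolding findim_def by metis
  have "\<exists>\<psi>. \<psi> \<in> evalf \<and> (\<forall>a\<in>A. \<psi> a = coord g (\<pi> a))"
  proof (rule findim_functional_evalf[of S "\<lambda>a. coord g (\<pi> a)", OF S(1,3)])
    show "coord g (\<pi> (a + b)) = coord g (\<pi> a) + coord g (\<pi> b)"
      if "a \<in> ops.span S" "b \<in> ops.span S" for a b
      using that pi_add[of a b] by (simp only: S(2) evalf_add[OF coord_evalf[OF g]])
    show "coord g (\<pi> (oscale c a)) = c * coord g (\<pi> a)" if "a \<in> ops.span S" for a c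
      using that pi_scale[of a c] by (simp only: S(2) evalf_scale[OF coord_evalf[OF g]])
    fix \<psi> assume "\<psi> \<in> evalf" "\<And>T. T \<in> ops.span S \<Longrightarrow> \<psi> T = coord g (\<pi> T)"
    then show ?thesis using S(2) by blast
  qed
  then show ?thesis unfolding cf_def by (rule someI_ex)
qed

lemma cf_evalf: "g \<in> \<Gamma> \<Longrightarrow> cf g \<in> evalf" and cf_eq: "g \<in> \<Gamma> \<Longrightarrow> a \<in> A \<Longrightarrow> cf g a = coord g (\<pi> a)"
  using cf by blast+

definition sl :: "'j oper \<Rightarrow> ('i \<times> 'i) oper \<Rightarrow> 'i oper" where
  "sl g = (SOME L. is_slice (cf g) L)"

lemma sl: "g \<in> \<Gamma> \<Longrightarrow> is_slice (cf g) (sl g)"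
  unfolding sl_def using slice_exists[OF cf_evalf] by (rule someI_ex)

lemma sl_tensor: "g \<in> \<Gamma> \<Longrightarrow> a \<in> A \<Longrightarrow> b \<in> A \<Longrightarrow> sl g (a \<otimes>\<^sub>o b) = oscale (coord g (\<pi> b)) a"
  using is_sliceD(4)[OF sl A_bdd A_bdd] cf_eq by metis

lemmas sl_add = is_sliceD(1)[OF sl] and sl_scale = is_sliceD(2)[OF sl] and sl_0 = is_sliceD(3)[OF sl]

lemma sl_in: assumes g: "g \<in> \<Gamma>" and "T \<in> A \<otimes>\<^sub>C A" shows "sl g T \<in> A"
  using fin fin assms(2)
proof (induction rule: ctensor_induct)
  case (tensor a b)
  then show ?case using A_scale by (simp only: sl_tensor[OF g])
next
  case zero
  show ?case by (simp only: sl_0[OF g] A_0)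
next
  case (add S T)
  then show ?case by (simp only: sl_add[OF g] A_add)
next
  case (scale c T)
  then show ?case by (simp only: sl_scale[OF g] A_scale)
qed

text \<open>\<open>E g = (id \<otimes> coord g \<circ> \<pi>) \<Delta>\<close> is the projection of \<open>A\<close> onto the component of degree \<open>g\<close> of the
  grading that the coaction \<open>(id \<otimes> \<pi>) \<Delta>\<close> of the group dual defines on \<open>A\<close>.\<close>

definition E :: "'j oper \<Rightarrow> 'i oper \<Rightarrow> 'i oper" where
  "E g a = sl g (\<Delta> a)"

lemma E_in: "g \<in> \<Gamma> \<Longrightarrow> a \<in> A \<Longrightarrow> E g a \<in> A"
  unfolding E_def by (intro sl_in Delta_in)

lemma E_add: "g \<in> \<Gamma> \<Longrightarrow> a \<in> A \<Longrightarrow> b \<in> A \<Longrightarrow> E g (a + b) = E g a + E g b"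
  and E_scale: "g \<in> \<Gamma> \<Longrightarrow> a \<in> A \<Longrightarrow> E g (oscale c a) = oscale c (E g a)"
  unfolding E_def by (simp_all only: Delta_add Delta_scale sl_add sl_scale)

lemma E_lin: "g \<in> \<Gamma> \<Longrightarrow> lin_on A (E g)"
  unfolding lin_on_def using E_add E_scale by blast

lemma AA_bdd: "T \<in> A \<otimes>\<^sub>C A \<Longrightarrow> bounded_oper T"
  using findim_bdd[OF ctensor_findim(1)[OF fin fin]] .

lemma AA_sub: "ops.subspace (A \<otimes>\<^sub>C A)"
  using findim_subspace[OF ctensor_findim(1)[OF fin fin]] .

lemma Delta_one: "\<Delta> eA = eA \<otimes>\<^sub>o eA"
  using Delta_unit unit_of_eqI[OF is_unit_of_ctensor[OF fin fin A_unit A_unit]] by simp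

lemma E_unit: "g \<in> \<Gamma> \<Longrightarrow> E g eA = (if g = eB then eA else 0)"
  unfolding E_def Delta_one
  by (simp add: sl_tensor eA_in pi_unit coord_Gamma Gamma_one)

text \<open>This makes the grading multiplicative: the product of two group elements \<open>h\<close>, \<open>k\<close> in the second leg is
  the group element \<open>h \<circ> k\<close>.\<close>

lemma sl_comp:
  assumes g: "g \<in> \<Gamma>" and S: "S \<in> A \<otimes>\<^sub>C A" and T: "T \<in> A \<otimes>\<^sub>C A"
  shows "sl g (S \<circ> T) = (\<Sum>h\<in>\<Gamma>. \<Sum>k\<in>\<Gamma>. if h \<circ> k = g then sl h S \<circ> sl k T else 0)"
  using fin fin S
proof (induction rule: ctensor_induct)
  case (tensor a a')
  note a = tensor
  have ab: "bounded_oper (a \<otimes>\<^sub>o a')" using a by (intro bounded_otensor A_bdd)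
  show ?case using fin fin T
  proof (induction rule: ctensor_induct)
    case (tensor b b')
    have "sl g ((a \<otimes>\<^sub>o a') \<circ> (b \<otimes>\<^sub>o b')) = oscale (coord g (\<pi> a' \<circ> \<pi> b')) (a \<circ> b)"
      using a tensor by (simp only: otensor_comp[OF A_bdd A_bdd A_bdd A_bdd] sl_tensor[OF g] A_comp pi_comp)
    also have "\<dots> = (\<Sum>h\<in>\<Gamma>. \<Sum>k\<in>\<Gamma>. oscale (if h \<circ> k = g then coord h (\<pi> a') * coord k (\<pi> b') else 0) (a \<circ> b))"
      using a tensor by (simp only: coord_comp[OF g pi_in pi_in] ops.scale_sum_left)
    also have "\<dots> = (\<Sum>h\<in>\<Gamma>. \<Sum>k\<in>\<Gamma>. if h \<circ> k = g then sl h (a \<otimes>\<^sub>o a') \<circ> sl k (b \<otimes>\<^sub>o b') else 0)"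
    proof (intro sum.cong refl)
      fix h k assume "h \<in> \<Gamma>" "k \<in> \<Gamma>"
      then have "sl h (a \<otimes>\<^sub>o a') \<circ> sl k (b \<otimes>\<^sub>o b') = oscale (coord h (\<pi> a') * coord k (\<pi> b')) (a \<circ> b)"
        using a tensor
        by (simp only: sl_tensor scale_comp oper_comp_scale[OF A_bdd A_bdd] ops.scale_scale)
      then show "oscale (if h \<circ> k = g then coord h (\<pi> a') * coord k (\<pi> b') else 0) (a \<circ> b)
          = (if h \<circ> k = g then sl h (a \<otimes>\<^sub>o a') \<circ> sl k (b \<otimes>\<^sub>o b') else 0)"
        by (simp only: if_distrib[of "\<lambda>c. oscale c (a \<circ> b)"] ops.scale_zero_left)
    qed
    finally show ?case .
  next
    case zero
    have z: "X \<circ> 0 = 0" if "bounded_oper X" for X :: "'b oper"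
      using bdd_zero[OF that] by (simp add: fun_eq_iff)
    have "sl h (a \<otimes>\<^sub>o a') \<circ> sl k 0 = 0" if "h \<in> \<Gamma>" "k \<in> \<Gamma>" for h k
      using that a by (simp only: sl_0 sl_tensor z[OF bounded_oper_scale[OF A_bdd]])
    then have "(\<Sum>h\<in>\<Gamma>. \<Sum>k\<in>\<Gamma>. if h \<circ> k = g then sl h (a \<otimes>\<^sub>o a') \<circ> sl k 0 else 0) = 0"
      by (intro sum.neutral ballI) (simp only: if_cancel)
    then show ?case by (simp only: z[OF ab] sl_0[OF g])
  next
    case (add S T)
    have "sl h (a \<otimes>\<^sub>o a') \<circ> sl k (S + T) = (sl h (a \<otimes>\<^sub>o a') \<circ> sl k S) + (sl h (a \<otimes>\<^sub>o a') \<circ> sl k T)"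
      if "h \<in> \<Gamma>" "k \<in> \<Gamma>" for h k
      using that a add(1,2)
      by (simp only: sl_add oper_comp_add[OF A_bdd A_bdd A_bdd] sl_in otensor_in_ctensor[OF fin fin])
    then have "(\<Sum>h\<in>\<Gamma>. \<Sum>k\<in>\<Gamma>. if h \<circ> k = g then sl h (a \<otimes>\<^sub>o a') \<circ> sl k (S + T) else 0)
      = (\<Sum>h\<in>\<Gamma>. \<Sum>k\<in>\<Gamma>. (if h \<circ> k = g then sl h (a \<otimes>\<^sub>o a') \<circ> sl k S else 0)
         + (if h \<circ> k = g then sl h (a \<otimes>\<^sub>o a') \<circ> sl k T else 0))"
      by (intro sum.cong refl) simp
    then show ?case
      using add by (simp only: oper_comp_add[OF ab AA_bdd AA_bdd] sl_add[OF g] sum.distrib)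
  next
    case (scale c T)
    have "sl h (a \<otimes>\<^sub>o a') \<circ> sl k (oscale c T) = oscale c (sl h (a \<otimes>\<^sub>o a') \<circ> sl k T)"
      if "h \<in> \<Gamma>" "k \<in> \<Gamma>" for h k
      using that a scale(1)
      by (simp only: sl_scale oper_comp_scale[OF A_bdd A_bdd] sl_in otensor_in_ctensor[OF fin fin])
    then have "(\<Sum>h\<in>\<Gamma>. \<Sum>k\<in>\<Gamma>. if h \<circ> k = g then sl h (a \<otimes>\<^sub>o a') \<circ> sl k (oscale c T) else 0)
      = (\<Sum>h\<in>\<Gamma>. \<Sum>k\<in>\<Gamma>. oscale c (if h \<circ> k = g then sl h (a \<otimes>\<^sub>o a') \<circ> sl k T else 0))"
      by (intro sum.cong refl) simp
    then show ?case
      using scale by (simp only: oper_comp_scale[OF ab AA_bdd] sl_scale[OF g] ops.scale_sum_right)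
  qed
next
  case zero
  have z: "0 \<circ> X = 0" for X :: "'b oper" by (simp add: fun_eq_iff)
  have "sl h 0 \<circ> sl k T = 0" if "h \<in> \<Gamma>" for h k
    using that by (simp only: sl_0 z)
  then have "(\<Sum>h\<in>\<Gamma>. \<Sum>k\<in>\<Gamma>. if h \<circ> k = g then sl h 0 \<circ> sl k T else 0) = 0"
    by (intro sum.neutral ballI) (simp only: if_cancel)
  moreover have "(0 :: ('i \<times> 'i) oper) \<circ> T = 0" by (simp add: fun_eq_iff)
  ultimately show ?case by (simp only: sl_0[OF g])
next
  case (add S S')
  have "(\<Sum>h\<in>\<Gamma>. \<Sum>k\<in>\<Gamma>. if h \<circ> k = g then sl h (S + S') \<circ> sl k T else 0)
    = (\<Sum>h\<in>\<Gamma>. \<Sum>k\<in>\<Gamma>. (if h \<circ> k = g then sl h S \<circ> sl k T else 0)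
       + (if h \<circ> k = g then sl h S' \<circ> sl k T else 0))"
    by (intro sum.cong refl) (simp only: sl_add add_comp split: if_splits, simp)
  then show ?case using add by (simp only: add_comp sl_add[OF g] sum.distrib)
next
  case (scale c S)
  have "(\<Sum>h\<in>\<Gamma>. \<Sum>k\<in>\<Gamma>. if h \<circ> k = g then sl h (oscale c S) \<circ> sl k T else 0)
    = (\<Sum>h\<in>\<Gamma>. \<Sum>k\<in>\<Gamma>. oscale c (if h \<circ> k = g then sl h S \<circ> sl k T else 0))"
    by (intro sum.cong refl) (simp only: sl_scale scale_comp split: if_splits, simp)
  then show ?case using scale by (simp only: scale_comp sl_scale[OF g] ops.scale_sum_right)
qed

lemma E_comp:
  assumes "g \<in> \<Gamma>" "a \<in> A" "b \<in> A"
  shows "E g (a \<circ> b) = (\<Sum>h\<in>\<Gamma>. \<Sum>k\<in>\<Gamma>. if h \<circ> k = g then E h a \<circ> E k b else 0)"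
  unfolding E_def using assms by (simp only: Delta_comp sl_comp Delta_in)

end

context group_dual_subgroup
begin

abbreviation "AA \<equiv> A \<otimes>\<^sub>C A"

lemmas findim_AA = ctensor_findim(1)[OF fin fin]

lemma is_tensor_homD:
  assumes "is_tensor_hom X Y Z W f g F"
  shows "lin_on (X \<otimes>\<^sub>C Y) F" "a \<in> X \<Longrightarrow> b \<in> Y \<Longrightarrow> F (a \<otimes>\<^sub>o b) = f a \<otimes>\<^sub>o g b"
  using assms star_homD(1) unfolding is_tensor_hom_def by blast+

text \<open>The map \<open>\<pi> \<otimes> \<pi>\<close>, which intertwines the two comultiplications.\<close>

definition P :: "('i \<times> 'i) oper \<Rightarrow> ('j \<times> 'j) oper" where
  "P = (SOME P. is_tensor_hom A A B B \<pi> \<pi> P \<and> (\<forall>a\<in>A. P (\<Delta> a) = \<Delta>' (\<pi> a)))"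

lemma P: "is_tensor_hom A A B B \<pi> \<pi> P \<and> (\<forall>a\<in>A. P (\<Delta> a) = \<Delta>' (\<pi> a))"
proof -
  have "\<exists>P. is_tensor_hom A A B B \<pi> \<pi> P \<and> (\<forall>a\<in>A. P (\<Delta> a) = \<Delta>' (\<pi> a))"
    using sub unfolding quantum_subgroup_def by blast
  then show ?thesis unfolding P_def by (rule someI_ex)
qed

lemma P_hom: "is_tensor_hom A A B B \<pi> \<pi> P" and P_Delta: "a \<in> A \<Longrightarrow> P (\<Delta> a) = \<Delta>' (\<pi> a)"
  using P by blast+

lemmas P_lin = is_tensor_homD(1)[OF P_hom] and P_tensor = is_tensor_homD(2)[OF P_hom]

definition bsl :: "'j oper \<Rightarrow> ('j \<times> 'j) oper \<Rightarrow> 'j oper" where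
  "bsl g = (SOME L. is_slice (coord g) L)"

lemma bsl: "g \<in> \<Gamma> \<Longrightarrow> is_slice (coord g) (bsl g)"
  unfolding bsl_def using slice_exists[OF coord_evalf] by (rule someI_ex)

lemma cf_sl:
  assumes g: "g \<in> \<Gamma>" and h: "h \<in> \<Gamma>" and T: "T \<in> AA"
  shows "cf g (sl h T) = coord g (bsl h (P T))"
  using fin fin T
proof (induction rule: ctensor_induct)
  case (tensor a b)
  have "coord g (bsl h (P (a \<otimes>\<^sub>o b))) = coord h (\<pi> b) * coord g (\<pi> a)"
    using tensor
    by (simp only: P_tensor is_sliceD(4)[OF bsl[OF h] B_bdd B_bdd] pi_in evalf_scale[OF coord_evalf[OF g]])
  then show ?case using tensor
    by (simp only: sl_tensor[OF h] evalf_scale[OF cf_evalf[OF g]] cf_eq[OF g])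
next
  case zero
  show ?case
    by (simp only: sl_0[OF h] evalf_0[OF cf_evalf[OF g]] lin_on_zero[OF AA_sub P_lin]
        is_sliceD(3)[OF bsl[OF h]] evalf_0[OF coord_evalf[OF g]])
next
  case (add S T)
  then show ?case
    by (simp only: sl_add[OF h] evalf_add[OF cf_evalf[OF g]] lin_onD[OF P_lin]
        is_sliceD(1)[OF bsl[OF h]] evalf_add[OF coord_evalf[OF g]])
next
  case (scale c T)
  then show ?case
    by (simp only: sl_scale[OF h] evalf_scale[OF cf_evalf[OF g]] lin_onD[OF P_lin]
        is_sliceD(2)[OF bsl[OF h]] evalf_scale[OF coord_evalf[OF g]])
qed

lemma cf_E:
  assumes g: "g \<in> \<Gamma>" and h: "h \<in> \<Gamma>" and a: "a \<in> A"
  shows "cf g (E h a) = (if g = h then cf g a else 0)"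
proof -
  have L: "lin_on UNIV (bsl h)" by (rule is_sliceD(5)[OF bsl[OF h]])
  have "cf g (E h a) = coord g (bsl h (\<Sum>s\<in>\<Gamma>. oscale (coord s (\<pi> a)) (s \<otimes>\<^sub>o s)))"
    unfolding E_def using a
    by (simp only: cf_sl[OF g h] Delta_in P_Delta Delta'_expand[OF pi_in])
  also have "\<dots> = coord g (\<Sum>s\<in>\<Gamma>. bsl h (oscale (coord s (\<pi> a)) (s \<otimes>\<^sub>o s)))"
    by (subst lin_on_sum[OF ops.subspace_UNIV L]) simp_all
  also have "\<dots> = (\<Sum>s\<in>\<Gamma>. coord g (bsl h (oscale (coord s (\<pi> a)) (s \<otimes>\<^sub>o s))))"
    by (rule evalf_sum[OF coord_evalf[OF g]])
  also have "\<dots> = (\<Sum>s\<in>\<Gamma>. if s = h then (if g = h then cf g a else 0) else 0)"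
  proof (rule sum.cong[OF refl])
    fix s assume s: "s \<in> \<Gamma>"
    have "coord g (bsl h (oscale (coord s (\<pi> a)) (s \<otimes>\<^sub>o s)))
        = coord s (\<pi> a) * (coord h s * coord g s)"
      by (simp only: is_sliceD(2)[OF bsl[OF h]] is_sliceD(4)[OF bsl[OF h] Gamma_bdd[OF s] Gamma_bdd[OF s]]
          evalf_scale[OF coord_evalf[OF g]])
    then show "coord g (bsl h (oscale (coord s (\<pi> a)) (s \<otimes>\<^sub>o s)))
        = (if s = h then (if g = h then cf g a else 0) else 0)"
      using s g h a cf_eq[OF g a] by (auto simp: coord_Gamma)
  qed
  also have "\<dots> = (if g = h then cf g a else 0)" using h Gamma_finite by (simp only: sum.delta if_True)
  finally show ?thesis .
qed

text \<open>The maps \<open>E g\<close> are orthogonal idempotents, by coassociativity: slicing the last two legs of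
  \<open>(\<Delta> \<otimes> id) \<Delta> a\<close> gives \<open>E g (E h a)\<close>, while slicing those of \<open>(id \<otimes> \<Delta>) \<Delta> a\<close> evaluates the functional
  \<open>coord g \<otimes> coord h\<close> on the comultiplication of \<open>C(H)\<close>, where it is \<open>\<delta>\<^sub>g\<^sub>h coord g\<close> because the basis
  is group-like. In the proof \<open>\<omega>\<close> is this functional pulled back to \<open>A \<otimes> A\<close>.\<close>

lemma E_E:
  assumes g: "g \<in> \<Gamma>" and h: "h \<in> \<Gamma>" and a: "a \<in> A"
  shows "E g (E h a) = (if g = h then E g a else 0)"
proof -
  obtain F F' where F: "is_tensor_hom A A AA A \<Delta> (\<lambda>a. a) F"
    and F': "is_tensor_hom A A A AA (\<lambda>a. a) \<Delta> F'"
    and FF': "\<And>a. a \<in> A \<Longrightarrow> oassoc (F (\<Delta> a)) = F' (\<Delta> a)"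
    using G_cqg unfolding compact_quantum_group_def coassociative_def Let_def by blast
  obtain M :: "(('i \<times> 'i) \<times> 'i) oper \<Rightarrow> ('i \<times> 'i) oper" where M: "is_slice (cf h) M"
    using slice_exists[OF cf_evalf[OF h]] by blast
  obtain S where S: "finite S" "AA = ops.span S" "\<And>s. s \<in> S \<Longrightarrow> bounded_oper s"
    using findim_AA unfolding findim_def by metis
  have "\<exists>\<omega>. \<omega> \<in> evalf \<and> (\<forall>T\<in>AA. \<omega> T = cf g (sl h T))"
  proof (rule findim_functional_evalf[of S "\<lambda>T. cf g (sl h T)", OF S(1,3)])
    fix \<psi> assume "\<psi> \<in> evalf" "\<And>T. T \<in> ops.span S \<Longrightarrow> \<psi> T = cf g (sl h T)"
    then show ?thesis using S(2) by blast
  qed (simp_all only: sl_add[OF h] sl_scale[OF h] evalf_add[OF cf_evalf[OF g]] evalf_scale[OF cf_evalf[OF g]])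
  then obtain \<omega> where \<omega>: "\<omega> \<in> evalf" "\<And>T. T \<in> AA \<Longrightarrow> \<omega> T = cf g (sl h T)" by blast
  obtain N :: "('i \<times> 'i \<times> 'i) oper \<Rightarrow> 'i oper" where N: "is_slice \<omega> N"
    using slice_exists[OF \<omega>(1)] by blast
  have MF: "M (F T) = \<Delta> (sl h T)" if "T \<in> AA" for T
    using fin fin that
  proof (induction rule: ctensor_induct)
    case (tensor a b)
    then show ?case
      by (simp only: is_tensor_homD(2)[OF F] is_sliceD(4)[OF M AA_bdd A_bdd] Delta_in
          sl_tensor[OF h] Delta_scale cf_eq[OF h])
  next
    case zero
    show ?case
      by (simp only: lin_on_zero[OF AA_sub is_tensor_homD(1)[OF F]] is_sliceD(3)[OF M] sl_0[OF h]
          lin_on_zero[OF A_sub Delta_lin])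
  next
    case (add S T)
    then show ?case
      by (simp only: lin_onD[OF is_tensor_homD(1)[OF F]] is_sliceD(1)[OF M] sl_add[OF h] Delta_add sl_in[OF h])
  next
    case (scale c T)
    then show ?case
      by (simp only: lin_onD[OF is_tensor_homD(1)[OF F]] is_sliceD(2)[OF M] sl_scale[OF h] Delta_scale sl_in[OF h])
  qed
  have NF: "N (F' T) = (if g = h then sl g T else 0)" if "T \<in> AA" for T
    using fin fin that
  proof (induction rule: ctensor_induct)
    case (tensor a b)
    have "N (F' (a \<otimes>\<^sub>o b)) = oscale (cf g (E h b)) a"
      using tensor by (simp only: is_tensor_homD(2)[OF F'] is_sliceD(4)[OF N A_bdd AA_bdd] Delta_in \<omega>(2) E_def)
    also have "\<dots> = (if g = h then sl g (a \<otimes>\<^sub>o b) else 0)"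
      using tensor cf_E[OF g h tensor(2)] cf_eq[OF g tensor(2)] sl_tensor[OF g tensor]
      by (simp only: if_distrib[of "\<lambda>c. oscale c a"] ops.scale_zero_left)
    finally show ?case .
  next
    case zero
    show ?case
      by (simp only: lin_on_zero[OF AA_sub is_tensor_homD(1)[OF F']] is_sliceD(3)[OF N] sl_0[OF g] if_cancel)
  next
    case (add S T)
    then show ?case
      by (cases "g = h")
        (simp_all only: lin_onD[OF is_tensor_homD(1)[OF F']] is_sliceD(1)[OF N] sl_add[OF h] if_True if_False add_0_left simp_thms)
  next
    case (scale c T)
    then show ?case
      by (cases "g = h")
        (simp_all only: lin_onD[OF is_tensor_homD(1)[OF F']] is_sliceD(2)[OF N] sl_scale[OF h] if_True if_False
          ops.scale_zero_right simp_thms)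
  qed
  have assoc: "N (oassoc X) = sl g (M X)" if "X \<in> AA \<otimes>\<^sub>C A" for X
    using findim_AA fin that
  proof (induction rule: ctensor_induct)
    case (tensor T c)
    note c = tensor(2)
    have "N (oassoc (T \<otimes>\<^sub>o c)) = oscale (cf h c) (sl g T)"
      using fin fin tensor(1)
    proof (induction rule: ctensor_induct)
      case (tensor a b)
      have "N (oassoc ((a \<otimes>\<^sub>o b) \<otimes>\<^sub>o c)) = oscale (cf g (sl h (b \<otimes>\<^sub>o c))) a"
        using tensor c
        by (simp only: oassoc_otensor[OF A_bdd A_bdd A_bdd] is_sliceD(4)[OF N A_bdd AA_bdd]
            otensor_in_ctensor[OF fin fin] \<omega>(2))
      also have "\<dots> = oscale (cf h c) (sl g (a \<otimes>\<^sub>o b))"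
        using tensor c
        by (simp only: sl_tensor[OF g] sl_tensor[OF h] evalf_scale[OF cf_evalf[OF g]] cf_eq[OF g] cf_eq[OF h]
            ops.scale_scale)
      finally show ?case .
    next
      case zero
      have "oassoc (0 :: (('i \<times> 'i) \<times> 'i) oper) = 0" by (auto simp: oassoc_def fun_eq_iff)
      then show ?case
        by (simp only: otensor_zero[OF A_bdd[OF c]] is_sliceD(3)[OF N] sl_0[OF g] ops.scale_zero_right)
    next
      case (add S T)
      then show ?case
        by (simp only: otensor_linear(1)[OF AA_bdd AA_bdd A_bdd[OF c] A_bdd[OF c]] oassoc_linear is_sliceD(1)[OF N]
            sl_add[OF g] ops.scale_right_distrib)
    next
      case (scale d T)
      then show ?case
        by (simp only: otensor_linear(3)[OF AA_bdd AA_bdd A_bdd[OF c] A_bdd[OF c]] oassoc_linear is_sliceD(2)[OF N]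
            sl_scale[OF g] ops.scale_scale mult.commute)
    qed
    also have "\<dots> = sl g (M (T \<otimes>\<^sub>o c))"
      using tensor by (simp only: is_sliceD(4)[OF M AA_bdd A_bdd] sl_scale[OF g])
    finally show ?case .
  next
    case zero
    have "oassoc (0 :: (('i \<times> 'i) \<times> 'i) oper) = 0" by (auto simp: oassoc_def fun_eq_iff)
    then show ?case by (simp only: is_sliceD(3)[OF M] is_sliceD(3)[OF N] sl_0[OF g])
  next
    case (add S T)
    then show ?case by (simp only: oassoc_linear is_sliceD(1)[OF M] is_sliceD(1)[OF N] sl_add[OF g])
  next
    case (scale c T)
    then show ?case by (simp only: oassoc_linear is_sliceD(2)[OF M] is_sliceD(2)[OF N] sl_scale[OF g])
  qed
  have Da: "\<Delta> a \<in> AA" by (rule Delta_in[OF a])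
  have FD: "F (\<Delta> a) \<in> AA \<otimes>\<^sub>C A"
    using F Da star_homD(2) unfolding is_tensor_hom_def by blast
  have "E g (E h a) = sl g (M (F (\<Delta> a)))" unfolding E_def by (simp only: MF[OF Da])
  also have "\<dots> = N (F' (\<Delta> a))" by (simp only: assoc[OF FD, symmetric] FF'[OF a])
  also have "\<dots> = (if g = h then E g a else 0)" by (simp only: NF[OF Da] E_def)
  finally show ?thesis .
qed

lemma span_subset_norm_closure_eq:
  assumes "V \<subseteq> AA" "norm_closure (ops.span V) = AA" shows "ops.span V = AA"
  using findim_norm_closure[OF findim_AA ops.span_minimal[OF assms(1) AA_sub] ops.subspace_span] assms(2) by simp

lemma Delta_mult_in:
  assumes "a \<in> A" "T \<in> AA" shows "\<Delta> a \<circ> T \<in> AA"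
proof -
  have cl: "S \<circ> T \<in> AA" if S: "S \<in> AA" for S
    using fin fin S
  proof (induction rule: ctensor_induct)
    case (tensor a a')
    show ?case using fin fin assms(2)
    proof (induction rule: ctensor_induct)
      case (tensor b b')
      show ?case using \<open>a \<in> A\<close> \<open>a' \<in> A\<close> tensor
        by (simp only: otensor_comp[OF A_bdd A_bdd A_bdd A_bdd] otensor_in_ctensor[OF fin fin] A_comp)
    next
      case zero
      have "(a \<otimes>\<^sub>o a') \<circ> 0 = (0 :: ('i \<times> 'i) oper)"
        using bdd_zero[OF AA_bdd[OF otensor_in_ctensor[OF fin fin tensor]]] by (simp add: fun_eq_iff)
      then show ?case using ops.subspace_0[OF AA_sub] by (simp only:)
    next
      case (add S T)
      then show ?case using tensor
        by (simp only: oper_comp_add[OF AA_bdd AA_bdd AA_bdd] otensor_in_ctensor[OF fin fin] ops.subspace_add[OF AA_sub])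
    next
      case (scale c T)
      then show ?case using tensor
        by (simp only: oper_comp_scale[OF AA_bdd AA_bdd] otensor_in_ctensor[OF fin fin] ops.subspace_scale[OF AA_sub])
    qed
  next
    case zero
    have "(0 :: ('i \<times> 'i) oper) \<circ> T = 0" by (simp add: fun_eq_iff)
    then show ?case using ops.subspace_0[OF AA_sub] by (simp only:)
  next
    case (add S S')
    then show ?case by (simp only: add_comp ops.subspace_add[OF AA_sub])
  next
    case (scale c S)
    then show ?case by (simp only: scale_comp ops.subspace_scale[OF AA_sub])
  qed
  then show ?thesis using Delta_in[OF assms(1)] by blast
qed

lemma cancel1: "ops.span {\<Delta> a \<circ> (b \<otimes>\<^sub>o eA) |a b. a \<in> A \<and> b \<in> A} = AA"
  and cancel2: "ops.span {\<Delta> a \<circ> (eA \<otimes>\<^sub>o b) |a b. a \<in> A \<and> b \<in> A} = AA"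
proof -
  have c: "norm_closure (ops.span {\<Delta> a \<circ> (b \<otimes>\<^sub>o eA) |a b. a \<in> A \<and> b \<in> A}) = AA"
    "norm_closure (ops.span {\<Delta> a \<circ> (eA \<otimes>\<^sub>o b) |a b. a \<in> A \<and> b \<in> A}) = AA"
    using G_cqg unfolding compact_quantum_group_def cancellation_def Let_def by blast+
  have "{\<Delta> a \<circ> (b \<otimes>\<^sub>o eA) |a b. a \<in> A \<and> b \<in> A} \<subseteq> AA"
    "{\<Delta> a \<circ> (eA \<otimes>\<^sub>o b) |a b. a \<in> A \<and> b \<in> A} \<subseteq> AA"
    using Delta_mult_in otensor_in_ctensor[OF fin fin] eA_in by blast+
  then show "ops.span {\<Delta> a \<circ> (b \<otimes>\<^sub>o eA) |a b. a \<in> A \<and> b \<in> A} = AA"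
    "ops.span {\<Delta> a \<circ> (eA \<otimes>\<^sub>o b) |a b. a \<in> A \<and> b \<in> A} = AA"
    using span_subset_norm_closure_eq c by blast+
qed

end

context group_dual_subgroup
begin

lemma sl_mult_left_leg:
  assumes g: "g \<in> \<Gamma>" and b: "b \<in> A" and T: "T \<in> AA"
  shows "sl g (T \<circ> (b \<otimes>\<^sub>o eA)) = sl g T \<circ> b"
  using fin fin T
proof (induction rule: ctensor_induct)
  case (tensor a a')
  then show ?case using b eA_in
    by (simp only: otensor_comp[OF A_bdd A_bdd A_bdd A_bdd] eA_right sl_tensor[OF g] A_comp scale_comp)
next
  case zero
  have "(0 :: ('i \<times> 'i) oper) \<circ> (b \<otimes>\<^sub>o eA) = 0" "(0 :: 'i oper) \<circ> b = 0" by (simp_all add: fun_eq_iff)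
  then show ?case by (simp only: sl_0[OF g])
next
  case (add S T)
  then show ?case by (simp only: add_comp sl_add[OF g])
next
  case (scale c T)
  then show ?case by (simp only: scale_comp sl_scale[OF g])
qed

text \<open>Every component generates \<open>A\<close> as a right module. Indeed the elements \<open>\<Delta> a (b \<otimes> 1)\<close> span \<open>A \<otimes> A\<close>, their
  slices are \<open>E g a \<circ> b\<close>, and \<open>c\<close> is the slice of \<open>c \<otimes> d\<close> when \<open>\<pi> d = g\<close>.\<close>

lemma E_generate:
  assumes g: "g \<in> \<Gamma>" and c: "c \<in> A"
  shows "c \<in> ops.span {E g a \<circ> b |a b. a \<in> A \<and> b \<in> A}" (is "_ \<in> ?R")
proof -
  let ?W = "{\<Delta> a \<circ> (b \<otimes>\<^sub>o eA) |a b. a \<in> A \<and> b \<in> A}"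
  obtain d where d: "d \<in> A" "\<pi> d = g" using Gamma_in[OF g] pi_surj by (metis imageE)
  have "ops.span ?W \<subseteq> {T. sl g T \<in> ?R}"
  proof (rule ops.span_minimal)
    show "?W \<subseteq> {T. sl g T \<in> ?R}"
    proof clarify
      fix a b assume ab: "a \<in> A" "b \<in> A"
      have "sl g (\<Delta> a \<circ> (b \<otimes>\<^sub>o eA)) = E g a \<circ> b"
        unfolding E_def by (rule sl_mult_left_leg[OF g ab(2) Delta_in[OF ab(1)]])
      moreover have "E g a \<circ> b \<in> ?R" using ab by (intro ops.span_base) blast
      ultimately show "sl g (\<Delta> a \<circ> (b \<otimes>\<^sub>o eA)) \<in> ?R" by simp
    qed
    show "ops.subspace {T. sl g T \<in> ?R}"
      unfolding ops.subspace_def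
      by (intro conjI ballI allI)
        (simp_all only: mem_Collect_eq sl_0[OF g] sl_add[OF g] sl_scale[OF g] ops.span_zero ops.span_add ops.span_scale)
  qed
  moreover have "c \<otimes>\<^sub>o d \<in> ops.span ?W" using otensor_in_ctensor[OF fin fin c d(1)] cancel1 by simp
  ultimately have "sl g (c \<otimes>\<^sub>o d) \<in> ?R" by blast
  moreover have "sl g (c \<otimes>\<^sub>o d) = c"
    using c d g by (simp add: sl_tensor coord_Gamma)
  ultimately show ?thesis by simp
qed

text \<open>The counit of the group dual, that is, the character with value 1 on every group element.\<close>

definition eps :: "'j oper \<Rightarrow> complex" where
  "eps b = (\<Sum>g\<in>\<Gamma>. coord g b)"

lemma eps_comp: assumes "x \<in> B" "y \<in> B" shows "eps (x \<circ> y) = eps x * eps y"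
proof -
  have "eps (x \<circ> y) = (\<Sum>g\<in>\<Gamma>. \<Sum>h\<in>\<Gamma>. \<Sum>k\<in>\<Gamma>. if h \<circ> k = g then coord h x * coord k y else 0)"
    unfolding eps_def by (intro sum.cong refl coord_comp assms)
  also have "\<dots> = (\<Sum>h\<in>\<Gamma>. \<Sum>g\<in>\<Gamma>. \<Sum>k\<in>\<Gamma>. if h \<circ> k = g then coord h x * coord k y else 0)"
    by (rule sum.swap)
  also have "\<dots> = (\<Sum>h\<in>\<Gamma>. \<Sum>k\<in>\<Gamma>. \<Sum>g\<in>\<Gamma>. if h \<circ> k = g then coord h x * coord k y else 0)"
    by (intro sum.cong refl sum.swap)
  also have "\<dots> = (\<Sum>h\<in>\<Gamma>. \<Sum>k\<in>\<Gamma>. coord h x * coord k y)"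
    by (intro sum.cong refl, subst sum.delta'[OF Gamma_finite]) (simp add: Gamma_comp)
  also have "\<dots> = eps x * eps y" unfolding eps_def by (simp add: sum_product)
  finally show ?thesis .
qed

lemma eps_Gamma: "g \<in> \<Gamma> \<Longrightarrow> eps g = 1"
  unfolding eps_def using Gamma_finite by (simp add: coord_Gamma)

lemma eps_add: "eps (x + y) = eps x + eps y" and eps_scale: "eps (oscale c x) = c * eps x"
  unfolding eps_def
  by (simp_all add: evalf_add[OF coord_evalf] evalf_scale[OF coord_evalf] sum.distrib sum_distrib_left)

definition slsum :: "('i \<times> 'i) oper \<Rightarrow> 'i oper" where
  "slsum T = (\<Sum>g\<in>\<Gamma>. sl g T)"

lemma slsum_lin: "slsum (S + T) = slsum S + slsum T" "slsum (oscale c T) = oscale c (slsum T)" "slsum 0 = 0"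
proof -
  show "slsum (S + T) = slsum S + slsum T"
    unfolding slsum_def sum.distrib[symmetric] by (intro sum.cong refl sl_add)
  show "slsum (oscale c T) = oscale c (slsum T)"
    unfolding slsum_def ops.scale_sum_right by (intro sum.cong refl sl_scale)
  show "slsum 0 = 0" unfolding slsum_def by (intro sum.neutral ballI sl_0)
qed

lemma slsum_tensor: assumes "a \<in> A" "b \<in> A" shows "slsum (a \<otimes>\<^sub>o b) = oscale (eps (\<pi> b)) a"
proof -
  have "slsum (a \<otimes>\<^sub>o b) = (\<Sum>g\<in>\<Gamma>. oscale (coord g (\<pi> b)) a)"
    unfolding slsum_def by (intro sum.cong refl sl_tensor assms)
  then show ?thesis by (simp only: eps_def ops.scale_sum_left)
qed

lemma slsum_mult_right_leg:
  assumes b: "b \<in> A" and T: "T \<in> AA"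
  shows "slsum (T \<circ> (eA \<otimes>\<^sub>o b)) = oscale (eps (\<pi> b)) (slsum T)"
  using fin fin T
proof (induction rule: ctensor_induct)
  case (tensor a a')
  then show ?case using b eA_in
    by (simp only: otensor_comp[OF A_bdd A_bdd A_bdd A_bdd] eA_right slsum_tensor A_comp pi_comp eps_comp
        pi_in ops.scale_scale mult.commute)
next
  case zero
  have "(0 :: ('i \<times> 'i) oper) \<circ> (eA \<otimes>\<^sub>o b) = 0" by (simp_all add: fun_eq_iff)
  then show ?case by (simp only: slsum_lin ops.scale_zero_right)
next
  case (add S T)
  then show ?case by (simp only: add_comp slsum_lin ops.scale_right_distrib)
next
  case (scale c T)
  then show ?case by (simp only: scale_comp slsum_lin ops.scale_scale mult.commute)
qed

text \<open>The components add up to \<open>A\<close>. The sum \<open>S\<close> of the \<open>E g\<close> is idempotent, so surjectivity suffices. It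
  follows from the second cancellation property: write \<open>c \<otimes> 1 = \<Sum> \<Delta> a\<^sub>i (1 \<otimes> b\<^sub>i)\<close> and apply
  \<open>id \<otimes> eps \<circ> \<pi>\<close>, which is multiplicative; the result is \<open>c = S (\<Sum> eps (\<pi> b\<^sub>i) a\<^sub>i)\<close>.\<close>

lemma E_sum: assumes c: "c \<in> A" shows "(\<Sum>g\<in>\<Gamma>. E g c) = c"
proof -
  let ?W = "{\<Delta> a \<circ> (eA \<otimes>\<^sub>o b) |a b. a \<in> A \<and> b \<in> A}"
  let ?R = "{T. \<exists>a\<in>A. slsum T = slsum (\<Delta> a)}"
  have "ops.span ?W \<subseteq> ?R"
  proof (rule ops.span_minimal)
    show "?W \<subseteq> ?R"
    proof clarify
      fix a b assume ab: "a \<in> A" "b \<in> A"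
      have "slsum (\<Delta> a \<circ> (eA \<otimes>\<^sub>o b)) = slsum (\<Delta> (oscale (eps (\<pi> b)) a))"
        using slsum_mult_right_leg[OF ab(2) Delta_in[OF ab(1)]] ab by (simp only: Delta_scale slsum_lin)
      then show "\<exists>a'\<in>A. slsum (\<Delta> a \<circ> (eA \<otimes>\<^sub>o b)) = slsum (\<Delta> a')" using A_scale[OF ab(1)] by blast
    qed
    show "ops.subspace ?R"
      unfolding ops.subspace_def
    proof (intro conjI ballI allI)
      have "slsum 0 = slsum (\<Delta> 0)" by (simp only: lin_on_zero[OF A_sub Delta_lin])
      then show "0 \<in> ?R" using A_0 by blast
    next
      fix S T assume "S \<in> ?R" "T \<in> ?R"
      then obtain a b where ab: "a \<in> A" "b \<in> A" "slsum S = slsum (\<Delta> a)" "slsum T = slsum (\<Delta> b)" by blast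
      then have "slsum (S + T) = slsum (\<Delta> (a + b))" by (simp only: slsum_lin Delta_add)
      then show "S + T \<in> ?R" using A_add[OF ab(1,2)] by blast
    next
      fix c T assume "T \<in> ?R"
      then obtain a where a: "a \<in> A" "slsum T = slsum (\<Delta> a)" by blast
      then have "slsum (oscale c T) = slsum (\<Delta> (oscale c a))" by (simp only: slsum_lin Delta_scale)
      then show "oscale c T \<in> ?R" using A_scale[OF a(1)] by blast
    qed
  qed
  moreover have "c \<otimes>\<^sub>o eA \<in> ops.span ?W" using otensor_in_ctensor[OF fin fin c eA_in] cancel2 by simp
  ultimately obtain a where a: "a \<in> A" "slsum (c \<otimes>\<^sub>o eA) = slsum (\<Delta> a)" by blast
  have "slsum (c \<otimes>\<^sub>o eA) = c"
    using slsum_tensor[OF c eA_in] eps_Gamma[OF Gamma_one] by (simp add: pi_unit)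
  then have ca: "c = (\<Sum>g\<in>\<Gamma>. E g a)" using a(2) by (simp only: slsum_def E_def)
  have "E h c = E h a" if h: "h \<in> \<Gamma>" for h
  proof -
    have "E h c = (\<Sum>g\<in>\<Gamma>. E h (E g a))"
      unfolding ca by (intro lin_on_sum[OF A_sub E_lin[OF h]] E_in a(1))
    also have "\<dots> = (\<Sum>g\<in>\<Gamma>. if g = h then E h a else 0)"
      using h a(1) by (intro sum.cong refl) (auto simp: E_E)
    finally show ?thesis using h Gamma_finite by (simp only: sum.delta if_True)
  qed
  then have "(\<Sum>g\<in>\<Gamma>. E g c) = (\<Sum>g\<in>\<Gamma>. E g a)" by (intro sum.cong refl)
  then show ?thesis using ca by simp
qed

definition hom_part :: "'j oper \<Rightarrow> 'i oper set" where
  "hom_part g = {x \<in> A. E g x = x}"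

lemma E_hom_part: "g \<in> \<Gamma> \<Longrightarrow> a \<in> A \<Longrightarrow> E g a \<in> hom_part g"
  unfolding hom_part_def by (simp add: E_in E_E)

lemma hom_partD: "x \<in> hom_part g \<Longrightarrow> x \<in> A" "x \<in> hom_part g \<Longrightarrow> E g x = x"
  by (auto simp: hom_part_def)

lemma E_other: "x \<in> hom_part g \<Longrightarrow> g \<in> \<Gamma> \<Longrightarrow> h \<in> \<Gamma> \<Longrightarrow> h \<noteq> g \<Longrightarrow> E h x = 0"
  using E_E[of h g x] hom_partD[of x g] by simp

lemma hom_part_comp:
  assumes g: "g \<in> \<Gamma>" and k: "k \<in> \<Gamma>" and x: "x \<in> hom_part g" and b: "b \<in> A"
  shows "E (g \<circ> k) (x \<circ> b) = x \<circ> E k b"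
proof -
  have zc: "(0 :: 'i oper) \<circ> y = 0" for y by (simp add: fun_eq_iff)
  have "E (g \<circ> k) (x \<circ> b) = (\<Sum>h\<in>\<Gamma>. \<Sum>l\<in>\<Gamma>. if h \<circ> l = g \<circ> k then E h x \<circ> E l b else 0)"
    by (rule E_comp[OF Gamma_comp[OF g k] hom_partD(1)[OF x] b])
  also have "\<dots> = (\<Sum>h\<in>\<Gamma>. if h = g then x \<circ> E k b else 0)"
  proof (rule sum.cong[OF refl])
    fix h assume h: "h \<in> \<Gamma>"
    show "(\<Sum>l\<in>\<Gamma>. if h \<circ> l = g \<circ> k then E h x \<circ> E l b else 0) = (if h = g then x \<circ> E k b else 0)"
    proof (cases "h = g")
      case True
      have "(\<Sum>l\<in>\<Gamma>. if h \<circ> l = g \<circ> k then E h x \<circ> E l b else 0) = (\<Sum>l\<in>\<Gamma>. if l = k then x \<circ> E k b else 0)"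
      proof (rule sum.cong[OF refl])
        fix l assume l: "l \<in> \<Gamma>"
        have "h \<circ> l = g \<circ> k \<longleftrightarrow> l = k"
          using Gamma_cancel[OF g Gamma_in[OF l] Gamma_in[OF k]] True by blast
        then show "(if h \<circ> l = g \<circ> k then E h x \<circ> E l b else 0) = (if l = k then x \<circ> E k b else 0)"
          using hom_partD(2)[OF x] by (simp only: True cong: if_cong)
      qed
      also have "\<dots> = x \<circ> E k b" using k Gamma_finite by (simp only: sum.delta if_True)
      finally show ?thesis using True by (simp only: if_True simp_thms)
    next
      case False
      then show ?thesis
        by (simp only: E_other[OF x g h] zc if_cancel sum.neutral_const if_False not_False_eq_True)
    qed
  qed
  also have "\<dots> = x \<circ> E k b" using g Gamma_finite by (simp only: sum.delta if_True)
  finally show ?thesis .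
qed

lemma eA_nonzero: "eA \<noteq> 0"
  using pi_unit nontrivial lin_on_zero[OF A_sub pi_lin] by metis

lemma unit_hom_part: "eA \<in> hom_part eB"
  using E_unit[OF Gamma_one] eA_in by (simp add: hom_part_def)

text \<open>If the component of degree \<open>g\<close> is spanned by \<open>x\<close>, then \<open>x \<circ> b = 1\<close> for some \<open>b\<close>, because the component
  generates \<open>A\<close>. A homogeneous \<open>c\<close> of trivial degree satisfies \<open>c \<circ> x = \<lambda> x\<close>, hence
  \<open>c = c \<circ> x \<circ> b = \<lambda> 1\<close>: the trivial component consists of scalars. For any degree \<open>h\<close> there are then
  homogeneous \<open>a\<close>, \<open>b\<close> of degrees \<open>h\<close> and \<open>h\<^sup>-\<^sup>1\<close> whose product is a non-zero scalar \<open>l\<close>, and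
  \<open>l y = a \<circ> (b \<circ> y)\<close> is a multiple of \<open>a\<close> for every \<open>y\<close> of degree \<open>h\<close>.\<close>

lemma one_dim_hom_parts:
  assumes g: "g \<in> \<Gamma>" and x: "x \<in> hom_part g" and x1: "\<And>y. y \<in> hom_part g \<Longrightarrow> \<exists>c. y = oscale c x"
    and h: "h \<in> \<Gamma>"
  obtains z where "\<And>y. y \<in> hom_part h \<Longrightarrow> \<exists>c. y = oscale c z"
proof -
  have xA: "x \<in> A" using x by (rule hom_partD)
  have "ops.span {E g a \<circ> b |a b. a \<in> A \<and> b \<in> A} \<subseteq> {x \<circ> b |b. b \<in> A}"
  proof (rule ops.span_minimal)
    show "{E g a \<circ> b |a b. a \<in> A \<and> b \<in> A} \<subseteq> {x \<circ> b |b. b \<in> A}"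
    proof clarify
      fix a b assume ab: "a \<in> A" "b \<in> A"
      obtain c where "E g a = oscale c x" using x1[OF E_hom_part[OF g ab(1)]] by blast
      then have "E g a \<circ> b = x \<circ> oscale c b"
        using xA ab by (simp only: scale_comp oper_comp_scale[OF A_bdd A_bdd])
      then show "\<exists>b'. E g a \<circ> b = x \<circ> b' \<and> b' \<in> A" using A_scale[OF ab(2)] by blast
    qed
    show "ops.subspace {x \<circ> b |b. b \<in> A}"
      unfolding ops.subspace_def
    proof (intro conjI ballI allI)
      have "x \<circ> 0 = (0 :: 'i oper)" using bdd_zero[OF A_bdd[OF xA]] by (simp add: fun_eq_iff)
      then show "0 \<in> {x \<circ> b |b. b \<in> A}" using A_0 by (metis (mono_tags, lifting) mem_Collect_eq)
    next
      fix s t assume "s \<in> {x \<circ> b |b. b \<in> A}" "t \<in> {x \<circ> b |b. b \<in> A}"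
      then obtain a b where ab: "a \<in> A" "b \<in> A" "s = x \<circ> a" "t = x \<circ> b" by blast
      then have "s + t = x \<circ> (a + b)" using xA by (simp only: oper_comp_add[OF A_bdd A_bdd A_bdd])
      then show "s + t \<in> {x \<circ> b |b. b \<in> A}" using A_add[OF ab(1,2)] by blast
    next
      fix c s assume "s \<in> {x \<circ> b |b. b \<in> A}"
      then obtain a where a: "a \<in> A" "s = x \<circ> a" by blast
      then have "oscale c s = x \<circ> oscale c a" using xA by (simp only: oper_comp_scale[OF A_bdd A_bdd])
      then show "oscale c s \<in> {x \<circ> b |b. b \<in> A}" using A_scale[OF a(1)] by blast
    qed
  qed
  then obtain b where b: "b \<in> A" "eA = x \<circ> b" using E_generate[OF g eA_in] by blast
  have triv: "\<exists>l. c = oscale l eA" if c: "c \<in> hom_part eB" for c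
  proof -
    have cA: "c \<in> A" using c by (rule hom_partD)
    have "E (eB \<circ> g) (c \<circ> x) = c \<circ> E g x" by (rule hom_part_comp[OF Gamma_one g c xA])
    then have "E g (c \<circ> x) = c \<circ> x"
      using eB_left[OF Gamma_in[OF g]] hom_partD(2)[OF x] by simp
    then have "c \<circ> x \<in> hom_part g" using A_comp[OF cA xA] by (simp add: hom_part_def)
    then obtain l where l: "c \<circ> x = oscale l x" using x1 by blast
    have "c = c \<circ> (x \<circ> b)" using eA_right[OF cA] b(2) by simp
    also have "\<dots> = (c \<circ> x) \<circ> b" by (rule comp_assoc[symmetric])
    also have "\<dots> = oscale l eA" unfolding l scale_comp b(2) ..
    finally show ?thesis by blast
  qed
  obtain h' where h': "h' \<in> \<Gamma>" "h \<circ> h' = eB" "h' \<circ> h = eB" using Gamma_inv[OF h] by blast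
  have "\<exists>a\<in>A. \<exists>b\<in>A. E h a \<circ> E h' b \<noteq> 0"
  proof (rule ccontr)
    assume "\<not> ?thesis"
    then have z: "\<And>a b. a \<in> A \<Longrightarrow> b \<in> A \<Longrightarrow> E h a \<circ> E h' b = 0" by blast
    have "ops.span {E h a \<circ> b |a b. a \<in> A \<and> b \<in> A} \<subseteq> {c \<in> A. E eB c = 0}"
    proof (rule ops.span_minimal)
      show "{E h a \<circ> b |a b. a \<in> A \<and> b \<in> A} \<subseteq> {c \<in> A. E eB c = 0}"
      proof clarify
        fix a b assume ab: "a \<in> A" "b \<in> A"
        have "E (h \<circ> h') (E h a \<circ> b) = E h a \<circ> E h' b"
          by (rule hom_part_comp[OF h h'(1) E_hom_part[OF h ab(1)] ab(2)])
        then show "E h a \<circ> b \<in> A \<and> E eB (E h a \<circ> b) = 0"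
          using z[OF ab] h'(2) A_comp[OF E_in[OF h ab(1)] ab(2)] by simp
      qed
      show "ops.subspace {c \<in> A. E eB c = 0}"
        unfolding ops.subspace_def
        using A_0 A_add A_scale E_add[OF Gamma_one] E_scale[OF Gamma_one] lin_on_zero[OF A_sub E_lin[OF Gamma_one]]
        by auto
    qed
    then have "E eB eA = 0" using E_generate[OF h eA_in] by blast
    then show False using hom_partD(2)[OF unit_hom_part] eA_nonzero by simp
  qed
  then obtain a b where ab: "a \<in> A" "b \<in> A" "E h a \<circ> E h' b \<noteq> 0" by blast
  have hb: "E h' b \<in> hom_part h'" and ha: "E h a \<in> hom_part h"
    using E_hom_part h h'(1) ab by blast+
  have "E (h \<circ> h') (E h a \<circ> E h' b) = E h a \<circ> E h' (E h' b)"
    by (rule hom_part_comp[OF h h'(1) ha hom_partD(1)[OF hb]])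
  then have "E h a \<circ> E h' b \<in> hom_part eB"
    using h'(2) hom_partD(2)[OF hb] A_comp[OF hom_partD(1)[OF ha] hom_partD(1)[OF hb]] by (simp add: hom_part_def)
  then obtain l where l: "E h a \<circ> E h' b = oscale l eA" using triv by blast
  have l0: "l \<noteq> 0" using l ab(3) by auto
  show ?thesis
  proof (rule that[of "E h a"])
    fix y assume y: "y \<in> hom_part h"
    have yA: "y \<in> A" using y by (rule hom_partD)
    have "E (h' \<circ> h) (E h' b \<circ> y) = E h' b \<circ> E h y" by (rule hom_part_comp[OF h'(1) h hb yA])
    then have "E h' b \<circ> y \<in> hom_part eB"
      using h'(3) hom_partD(2)[OF y] A_comp[OF hom_partD(1)[OF hb] yA] by (simp add: hom_part_def)
    then obtain m where m: "E h' b \<circ> y = oscale m eA" using triv by blast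
    have "oscale l y = oscale l eA \<circ> y" using eA_left[OF yA] by (simp only: scale_comp)
    also have "\<dots> = E h a \<circ> (E h' b \<circ> y)" unfolding l[symmetric] by (rule comp_assoc)
    also have "\<dots> = oscale m (E h a)"
      unfolding m using hom_partD(1)[OF ha]
      by (simp only: oper_comp_scale[OF A_bdd A_bdd] eA_in eA_right)
    finally have "oscale (1 / l) (oscale l y) = oscale (1 / l) (oscale m (E h a))" by simp
    then have "y = oscale (1 / l * m) (E h a)" using l0 by (simp only: ops.scale_scale) simp
    then show "\<exists>c. y = oscale c (E h a)" by blast
  qed
qed

end

context group_dual_subgroup
begin

text \<open>Otherwise two independent vectors could be chosen in each of the \<open>card \<Gamma>\<close> components, and together
  they would be independent in \<open>A\<close>. Starting from \<open>0\<close> the assumption yields first a non-zero vector and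
  then a second one.\<close>

lemma exists_one_dim_part:
  assumes S: "finite S" "A = ops.span S" and card: "card S < 2 * card \<Gamma>"
  shows "\<exists>g\<in>\<Gamma>. \<exists>x\<in>hom_part g. \<forall>y\<in>hom_part g. \<exists>c. y = oscale c x"
proof (rule ccontr)
  assume "\<not> ?thesis"
  then have two: "\<exists>y\<in>hom_part g. \<forall>c. y \<noteq> oscale c x" if "g \<in> \<Gamma>" "x \<in> hom_part g" for g x
    using that by blast
  have "\<exists>W. finite W \<and> ops.independent W \<and> card W = 2 * card K \<and> W \<subseteq> A \<and>
      (\<forall>w\<in>W. \<forall>g\<in>\<Gamma> - K. E g w = 0)"
    if K: "finite K" "K \<subseteq> \<Gamma>" for K
    using K
  proof (induction K rule: finite_induct)
    case empty
    then show ?case by (intro exI[of _ "{}"] conjI ops.independent_empty) simp_all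
  next
    case (insert g K)
    have "K \<subseteq> \<Gamma>" using insert.prems by simp
    then obtain W where "finite W \<and> ops.independent W \<and> card W = 2 * card K \<and> W \<subseteq> A \<and>
        (\<forall>w\<in>W. \<forall>g\<in>\<Gamma> - K. E g w = 0)"
      using insert.IH by (elim exE meta_impE)
    then have W: "finite W" "ops.independent W" "card W = 2 * card K" "W \<subseteq> A"
        and WE: "\<And>w h. w \<in> W \<Longrightarrow> h \<in> \<Gamma> - K \<Longrightarrow> E h w = 0"
      by simp_all
    have g: "g \<in> \<Gamma>" "g \<notin> K" using insert by auto
    have z: "0 \<in> hom_part g" using A_0 lin_on_zero[OF A_sub E_lin[OF g(1)]] by (simp add: hom_part_def)
    obtain x where x: "x \<in> hom_part g" "\<And>c. x \<noteq> oscale c 0" using two[OF g(1) z] by blast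
    obtain y where y: "y \<in> hom_part g" "\<And>c. y \<noteq> oscale c x" using two[OF g(1) x(1)] by blast
    have xA: "x \<in> A" and yA: "y \<in> A" using x y hom_partD by blast+
    have ker: "ops.span W \<subseteq> {w \<in> A. E g w = 0}"
    proof (rule ops.span_minimal)
      show "W \<subseteq> {w \<in> A. E g w = 0}" using W(4) WE g by blast
      show "ops.subspace {w \<in> A. E g w = 0}"
        unfolding ops.subspace_def
        using A_0 A_add A_scale E_add[OF g(1)] E_scale[OF g(1)] lin_on_zero[OF A_sub E_lin[OF g(1)]]
        by auto
    qed
    have xW: "x \<notin> ops.span W"
    proof
      assume "x \<in> ops.span W"
      then have "E g x = 0" using ker by blast
      then show False using hom_partD(2)[OF x(1)] x(2)[of 0] by simp
    qed
    have yW: "y \<notin> ops.span (insert x W)"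
    proof
      assume "y \<in> ops.span (insert x W)"
      then obtain k where "y - oscale k x \<in> ops.span W" using ops.span_breakdown_eq by blast
      then have "E g (y - oscale k x) = 0" using ker by blast
      moreover have "y - oscale k x = y + oscale (- k) x"
        by (simp only: ops.scale_minus_left) simp
      ultimately have "y + oscale (- k) x = 0"
        using E_add[OF g(1) yA A_scale[OF xA]] E_scale[OF g(1) xA] hom_partD(2)[OF x(1)] hom_partD(2)[OF y(1)]
        by metis
      then have "y = oscale k x" by (simp only: ops.scale_minus_left) simp
      then show False using y(2) by blast
    qed
    have ind: "ops.independent (insert y (insert x W))"
      by (intro ops.independent_insertI xW yW W(2))
    have "x \<notin> W" "y \<notin> insert x W" using xW yW ops.span_base by blast+
    then have "card (insert y (insert x W)) = 2 * card (insert g K)"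
      using W(1,3) insert.hyps by simp
    moreover have "\<forall>w\<in>insert y (insert x W). \<forall>h\<in>\<Gamma> - insert g K. E h w = 0"
      using WE E_other[OF x(1) g(1)] E_other[OF y(1) g(1)] by blast
    moreover have "finite (insert y (insert x W))" "insert y (insert x W) \<subseteq> A"
      using W(1,4) xA yA by simp_all
    ultimately show ?case
      using ind by (intro exI[of _ "insert y (insert x W)"] conjI)
  qed
  from this[OF Gamma_finite order_refl] obtain W where
    "finite W \<and> ops.independent W \<and> card W = 2 * card \<Gamma> \<and> W \<subseteq> A \<and>
        (\<forall>w\<in>W. \<forall>g\<in>\<Gamma> - \<Gamma>. E g w = 0)"
    by (rule exE)
  then have W: "finite W" "ops.independent W" "card W = 2 * card \<Gamma>" "W \<subseteq> ops.span S"
    using S(2) by simp_all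
  then have "2 * card \<Gamma> \<le> card S" using ops.independent_span_bound[OF S(1) W(2,4)] by simp
  then show False using card by simp
qed

text \<open>A preimage of the group element \<open>g\<close> that is homogeneous of degree \<open>g\<close>.\<close>

definition lift :: "'j oper \<Rightarrow> 'i oper" where
  "lift g = E g (SOME a. a \<in> A \<and> \<pi> a = g)"

lemma lift:
  assumes g: "g \<in> \<Gamma>"
  shows "lift g \<in> hom_part g" "h \<in> \<Gamma> \<Longrightarrow> cf h (lift g) = (if h = g then 1 else 0)"
proof -
  have ex: "\<exists>a. a \<in> A \<and> \<pi> a = g" using pi_surj Gamma_in[OF g] by (metis imageE)
  define a where "a = (SOME a. a \<in> A \<and> \<pi> a = g)"
  have a: "a \<in> A" "\<pi> a = g" using someI_ex[OF ex] unfolding a_def by blast+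
  have l: "lift g = E g a" by (simp only: lift_def a_def)
  show "lift g \<in> hom_part g" unfolding l by (rule E_hom_part[OF g a(1)])
  show "cf h (lift g) = (if h = g then 1 else 0)" if h: "h \<in> \<Gamma>"
    unfolding l using cf_E[OF h g a(1)] cf_eq[OF h a(1)] a(2) coord_Gamma[OF h g] by (cases "h = g") auto
qed

text \<open>All components are one-dimensional, hence the lifts of the group elements form a basis of \<open>A\<close>;
  expanding \<open>\<Delta> a\<close> in the basis of their tensor products has coefficients
  \<open>cf g (E h a) = \<delta>\<^sub>g\<^sub>h cf g a\<close>, so that only the symmetric terms \<open>lift g \<otimes> lift g\<close> occur.\<close>

theorem cocommutative_if_small:
  assumes S: "finite S" "A = ops.span S" and card: "card S < 2 * card \<Gamma>"
  shows "cocommutative G"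
proof -
  obtain g x where g: "g \<in> \<Gamma>" and x: "x \<in> hom_part g" "\<And>y. y \<in> hom_part g \<Longrightarrow> \<exists>c. y = oscale c x"
    using exists_one_dim_part[OF assms] by blast
  have E_lift: "E h a = oscale (cf h a) (lift h)" if h: "h \<in> \<Gamma>" and a: "a \<in> A" for h a
  proof -
    obtain z where z: "\<And>y. y \<in> hom_part h \<Longrightarrow> \<exists>c. y = oscale c z"
      using one_dim_hom_parts[OF g x h] by blast
    obtain c where c: "E h a = oscale c z" using z[OF E_hom_part[OF h a]] by blast
    obtain d where d: "lift h = oscale d z" using z[OF lift(1)[OF h]] by blast
    have dz: "d * cf h z = 1"
      using lift(2)[OF h h] unfolding d by (simp add: evalf_scale[OF cf_evalf[OF h]])
    have "cf h a = c * cf h z"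
      using cf_E[OF h h a] unfolding c by (simp add: evalf_scale[OF cf_evalf[OF h]])
    then have "cf h a * d = c" using dz by (simp add: algebra_simps)
    then show ?thesis unfolding c d by (simp only: ops.scale_scale)
  qed
  have expand: "a = (\<Sum>g\<in>\<Gamma>. oscale (cf g a) (lift g))" if a: "a \<in> A" for a
  proof -
    have "(\<Sum>g\<in>\<Gamma>. E g a) = (\<Sum>g\<in>\<Gamma>. oscale (cf g a) (lift g))"
      using E_lift a by (intro sum.cong refl)
    then show ?thesis using E_sum[OF a] by simp
  qed
  have lA: "lift g \<in> A" if "g \<in> \<Gamma>" for g using lift(1)[OF that] by (rule hom_partD)
  have expand2: "T = (\<Sum>g\<in>\<Gamma>. \<Sum>h\<in>\<Gamma>. oscale (cf g (sl h T)) (lift g \<otimes>\<^sub>o lift h))" if T: "T \<in> AA" for T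
    using fin fin T
  proof (induction rule: ctensor_induct)
    case (tensor a b)
    have l1: "lin_on A (\<lambda>x. x \<otimes>\<^sub>o b)"
      unfolding lin_on_def using otensor_linear(1,3)[OF A_bdd A_bdd A_bdd A_bdd] tensor(2) by blast
    have l2: "lin_on A (\<lambda>x. lift g \<otimes>\<^sub>o x)" if "g \<in> \<Gamma>" for g
      unfolding lin_on_def using otensor_linear(2,4)[OF A_bdd A_bdd A_bdd A_bdd] lA[OF that] by blast
    have "a \<otimes>\<^sub>o b = (\<Sum>g\<in>\<Gamma>. oscale (cf g a) (lift g)) \<otimes>\<^sub>o b"
      using expand[OF tensor(1)] by (rule arg_cong)
    also have "\<dots> = (\<Sum>g\<in>\<Gamma>. oscale (cf g a) (lift g) \<otimes>\<^sub>o b)"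
      by (intro lin_on_sum[OF A_sub l1] A_scale lA)
    also have "\<dots> = (\<Sum>g\<in>\<Gamma>. \<Sum>h\<in>\<Gamma>. oscale (cf g (sl h (a \<otimes>\<^sub>o b))) (lift g \<otimes>\<^sub>o lift h))"
    proof (rule sum.cong[OF refl])
      fix g assume g: "g \<in> \<Gamma>"
      have "lift g \<otimes>\<^sub>o b = lift g \<otimes>\<^sub>o (\<Sum>h\<in>\<Gamma>. oscale (cf h b) (lift h))"
        using expand[OF tensor(2)] by (rule arg_cong)
      also have "\<dots> = (\<Sum>h\<in>\<Gamma>. lift g \<otimes>\<^sub>o oscale (cf h b) (lift h))"
        by (intro lin_on_sum[OF A_sub l2[OF g]] A_scale lA)
      finally have lb: "lift g \<otimes>\<^sub>o b = (\<Sum>h\<in>\<Gamma>. lift g \<otimes>\<^sub>o oscale (cf h b) (lift h))" .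
      have "oscale (cf g a) (lift g) \<otimes>\<^sub>o b = oscale (cf g a) (lift g \<otimes>\<^sub>o b)"
        using lA[OF g] tensor(2) by (simp only: otensor_linear(3)[OF A_bdd A_bdd A_bdd A_bdd])
      also have "\<dots> = (\<Sum>h\<in>\<Gamma>. oscale (cf g a) (lift g \<otimes>\<^sub>o oscale (cf h b) (lift h)))"
        unfolding lb by (rule ops.scale_sum_right)
      also have "\<dots> = (\<Sum>h\<in>\<Gamma>. oscale (cf g (sl h (a \<otimes>\<^sub>o b))) (lift g \<otimes>\<^sub>o lift h))"
      proof (rule sum.cong[OF refl])
        fix h assume h: "h \<in> \<Gamma>"
        show "oscale (cf g a) (lift g \<otimes>\<^sub>o oscale (cf h b) (lift h))
            = oscale (cf g (sl h (a \<otimes>\<^sub>o b))) (lift g \<otimes>\<^sub>o lift h)"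
          using lA[OF g] lA[OF h] tensor
          by (simp only: otensor_linear(4)[OF A_bdd A_bdd A_bdd A_bdd] ops.scale_scale sl_tensor[OF h]
              evalf_scale[OF cf_evalf[OF g]] cf_eq[OF h] mult.commute)
      qed
      finally show "oscale (cf g a) (lift g) \<otimes>\<^sub>o b
          = (\<Sum>h\<in>\<Gamma>. oscale (cf g (sl h (a \<otimes>\<^sub>o b))) (lift g \<otimes>\<^sub>o lift h))" .
    qed
    finally show ?case .
  next
    case zero
    have "(\<Sum>g\<in>\<Gamma>. \<Sum>h\<in>\<Gamma>. oscale (cf g (sl h 0)) (lift g \<otimes>\<^sub>o lift h)) = 0"
      by (intro sum.neutral ballI) (simp only: sl_0 evalf_0[OF cf_evalf] ops.scale_zero_left)
    then show ?case by (rule sym)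
  next
    case (add S T)
    have "(\<Sum>g\<in>\<Gamma>. \<Sum>h\<in>\<Gamma>. oscale (cf g (sl h (S + T))) (lift g \<otimes>\<^sub>o lift h))
      = (\<Sum>g\<in>\<Gamma>. \<Sum>h\<in>\<Gamma>. oscale (cf g (sl h S)) (lift g \<otimes>\<^sub>o lift h)
          + oscale (cf g (sl h T)) (lift g \<otimes>\<^sub>o lift h))"
      by (intro sum.cong refl) (simp only: sl_add evalf_add[OF cf_evalf] ops.scale_left_distrib)
    also have "\<dots> = S + T" unfolding sum.distrib using add(3,4) by simp
    finally show ?case by (rule sym)
  next
    case (scale c T)
    have "(\<Sum>g\<in>\<Gamma>. \<Sum>h\<in>\<Gamma>. oscale (cf g (sl h (oscale c T))) (lift g \<otimes>\<^sub>o lift h))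
      = (\<Sum>g\<in>\<Gamma>. \<Sum>h\<in>\<Gamma>. oscale c (oscale (cf g (sl h T)) (lift g \<otimes>\<^sub>o lift h)))"
      by (intro sum.cong refl) (simp only: sl_scale evalf_scale[OF cf_evalf] ops.scale_scale)
    also have "\<dots> = oscale c T" unfolding ops.scale_sum_right[symmetric] using scale(2) by simp
    finally show ?case by (rule sym)
  qed
  have flip_sum: "oflip (\<Sum>x\<in>X. F x) = (\<Sum>x\<in>X. oflip (F x))" for X and F :: "'j oper \<Rightarrow> ('i \<times> 'i) oper"
    by (rule lin_on_sum[OF ops.subspace_UNIV]) (simp_all only: lin_on_def oflip_linear UNIV_I simp_thms ball_simps)
  have "oflip (\<Delta> a) = \<Delta> a" if a: "a \<in> A" for a
  proof -
    have "\<Delta> a = (\<Sum>g\<in>\<Gamma>. \<Sum>h\<in>\<Gamma>. oscale (cf g (sl h (\<Delta> a))) (lift g \<otimes>\<^sub>o lift h))"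
      by (rule expand2[OF Delta_in[OF a]])
    also have "\<dots> = (\<Sum>g\<in>\<Gamma>. oscale (cf g a) (lift g \<otimes>\<^sub>o lift g))"
    proof (rule sum.cong[OF refl])
      fix g assume g: "g \<in> \<Gamma>"
      have "(\<Sum>h\<in>\<Gamma>. oscale (cf g (sl h (\<Delta> a))) (lift g \<otimes>\<^sub>o lift h))
          = (\<Sum>h\<in>\<Gamma>. if h = g then oscale (cf g a) (lift g \<otimes>\<^sub>o lift g) else 0)"
        using cf_E[OF g _ a] unfolding E_def by (intro sum.cong refl) simp
      then show "(\<Sum>h\<in>\<Gamma>. oscale (cf g (sl h (\<Delta> a))) (lift g \<otimes>\<^sub>o lift h)) = oscale (cf g a) (lift g \<otimes>\<^sub>o lift g)"
        using g Gamma_finite by (simp only: sum.delta if_True)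
    qed
    finally have Da: "\<Delta> a = (\<Sum>g\<in>\<Gamma>. oscale (cf g a) (lift g \<otimes>\<^sub>o lift g))" .
    show ?thesis
      unfolding Da flip_sum oflip_linear
      by (intro sum.cong refl arg_cong[where f = "oscale _"] oflip_otensor A_bdd lA)
  qed
  then show ?thesis unfolding cocommutative_def by blast
qed

lemma nonclassical_noncommuting:
  assumes "\<not> classical H" shows "\<exists>v\<in>\<Gamma>. \<exists>w\<in>\<Gamma>. v \<circ> w \<noteq> w \<circ> v"
proof (rule ccontr)
  assume "\<not> ?thesis"
  then have c: "v \<circ> w = w \<circ> v" if "v \<in> \<Gamma>" "w \<in> \<Gamma>" for v w using that by blast
  have sub: "ops.subspace {b \<in> B. \<forall>v\<in>X. v \<circ> b = b \<circ> v}" if X: "X \<subseteq> B" for X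
    unfolding ops.subspace_def
  proof (intro conjI ballI allI)
    have "v \<circ> 0 = (0 :: 'j oper) \<circ> v" if "v \<in> X" for v
      using bdd_zero[OF B_bdd] that X by (auto simp: fun_eq_iff)
    then show "0 \<in> {b \<in> B. \<forall>v\<in>X. v \<circ> b = b \<circ> v}" using ops.subspace_0[OF B_sub] by blast
  next
    fix x y assume xy: "x \<in> {b \<in> B. \<forall>v\<in>X. v \<circ> b = b \<circ> v}" "y \<in> {b \<in> B. \<forall>v\<in>X. v \<circ> b = b \<circ> v}"
    have "v \<circ> (x + y) = (x + y) \<circ> v" if v: "v \<in> X" for v
    proof -
      have "v \<in> B" "x \<in> B" "y \<in> B" "v \<circ> x = x \<circ> v" "v \<circ> y = y \<circ> v" using v X xy by blast+
      then show ?thesis by (simp only: oper_comp_add[OF B_bdd B_bdd B_bdd] add_comp)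
    qed
    then show "x + y \<in> {b \<in> B. \<forall>v\<in>X. v \<circ> b = b \<circ> v}" using xy ops.subspace_add[OF B_sub] by blast
  next
    fix d x assume x: "x \<in> {b \<in> B. \<forall>v\<in>X. v \<circ> b = b \<circ> v}"
    have "v \<circ> oscale d x = oscale d x \<circ> v" if v: "v \<in> X" for v
    proof -
      have "v \<in> B" "x \<in> B" "v \<circ> x = x \<circ> v" using v X x by blast+
      then show ?thesis by (simp only: oper_comp_scale[OF B_bdd B_bdd] scale_comp)
    qed
    then show "oscale d x \<in> {b \<in> B. \<forall>v\<in>X. v \<circ> b = b \<circ> v}" using x ops.subspace_scale[OF B_sub] by blast
  qed
  have "ops.span \<Gamma> \<subseteq> {b \<in> B. \<forall>v\<in>\<Gamma>. v \<circ> b = b \<circ> v}"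
    using c Gamma_in by (intro ops.span_minimal sub) blast+
  then have c1: "v \<circ> b = b \<circ> v" if "v \<in> \<Gamma>" "b \<in> B" for v b using that Gamma_span by blast
  have "ops.span \<Gamma> \<subseteq> {b \<in> B. \<forall>v\<in>B. v \<circ> b = b \<circ> v}"
    using c1 Gamma_in by (intro ops.span_minimal sub) (blast intro: sym)+
  then have "classical H" unfolding classical_def using Gamma_span by blast
  then show False using assms by blast
qed

text \<open>Two non-commuting elements \<open>v\<close>, \<open>w\<close> of a group yield the five distinct elements
  \<open>1, v, w, vw, wv\<close>.\<close>

lemma card_Gamma_ge_5: assumes "\<not> classical H" shows "5 \<le> card \<Gamma>"
proof -
  obtain v w where vw: "v \<in> \<Gamma>" "w \<in> \<Gamma>" "v \<circ> w \<noteq> w \<circ> v" using nonclassical_noncommuting[OF assms] by blast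
  note B = Gamma_in[OF vw(1)] Gamma_in[OF vw(2)]
  obtain v' w' where inv: "v' \<in> \<Gamma>" "v' \<circ> v = eB" "v \<circ> v' = eB" "w' \<in> \<Gamma>" "w' \<circ> w = eB" "w \<circ> w' = eB"
    using Gamma_inv[OF vw(1)] Gamma_inv[OF vw(2)] by metis
  have e: "eB \<circ> v = v" "v \<circ> eB = v" "eB \<circ> w = w" "w \<circ> eB = w" using B eB_left eB_right by blast+
  have canc: "v \<circ> x = v \<Longrightarrow> x = eB" "w \<circ> x = w \<Longrightarrow> x = eB" if "x \<in> B" for x
    using Gamma_cancel[OF vw(1) that eB_in] Gamma_cancel[OF vw(2) that eB_in] e by simp_all
  have ne: "v \<noteq> eB" "w \<noteq> eB" "v \<noteq> w" using vw(3) e by auto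
  have "v \<circ> w \<noteq> v" "w \<circ> v \<noteq> w" using canc B ne by blast+
  moreover have "v \<circ> w \<noteq> w"
  proof
    assume "v \<circ> w = w"
    then have "(v \<circ> w) \<circ> w' = w \<circ> w'" by simp
    then show False using inv e ne(1) by (metis comp_assoc)
  qed
  moreover have "w \<circ> v \<noteq> v"
  proof
    assume "w \<circ> v = v"
    then have "(w \<circ> v) \<circ> v' = v \<circ> v'" by simp
    then show False using inv e ne(2) by (metis comp_assoc)
  qed
  moreover have "v \<circ> w \<noteq> eB"
  proof
    assume vwe: "v \<circ> w = eB"
    have "v \<circ> (w \<circ> v) = v \<circ> eB" using vwe e by (metis comp_assoc)
    then have "w \<circ> v = eB" using canc(1)[OF B_comp[OF B(2,1)]] e by simp
    then show False using vwe vw(3) by simp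
  qed
  moreover have "w \<circ> v \<noteq> eB"
  proof
    assume wve: "w \<circ> v = eB"
    have "w \<circ> (v \<circ> w) = w \<circ> eB" using wve e by (metis comp_assoc)
    then have "v \<circ> w = eB" using canc(2)[OF B_comp[OF B(1,2)]] e by simp
    then show False using wve vw(3) by simp
  qed
  moreover have "card {a, b, c, d, e} = 5"
    if "b \<noteq> a" "c \<noteq> a" "b \<noteq> c" "d \<noteq> b" "e \<noteq> c" "d \<noteq> c" "e \<noteq> b" "d \<noteq> a" "e \<noteq> a" "d \<noteq> e"
    for a b c d e :: "'j oper"
    using that by (auto simp: card_insert_if)
  ultimately have "card {eB, v, w, v \<circ> w, w \<circ> v} = 5" using ne vw(3) by metis
  moreover have "{eB, v, w, v \<circ> w, w \<circ> v} \<subseteq> \<Gamma>" using vw Gamma_one Gamma_comp by blast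
  ultimately show ?thesis using card_mono[OF Gamma_finite] by metis
qed

end

section \<open>Block algebras\<close>

lemma munit_apply: "x \<in> l2 \<Longrightarrow> munit p q x i = (if i = p then x q else 0)"
  by (simp add: munit_def)

lemma bounded_munit: "bounded_oper (munit p q)"
proof -
  have main: "munit p q x \<in> l2 \<and> l2norm (munit p q x) \<le> 1 * l2norm x" if x: "x \<in> l2" for x
  proof -
    have "(\<Sum>i\<in>F. (cmod (munit p q x i))\<^sup>2) \<le> (l2norm x)\<^sup>2" if F: "finite F" for F
    proof -
      have "(\<Sum>i\<in>F. (cmod (munit p q x i))\<^sup>2) = (\<Sum>i\<in>F. if i = p then (cmod (x q))\<^sup>2 else 0)"
        using x by (intro sum.cong) (auto simp: munit_apply)
      also have "\<dots> \<le> (cmod (x q))\<^sup>2" using F by (simp add: sum.delta)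
      also have "\<dots> \<le> (l2norm x)\<^sup>2" using cmod_le_l2norm[OF x, of q] by (intro power_mono) auto
      finally show ?thesis .
    qed
    then show ?thesis using l2norm_leI[of "munit p q x" "l2norm x"] by simp
  qed
  show ?thesis
  proof (rule bounded_operI[where C = 1])
    fix x y :: "'a vec" assume xy: "x \<in> l2" "y \<in> l2"
    show "munit p q (x + y) = munit p q x + munit p q y"
      using munit_apply[OF xy(1), of p q] munit_apply[OF xy(2), of p q] munit_apply[OF l2_add(1)[OF xy], of p q]
      by (intro ext) simp
  next
    fix c and x :: "'a vec" assume x: "x \<in> l2"
    show "munit p q (\<lambda>i. c * x i) = (\<lambda>i. c * munit p q x i)"
      using munit_apply[OF x, of p q] munit_apply[OF l2_scale(1)[OF x], of p q]
      by (intro ext) simp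
  qed (use main in \<open>auto simp: munit_def\<close>)
qed

lemma munit_ket: "munit p q (ket r) i = (if i = p \<and> r = q then 1 else 0)"
  by (simp add: munit_apply) (simp add: ket_def)

lemma entry_ket: "entry T p q = T (ket q) p"
  by (simp add: entry_def ket_def)

lemma entry_munit: "entry (munit p q) r s = (if r = p \<and> s = q then 1 else 0)"
  by (simp add: entry_ket munit_ket)

lemma entry_add: "entry (S + T) p q = entry S p q + entry T p q"
  and entry_scale: "entry (oscale c T) p q = c * entry T p q"
  and entry_zero: "entry 0 p q = 0"
  by (simp_all add: entry_ket oscale_apply)

lemma entry_sum: "entry (\<Sum>x\<in>X. F x) p q = (\<Sum>x\<in>X. entry (F x) p q)"
proof (induction X rule: infinite_finite_induct)
  case (insert x X)
  then show ?case by (simp only: sum.insert[OF insert.hyps(1,2)] entry_add)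
qed (simp_all only: sum.infinite sum.empty entry_zero not_False_eq_True)

lemma entry_eqI:
  assumes "bounded_oper S" "bounded_oper T" "\<And>p q. entry S p q = entry T p q" shows "S = T"
  using assms by (intro oper_eqI) (auto simp: entry_ket)

lemma munit_comp: "munit p q \<circ> munit r s = (if q = r then munit p s else 0)"
proof (rule entry_eqI)
  show "bounded_oper (if q = r then munit p s else 0)" by (simp add: bounded_munit bounded_oper_zero)
  fix i j show "entry (munit p q \<circ> munit r s) i j = entry (if q = r then munit p s else 0) i j"
    using bdd_in_l2[OF bounded_munit[of r s], of "ket j"]
    by (simp add: entry_ket munit_apply munit_ket)
qed (intro bounded_oper_comp bounded_munit)

lemma entry_otensor:
  assumes "bounded_oper a" "bounded_oper b"
  shows "entry (a \<otimes>\<^sub>o b) (p, r) (q, s) = entry a p q * entry b r s"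
  using assms by (simp add: entry_ket ket_pair otensor_tvec tvec_apply)

lemma munit_otensor: "munit p q \<otimes>\<^sub>o munit r s = munit (p, r) (q, s)"
proof (rule entry_eqI)
  fix i j show "entry (munit p q \<otimes>\<^sub>o munit r s) i j = entry (munit (p, r) (q, s)) i j"
    by (cases i; cases j) (simp add: entry_otensor bounded_munit entry_munit)
qed (simp_all add: bounded_munit bounded_otensor)

text \<open>The algebra of finite matrices supported on \<open>R\<close>. When \<open>R\<close> is a finite partial equivalence relation this
  is a direct sum of matrix algebras, one for each class of \<open>R\<close>.\<close>

definition blk :: "('i \<times> 'i) set \<Rightarrow> 'i oper set" where
  "blk R = ops.span ((\<lambda>(p, q). munit p q) ` R)"

definition of_mat :: "('i \<times> 'i) set \<Rightarrow> ('i \<Rightarrow> 'i \<Rightarrow> complex) \<Rightarrow> 'i oper" where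
  "of_mat R M = (\<Sum>(p, q)\<in>R. oscale (M p q) (munit p q))"

lemma blk_bdd: "T \<in> blk R \<Longrightarrow> bounded_oper T"
  unfolding blk_def by (rule bounded_oper_span) (auto simp: bounded_munit)

lemma findim_blk: "finite R \<Longrightarrow> findim (blk R)"
  unfolding findim_def blk_def
  by (intro exI[of _ "(\<lambda>(p, q). munit p q) ` R"]) (auto simp: bounded_munit)

lemma blk_subspace: "ops.subspace (blk R)"
  by (simp add: blk_def)

lemma munit_in_blk: "(p, q) \<in> R \<Longrightarrow> munit p q \<in> blk R"
  unfolding blk_def by (rule ops.span_base) force

lemma of_mat_in_blk: "of_mat R M \<in> blk R"
  unfolding of_mat_def by (intro ops.subspace_sum blk_subspace) (auto intro!: ops.subspace_scale blk_subspace munit_in_blk)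

lemma entry_of_mat: assumes "finite R" shows "entry (of_mat R M) p q = (if (p, q) \<in> R then M p q else 0)"
proof -
  have "entry (of_mat R M) p q = (\<Sum>(r, s)\<in>R. M r s * (if p = r \<and> q = s then 1 else 0))"
    unfolding of_mat_def entry_sum
    by (intro sum.cong refl) (simp only: entry_scale entry_munit split: prod.splits, simp)
  also have "\<dots> = (\<Sum>x\<in>R. if x = (p, q) then M p q else 0)" by (intro sum.cong) (auto split: if_splits)
  finally show ?thesis using assms by simp
qed

lemma entry_outside: assumes "T \<in> blk R" "(p, q) \<notin> R" shows "entry T p q = 0"
proof -
  have "blk R \<subseteq> {T. entry T p q = 0}"
    unfolding blk_def
    by (rule ops.span_minimal) (use assms(2) in \<open>auto simp: entry_munit ops.subspace_def entry_add entry_scale entry_zero\<close>)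
  then show ?thesis using assms(1) by blast
qed

lemma blk_eqI:
  assumes "S \<in> blk R" "T \<in> blk R" "\<And>p q. (p, q) \<in> R \<Longrightarrow> entry S p q = entry T p q" shows "S = T"
proof (rule entry_eqI[OF blk_bdd[OF assms(1)] blk_bdd[OF assms(2)]])
  fix p q show "entry S p q = entry T p q"
    using assms(3) entry_outside[OF assms(1), of p q] entry_outside[OF assms(2), of p q]
    by (cases "(p, q) \<in> R") auto
qed

lemma blk_expand: assumes "finite R" "T \<in> blk R" shows "T = of_mat R (entry T)"
  by (rule blk_eqI[OF assms(2) of_mat_in_blk]) (simp add: entry_of_mat[OF assms(1)])

lemma oper_sum_apply: "(\<Sum>a\<in>X. F a) x i = (\<Sum>a\<in>X. F a x i)" for F :: "'a \<Rightarrow> 'i oper"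
  by (induction X rule: infinite_finite_induct) auto

lemma blk_apply:
  assumes R: "finite R" and T: "T \<in> blk R" and x: "x \<in> l2"
  shows "T x p = (\<Sum>r\<in>R `` {p}. entry T p r * x r)"
proof -
  have "T x p = (\<Sum>a\<in>R. (case a of (r, s) \<Rightarrow> oscale (entry T r s) (munit r s)) x p)"
    unfolding oper_sum_apply[symmetric] using blk_expand[OF R T, unfolded of_mat_def]
    by (rule arg_cong[where f = "\<lambda>T. T x p"])
  also have "\<dots> = (\<Sum>a\<in>R. if fst a = p then entry T p (snd a) * x (snd a) else 0)"
    using x by (intro sum.cong) (auto simp: oscale_apply munit_apply)
  also have "\<dots> = (\<Sum>a\<in>{a\<in>R. fst a = p}. entry T p (snd a) * x (snd a))"
    using R by (simp add: sum.inter_filter)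
  also have "\<dots> = (\<Sum>r\<in>R `` {p}. entry T p r * x r)"
    by (rule sum.reindex_bij_witness[of _ "Pair p" snd]) auto
  finally show ?thesis .
qed

lemma entry_comp:
  assumes "finite R" "S \<in> blk R" "bounded_oper T"
  shows "entry (S \<circ> T) p q = (\<Sum>r\<in>R `` {p}. entry S p r * entry T r q)"
  using blk_apply[OF assms(1,2) bdd_in_l2[OF assms(3)]] by (simp add: entry_ket)

lemma blk_comp:
  assumes R: "finite R" "trans R" and S: "S \<in> blk R" and T: "T \<in> blk R"
  shows "S \<circ> T \<in> blk R"
proof -
  have "S \<circ> T = of_mat R (entry (S \<circ> T))"
  proof (rule entry_eqI)
    fix p q
    have "entry (S \<circ> T) p q = 0" if pq: "(p, q) \<notin> R"
    proof -
      have "entry S p r * entry T r q = 0" for r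
        using pq R(2) entry_outside[OF S] entry_outside[OF T] by (metis mult_eq_0_iff transD)
      then show ?thesis unfolding entry_comp[OF R(1) S blk_bdd[OF T]] by (intro sum.neutral) simp
    qed
    then show "entry (S \<circ> T) p q = entry (of_mat R (entry (S \<circ> T))) p q"
      by (simp add: entry_of_mat[OF R(1)])
  qed (use S T blk_bdd of_mat_in_blk bounded_oper_comp in blast)+
  then show ?thesis using of_mat_in_blk by metis
qed

lemma l2inner_finite:
  assumes "finite F" "\<And>i. i \<notin> F \<Longrightarrow> cnj (x i) * y i = 0"
  shows "l2inner x y = (\<Sum>i\<in>F. cnj (x i) * y i)"
proof -
  have "l2inner x y = infsum (\<lambda>i. cnj (x i) * y i) F"
    unfolding l2inner_def by (rule infsum_cong_neutral) (use assms(2) in auto)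
  then show ?thesis using assms(1) by simp
qed

definition mat_adj :: "('i \<times> 'i) set \<Rightarrow> 'i oper \<Rightarrow> 'i oper" where
  "mat_adj R T = of_mat R (\<lambda>p q. cnj (entry T q p))"

lemma is_adjoint_blk:
  assumes R: "finite R" "sym R" and T: "T \<in> blk R"
  shows "is_adjoint T (mat_adj R T)"
  unfolding is_adjoint_def
proof (intro ballI)
  fix x y :: "'a vec" assume x: "x \<in> l2" and y: "y \<in> l2"
  let ?F = "fst ` R"
  have F: "finite ?F" using R(1) by simp
  have R0: "R `` {p} = {}" if "p \<notin> ?F" for p using that by force
  have Rs: "R = Sigma ?F (\<lambda>p. R `` {p})" by force
  have fin: "finite (R `` {p})" for p using R(1) by (simp add: finite_Image)
  have "l2inner (T x) y = (\<Sum>p\<in>?F. cnj (T x p) * y p)"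
    by (rule l2inner_finite[OF F]) (simp add: blk_apply[OF R(1) T x] R0)
  also have "\<dots> = (\<Sum>p\<in>?F. \<Sum>r\<in>R `` {p}. cnj (entry T p r) * cnj (x r) * y p)"
    by (simp add: blk_apply[OF R(1) T x] sum_distrib_right)
  also have "\<dots> = (\<Sum>(p, r)\<in>Sigma ?F (\<lambda>p. R `` {p}). cnj (entry T p r) * cnj (x r) * y p)"
    by (rule sum.Sigma) (use F fin in auto)
  also have "\<dots> = (\<Sum>(p, r)\<in>R. cnj (entry T p r) * cnj (x r) * y p)" using Rs by simp
  also have "\<dots> = (\<Sum>(p, r)\<in>R. cnj (entry T r p) * cnj (x p) * y r)"
    by (rule sum.reindex_bij_witness[of _ prod.swap prod.swap]) (use R(2) in \<open>auto dest: symD\<close>)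
  also have "\<dots> = (\<Sum>(p, r)\<in>Sigma ?F (\<lambda>p. R `` {p}). cnj (entry T r p) * cnj (x p) * y r)" using Rs by simp
  also have "\<dots> = (\<Sum>p\<in>?F. \<Sum>r\<in>R `` {p}. cnj (entry T r p) * cnj (x p) * y r)"
    by (rule sum.Sigma[symmetric]) (use F fin in auto)
  also have "\<dots> = (\<Sum>p\<in>?F. cnj (x p) * mat_adj R T y p)"
    unfolding mat_adj_def blk_apply[OF R(1) of_mat_in_blk y]
    by (auto simp: sum_distrib_left entry_of_mat[OF R(1)] intro!: sum.cong)
  also have "\<dots> = l2inner x (mat_adj R T y)"
    unfolding mat_adj_def
    by (rule l2inner_finite[OF F, symmetric]) (simp add: blk_apply[OF R(1) of_mat_in_blk y] R0)
  finally show "l2inner (T x) y = l2inner x (mat_adj R T y)" .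
qed

lemma adj_blk:
  assumes R: "finite R" "sym R" and T: "T \<in> blk R"
  shows "adj T \<in> blk R" "entry (adj T) p q = cnj (entry T q p)"
proof -
  have e: "adj T = mat_adj R T"
    by (rule adj_eqI[OF _ is_adjoint_blk[OF assms]]) (simp add: mat_adj_def blk_bdd[OF of_mat_in_blk])
  show "adj T \<in> blk R" unfolding e mat_adj_def by (rule of_mat_in_blk)
  have "entry T q p = 0" if "(p, q) \<notin> R"
    using that R(2) by (intro entry_outside[OF T]) (auto dest: symD)
  then show "entry (adj T) p q = cnj (entry T q p)" unfolding e mat_adj_def entry_of_mat[OF R(1)] by simp
qed

definition blk_one :: "('i \<times> 'i) set \<Rightarrow> 'i oper" where
  "blk_one R = of_mat R (\<lambda>p q. if p = q then 1 else 0)"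

lemma is_unit_of_blk:
  assumes R: "finite R" "sym R" "trans R" shows "is_unit_of (blk R) (blk_one R)"
  unfolding is_unit_of_def
proof (intro conjI ballI)
  show 1: "blk_one R \<in> blk R" unfolding blk_one_def by (rule of_mat_in_blk)
  fix T assume T: "T \<in> blk R"
  have refl: "(p, p) \<in> R" "(q, q) \<in> R" if "(p, q) \<in> R" for p q using that R(2,3) by (meson symD transD)+
  have fin: "finite (R `` {p})" for p using R(1) by (simp add: finite_Image)
  show "blk_one R \<circ> T = T"
  proof (rule blk_eqI[OF blk_comp[OF R(1,3) 1 T] T])
    fix p q assume pq: "(p, q) \<in> R"
    have "entry (blk_one R \<circ> T) p q = (\<Sum>r\<in>R `` {p}. if r = p then entry T p q else 0)"
      unfolding entry_comp[OF R(1) 1 blk_bdd[OF T]] unfolding blk_one_def entry_of_mat[OF R(1)]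
      by (intro sum.cong) auto
    then show "entry (blk_one R \<circ> T) p q = entry T p q" using refl[OF pq] fin by simp
  qed
  show "T \<circ> blk_one R = T"
  proof (rule blk_eqI[OF blk_comp[OF R(1,3) T 1] T])
    fix p q assume pq: "(p, q) \<in> R"
    have "entry (T \<circ> blk_one R) p q = (\<Sum>r\<in>R `` {p}. if r = q then entry T p q else 0)"
      unfolding entry_comp[OF R(1) T blk_bdd[OF 1]] unfolding blk_one_def entry_of_mat[OF R(1)]
      using refl[OF pq] by (intro sum.cong) auto
    then show "entry (T \<circ> blk_one R) p q = entry T p q" using pq fin by simp
  qed
qed

lemmas unit_of_blk = unit_of_eqI[OF is_unit_of_blk]

lemma cstar_algebra_blk:
  assumes R: "finite R" "sym R" "trans R" shows "cstar_algebra (blk R)"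
  unfolding cstar_algebra_def
proof (intro conjI)
  show "\<forall>a\<in>blk R. \<exists>b\<in>blk R. is_adjoint a b"
    using is_adjoint_blk[OF R(1,2)] of_mat_in_blk unfolding mat_adj_def by blast
  show "norm_closure (blk R) \<subseteq> blk R"
    using findim_norm_closure[OF findim_blk[OF R(1)] order_refl blk_subspace] by simp
  show "\<exists>e. is_unit_of (blk R) e" using is_unit_of_blk[OF R] by blast
qed (use blk_bdd blk_subspace blk_comp[OF R(1,3)] in blast)+

definition relprod :: "('i \<times> 'i) set \<Rightarrow> ('j \<times> 'j) set \<Rightarrow> (('i \<times> 'j) \<times> 'i \<times> 'j) set" (infixr \<open>\<otimes>\<^sub>R\<close> 75) where
  "R \<otimes>\<^sub>R S = {((p, r), (q, s)) | p q r s. (p, q) \<in> R \<and> (r, s) \<in> S}"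

lemma relprod_iff [simp]: "((p, r), (q, s)) \<in> R \<otimes>\<^sub>R S \<longleftrightarrow> (p, q) \<in> R \<and> (r, s) \<in> S"
  by (auto simp: relprod_def)

lemma relprod_props:
  shows "finite R \<Longrightarrow> finite S \<Longrightarrow> finite (R \<otimes>\<^sub>R S)" "sym R \<Longrightarrow> sym S \<Longrightarrow> sym (R \<otimes>\<^sub>R S)"
    "trans R \<Longrightarrow> trans S \<Longrightarrow> trans (R \<otimes>\<^sub>R S)"
proof -
  assume "finite R" "finite S"
  moreover have "R \<otimes>\<^sub>R S = (\<lambda>((p, q), (r, s)). ((p, r), (q, s))) ` (R \<times> S)"
    by (force simp: relprod_def)
  ultimately show "finite (R \<otimes>\<^sub>R S)" by simp
next
  assume "sym R" "sym S" then show "sym (R \<otimes>\<^sub>R S)" by (auto simp: sym_def)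
next
  assume "trans R" "trans S" then show "trans (R \<otimes>\<^sub>R S)" unfolding trans_def by (auto; blast)
qed

lemma ctensor_blk:
  assumes "finite R" "finite S" shows "blk R \<otimes>\<^sub>C blk S = blk (R \<otimes>\<^sub>R S)"
proof -
  have "(\<lambda>(s, t). s \<otimes>\<^sub>o t) ` (((\<lambda>(p, q). munit p q) ` R) \<times> ((\<lambda>(p, q). munit p q) ` S))
      = (\<lambda>(p, q). munit p q) ` (R \<otimes>\<^sub>R S)"
    by (force simp: relprod_def munit_otensor image_def)
  then show ?thesis
    unfolding blk_def using assms by (subst ctensor_findim_span) (auto simp: bounded_munit)
qed

text \<open>A *-homomorphism out of a block algebra is a system of matrix units in the target.\<close>

lemma star_hom_blkI:
  assumes R: "finite R" "sym R" and R': "finite R'" "sym R'" "trans R'"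
    and in_blk: "\<And>p q. (p, q) \<in> R \<Longrightarrow> \<Phi> p q \<in> blk R'"
    and mult: "\<And>p q r s. (p, q) \<in> R \<Longrightarrow> (r, s) \<in> R \<Longrightarrow> \<Phi> p q \<circ> \<Phi> r s = (if q = r then \<Phi> p s else 0)"
    and star: "\<And>p q. (p, q) \<in> R \<Longrightarrow> adj (\<Phi> p q) = \<Phi> q p"
    and unit: "(\<Sum>(p, q)\<in>R. if p = q then \<Phi> p p else 0) = blk_one R'"
    and tr: "trans R"
  shows "star_hom (blk R) (blk R') (\<lambda>T. \<Sum>(p, q)\<in>R. oscale (entry T p q) (\<Phi> p q))"
proof -
  let ?f = "\<lambda>T. \<Sum>(p, q)\<in>R. oscale (entry T p q) (\<Phi> p q)"
  have f_in: "?f T \<in> blk R'" for T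
    by (intro ops.subspace_sum blk_subspace) (auto intro!: ops.subspace_scale blk_subspace in_blk)
  have f_add: "?f (S + T) = ?f S + ?f T" for S T
    unfolding sum.distrib[symmetric] by (intro sum.cong refl) (simp only: entry_add ops.scale_left_distrib split: prod.splits, simp)
  have f_scale: "?f (oscale c T) = oscale c (?f T)" for c T
    unfolding ops.scale_sum_right by (intro sum.cong refl) (simp only: entry_scale ops.scale_scale split: prod.splits, simp)
  have f_munit: "?f (munit p q) = \<Phi> p q" if pq: "(p, q) \<in> R" for p q
  proof -
    have "?f (munit p q) = (\<Sum>a\<in>R. if a = (p, q) then \<Phi> p q else 0)"
    proof (intro sum.cong refl, clarify)
      fix r s
      show "oscale (entry (munit p q) r s) (\<Phi> r s) = (if (r, s) = (p, q) then \<Phi> p q else 0)"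
        by (cases "(r, s) = (p, q)") (simp_all only: entry_munit prod.inject simp_thms if_True if_False
             ops.scale_one ops.scale_zero_left)
    qed
    then show ?thesis using pq R(1) by (simp only: sum.delta if_True)
  qed
  have f_lin: "lin_on UNIV ?f" unfolding lin_on_def using f_add f_scale by blast
  have f_comp: "?f (S \<circ> T) = ?f S \<circ> ?f T" if S: "S \<in> blk R" and T: "T \<in> blk R" for S T
  proof -
    have 1: "?f (munit p q \<circ> T) = \<Phi> p q \<circ> ?f T" if pq: "(p, q) \<in> R" and T: "T \<in> blk R" for p q T
    proof -
      have "blk R \<subseteq> {T \<in> blk R. ?f (munit p q \<circ> T) = \<Phi> p q \<circ> ?f T}" (is "_ \<subseteq> ?V")
      proof -
        have "(\<lambda>(p, q). munit p q) ` R \<subseteq> ?V"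
        proof clarify
          fix r s assume rs: "(r, s) \<in> R"
          have "?f (munit p q \<circ> munit r s) = (if q = r then \<Phi> p s else 0)"
          proof (cases "q = r")
            case True
            then have "(p, s) \<in> R" using pq rs tr by (blast dest: transD)
            then show ?thesis using True by (simp only: munit_comp if_True f_munit simp_thms)
          next
            case False
            then show ?thesis by (simp only: munit_comp if_False lin_on_zero[OF ops.subspace_UNIV f_lin])
          qed
          then show "munit r s \<in> blk R \<and> ?f (munit p q \<circ> munit r s) = \<Phi> p q \<circ> ?f (munit r s)"
            using munit_in_blk[OF rs] mult[OF pq rs] f_munit[OF rs] by simp
        qed
        moreover have "ops.subspace ?V"
          unfolding ops.subspace_def
        proof (intro conjI ballI allI)
          have "munit p q \<circ> 0 = (0 :: 'a oper)" using bdd_zero[OF bounded_munit] by (simp add: fun_eq_iff)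
          moreover have "\<Phi> p q \<circ> 0 = (0 :: 'b oper)" using bdd_zero[OF blk_bdd[OF in_blk[OF pq]]] by (simp add: fun_eq_iff)
          ultimately have "?f (munit p q \<circ> 0) = \<Phi> p q \<circ> ?f 0"
            by (simp only: lin_on_zero[OF ops.subspace_UNIV f_lin])
          then show "0 \<in> ?V" using ops.subspace_0[OF blk_subspace] by blast
        next
          fix x y assume x: "x \<in> ?V" and y: "y \<in> ?V"
          have "?f (munit p q \<circ> (x + y)) = \<Phi> p q \<circ> ?f (x + y)"
          proof -
            have "x \<in> blk R" "y \<in> blk R" using x y by blast+
            then have "munit p q \<circ> (x + y) = (munit p q \<circ> x) + (munit p q \<circ> y)"
              by (intro oper_comp_add bounded_munit blk_bdd)
            then have "?f (munit p q \<circ> (x + y)) = ?f (munit p q \<circ> x) + ?f (munit p q \<circ> y)" by (simp only: f_add)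
            also have "\<dots> = (\<Phi> p q \<circ> ?f x) + (\<Phi> p q \<circ> ?f y)" using x y by simp
            also have "\<dots> = \<Phi> p q \<circ> (?f x + ?f y)"
              by (rule oper_comp_add[symmetric]) (intro blk_bdd[OF in_blk[OF pq]] blk_bdd[OF f_in])+
            finally show ?thesis by (simp only: f_add)
          qed
          then show "x + y \<in> ?V" using x y ops.subspace_add[OF blk_subspace] by blast
        next
          fix c x assume x: "x \<in> ?V"
          have "?f (munit p q \<circ> oscale c x) = \<Phi> p q \<circ> ?f (oscale c x)"
          proof -
            have "x \<in> blk R" using x by blast
            then have "munit p q \<circ> oscale c x = oscale c (munit p q \<circ> x)"
              by (intro oper_comp_scale bounded_munit blk_bdd)
            then have "?f (munit p q \<circ> oscale c x) = oscale c (?f (munit p q \<circ> x))" by (simp only: f_scale)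
            also have "\<dots> = oscale c (\<Phi> p q \<circ> ?f x)" using x by simp
            also have "\<dots> = \<Phi> p q \<circ> oscale c (?f x)"
              by (rule oper_comp_scale[symmetric]) (intro blk_bdd[OF in_blk[OF pq]] blk_bdd[OF f_in])+
            finally show ?thesis by (simp only: f_scale)
          qed
          then show "oscale c x \<in> ?V" using x ops.subspace_scale[OF blk_subspace] by blast
        qed
        ultimately show ?thesis unfolding blk_def[of R, symmetric] by (metis (no_types, lifting) blk_def ops.span_minimal)
      qed
      then show ?thesis using T by blast
    qed
    have "blk R \<subseteq> {S. ?f (S \<circ> T) = ?f S \<circ> ?f T}"
      unfolding blk_def
    proof (rule ops.span_minimal)
      show "(\<lambda>(p, q). munit p q) ` R \<subseteq> {S. ?f (S \<circ> T) = ?f S \<circ> ?f T}"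
        using 1[OF _ T] f_munit by force
      have "(0 :: 'a oper) \<circ> T = 0" "(0 :: 'b oper) \<circ> ?f T = 0" by (simp_all add: fun_eq_iff)
      then show "ops.subspace {S. ?f (S \<circ> T) = ?f S \<circ> ?f T}"
        unfolding ops.subspace_def
        by (intro conjI ballI allI)
          (simp_all only: mem_Collect_eq lin_on_zero[OF ops.subspace_UNIV f_lin] add_comp scale_comp f_add f_scale)
    qed
    then show ?thesis using S by blast
  qed
  have f_adj: "?f (adj T) = adj (?f T)" if T: "T \<in> blk R" for T
  proof (rule blk_eqI[OF f_in adj_blk(1)[OF R'(1,2) f_in]])
    fix P Q assume "(P, Q) \<in> R'"
    have "entry (?f (adj T)) P Q = (\<Sum>(p, q)\<in>R. cnj (entry T q p) * entry (\<Phi> p q) P Q)"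
      unfolding entry_sum by (intro sum.cong) (auto simp: entry_scale adj_blk(2)[OF R T])
    also have "\<dots> = (\<Sum>(p, q)\<in>R. cnj (entry T p q) * entry (\<Phi> q p) P Q)"
      by (rule sum.reindex_bij_witness[of _ prod.swap prod.swap]) (use R(2) in \<open>auto dest: symD\<close>)
    also have "\<dots> = (\<Sum>(p, q)\<in>R. cnj (entry T p q) * cnj (entry (\<Phi> p q) Q P))"
    proof (intro sum.cong refl, clarify)
      fix p q assume pq: "(p, q) \<in> R"
      show "cnj (entry T p q) * entry (\<Phi> q p) P Q = cnj (entry T p q) * cnj (entry (\<Phi> p q) Q P)"
        using adj_blk(2)[OF R'(1,2) in_blk[OF pq], of P Q] star[OF pq] by simp
    qed
    also have "\<dots> = cnj (entry (?f T) Q P)"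
      unfolding entry_sum cnj_sum by (intro sum.cong) (auto simp: entry_scale)
    finally show "entry (?f (adj T)) P Q = entry (adj (?f T)) P Q"
      unfolding adj_blk(2)[OF R'(1,2) f_in] .
  qed
  have f_unit: "?f (unit_of (blk R)) = unit_of (blk R')"
  proof -
    have "?f (blk_one R) = (\<Sum>(p, q)\<in>R. if p = q then \<Phi> p p else 0)"
    proof (intro sum.cong refl, clarify)
      fix p q assume pq: "(p, q) \<in> R"
      show "oscale (entry (blk_one R) p q) (\<Phi> p q) = (if p = q then \<Phi> p p else 0)"
        using pq by (cases "p = q")
          (simp_all only: blk_one_def entry_of_mat[OF R(1)] if_True if_False ops.scale_one ops.scale_zero_left simp_thms)
    qed
    then show ?thesis unfolding unit_of_blk[OF R tr] unit_of_blk[OF R'] unit .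
  qed
  show ?thesis
    unfolding star_hom_def using f_in f_add f_scale f_comp f_adj f_unit by blast
qed

section \<open>Roots of unity and sums over cyclic groups\<close>

lemma finite_Zk [simp]: "finite (Zk k)" by (simp add: Zk_def)

lemma sum_Zk_unique2:
  assumes "a \<in> Zk k" "b \<in> Zk k"
    and "\<And>m n. m \<in> Zk k \<Longrightarrow> n \<in> Zk k \<Longrightarrow> F m n = (if m = a \<and> n = b then c else 0)"
  shows "(\<Sum>m\<in>Zk k. \<Sum>n\<in>Zk k. F m n) = (c :: complex)"
proof -
  have "(\<Sum>m\<in>Zk k. \<Sum>n\<in>Zk k. F m n) = (\<Sum>m\<in>Zk k. if m = a then c else 0)"
  proof (rule sum.cong[OF refl])
    fix m assume m: "m \<in> Zk k"
    have "(\<Sum>n\<in>Zk k. F m n) = (\<Sum>n\<in>Zk k. if n = b then (if m = a then c else 0) else 0)"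
      using assms(3)[OF m] by (intro sum.cong) auto
    then show "(\<Sum>n\<in>Zk k. F m n) = (if m = a then c else 0)" using assms(2) by simp
  qed
  then show ?thesis using assms(1) by simp
qed

lemma sum_Zk_unique:
  assumes "a \<in> Zk k" and "\<And>m. m \<in> Zk k \<Longrightarrow> F m = (if m = a then c else 0)"
  shows "(\<Sum>m\<in>Zk k. F m) = (c :: complex)"
proof -
  have "(\<Sum>m\<in>Zk k. F m) = (\<Sum>m\<in>Zk k. if m = a then c else 0)"
    by (rule sum.cong[OF refl assms(2)])
  then show ?thesis using assms(1) by simp
qed

locale sekine_root =
  fixes k :: nat and \<eta> :: complex
  assumes prim: "primitive_root_of_unity k \<eta>"
begin

abbreviation "K \<equiv> int k"

lemma k_pos: "0 < k" and K_pos: "0 < K" and eta_k: "\<eta> ^ k = 1"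
  using prim by (auto simp: primitive_root_of_unity_def)

lemma Zk_iff: "i \<in> Zk k \<longleftrightarrow> 0 \<le> i \<and> i < K" by (simp add: Zk_def)

lemma Zk_mod: "i \<in> Zk k \<Longrightarrow> i mod K = i" by (simp add: Zk_iff)

lemma mod_Zk [simp]: "i mod K \<in> Zk k" using K_pos by (simp add: Zk_iff)

lemma eta_nz: "\<eta> \<noteq> 0"
  using eta_k k_pos by (metis power_0_left not_gr_zero zero_neq_one)

lemma powi_add: "\<eta> powi (m + n) = \<eta> powi m * \<eta> powi n"
  using eta_nz by (simp add: power_int_add)

lemma powi_mult_K: "\<eta> powi (K * n) = 1"
proof -
  have "\<eta> powi (K * n) = (\<eta> powi K) powi n" by (rule power_int_mult)
  then show ?thesis using eta_k by simp
qed

lemma powi_mod: "\<eta> powi (n mod K) = \<eta> powi n"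
proof -
  have "\<eta> powi n = \<eta> powi (K * (n div K) + n mod K)" by simp
  then show ?thesis by (simp only: powi_add powi_mult_K mult_1)
qed

lemma mod_K_ex: "\<exists>q. x mod K = x + K * q"
  by (rule exI[of _ "- (x div K)"]) (simp add: minus_mult_div_eq_mod[symmetric])

lemma powi_shift: "m = n + K * q \<Longrightarrow> \<eta> powi m = \<eta> powi n"
  by (simp add: powi_add powi_mult_K)

lemma powi_cong: "m mod K = n mod K \<Longrightarrow> \<eta> powi m = \<eta> powi n"
  using powi_mod by metis

lemma powi_eq_1_iff: "\<eta> powi n = 1 \<longleftrightarrow> n mod K = 0"
proof
  assume "\<eta> powi n = 1"
  then have "\<eta> powi (n mod K) = 1" by (simp add: powi_mod)
  then have "\<eta> ^ nat (n mod K) = 1" using K_pos by (simp add: power_int_def)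
  moreover have "nat (n mod K) < k" using K_pos by (simp add: nat_less_iff)
  ultimately have "nat (n mod K) = 0" using prim unfolding primitive_root_of_unity_def by (metis gr0I)
  then show "n mod K = 0" using K_pos pos_mod_sign[of K n] by linarith
qed (metis powi_mod power_int_0_right)

lemma cnj_powi: "cnj (\<eta> powi n) = \<eta> powi (- n)"
proof -
  have "norm \<eta> = 1" using power_eq_1_iff[of \<eta> k] eta_k k_pos by auto
  then have "\<eta> * cnj \<eta> = 1" by (simp add: complex_norm_square[symmetric])
  then have "cnj \<eta> = inverse \<eta>" using eta_nz by (simp add: field_simps)
  then show ?thesis
    by (simp add: power_int_def power_inverse)
qed

text \<open>Orthogonality of the characters of the cyclic group.\<close>

lemma root_sum: "(\<Sum>i\<in>Zk k. \<eta> powi (i * n)) = (if n mod K = 0 then of_nat k else 0)"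
proof (cases "n mod K = 0")
  case True
  then have "\<eta> powi (i * n) = 1" for i by (simp add: powi_eq_1_iff) (metis mod_mult_right_eq mult_zero_right mod_0)
  then show ?thesis using True by (simp add: Zk_def)
next
  case False
  define r where "r = \<eta> powi n"
  have r1: "r \<noteq> 1" using False by (simp add: r_def powi_eq_1_iff)
  have rk: "r ^ k = 1"
    using powi_mult_K[of n] by (simp add: r_def power_int_mult[symmetric] mult.commute flip: power_int_of_nat)
  have ri: "r ^ i = \<eta> powi (int i * n)" for i
    unfolding r_def mult.commute[of "int i"] power_int_mult by simp
  have "(\<Sum>i\<in>Zk k. \<eta> powi (i * n)) = (\<Sum>i<k. r ^ i)"
    unfolding ri by (rule sum.reindex_bij_witness[of _ int nat]) (auto simp: Zk_def)
  also have "\<dots> = 0" using r1 rk by (simp add: geometric_sum)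
  finally show ?thesis using False by simp
qed

lemma sum_shift:
  assumes "\<And>w. F (w mod K) = F w" shows "(\<Sum>w\<in>Zk k. F (w + c)) = (\<Sum>w\<in>Zk k. (F w :: complex))"
proof -
  have "(\<Sum>w\<in>Zk k. F (w + c)) = (\<Sum>w\<in>Zk k. F ((w + c) mod K))" by (simp add: assms)
  also have "\<dots> = (\<Sum>w\<in>Zk k. F w)"
  proof (rule sum.reindex_bij_witness[of _ "\<lambda>w. (w - c) mod K" "\<lambda>w. (w + c) mod K"])
    fix w assume "w \<in> Zk k"
    then show "((w + c) mod K - c) mod K = w" "((w - c) mod K + c) mod K = w"
      by (simp_all add: mod_simps Zk_mod)
  qed auto
  finally show ?thesis .
qed

section \<open>Sekine algebras as block algebras\<close>

definition R :: "sek rel" where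
  "R = (\<lambda>(i, j). (Inl (i, j), Inl (i, j))) ` (Zk k \<times> Zk k) \<union> (\<lambda>(i, j). (Inr i, Inr j)) ` (Zk k \<times> Zk k)"

abbreviation "RR \<equiv> R \<otimes>\<^sub>R R"

lemma R_simps [simp]:
  "(Inl (a, b), Inl (c, d)) \<in> R \<longleftrightarrow> a \<in> Zk k \<and> b \<in> Zk k \<and> c = a \<and> d = b"
  "(Inr x, Inr y) \<in> R \<longleftrightarrow> x \<in> Zk k \<and> y \<in> Zk k"
  "(Inl p, Inr y) \<notin> R" "(Inr y, Inl p) \<notin> R"
  by (auto simp: R_def)

lemma R_cases [consumes 1, case_names d e]:
  assumes "(p, q) \<in> R"
  obtains a b where "p = Inl (a, b)" "q = Inl (a, b)" "a \<in> Zk k" "b \<in> Zk k"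
    | x y where "p = Inr x" "q = Inr y" "x \<in> Zk k" "y \<in> Zk k"
  using assms by (auto simp: R_def)

lemma R_per: "finite R" "sym R" "trans R"
  by (auto simp: R_def sym_def trans_def)

lemmas RR_per = relprod_props(1)[OF R_per(1) R_per(1)] relprod_props(2)[OF R_per(2) R_per(2)]
  relprod_props(3)[OF R_per(3) R_per(3)]

lemma sek_alg_blk: "sek_alg k = blk R"
proof -
  have set: "{f i j |i j. i \<in> Zk k \<and> j \<in> Zk k} = (\<lambda>p. f (fst p) (snd p)) ` (Zk k \<times> Zk k)"
    for f :: "int \<Rightarrow> int \<Rightarrow> sek oper"
    by force
  have "{sek_d k i j |i j. i \<in> Zk k \<and> j \<in> Zk k}
      = (\<lambda>(p, q). munit p q) ` (\<lambda>(i, j). (Inl (i, j), Inl (i, j))) ` (Zk k \<times> Zk k)"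
    unfolding set image_image by (rule image_cong[OF refl]) (auto simp: sek_d_def Zk_mod)
  moreover have "{sek_e k i j |i j. i \<in> Zk k \<and> j \<in> Zk k}
      = (\<lambda>(p, q). munit p q) ` (\<lambda>(i, j). (Inr i, Inr j)) ` (Zk k \<times> Zk k)"
    unfolding set image_image by (rule image_cong[OF refl]) (auto simp: sek_e_def Zk_mod)
  ultimately show ?thesis unfolding sek_alg_def blk_def R_def image_Un by simp
qed

lemma entry_sek_d: "entry (sek_d k i j) p q = (if p = Inl (i mod K, j mod K) \<and> q = p then 1 else 0)"
  and entry_sek_e: "entry (sek_e k i j) p q = (if p = Inr (i mod K) \<and> q = Inr (j mod K) then 1 else 0)"
  by (auto simp: sek_d_def sek_e_def entry_munit)

lemma sek_in_blk: "sek_d k i j \<in> blk R" "sek_e k i j \<in> blk R"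
  unfolding sek_d_def sek_e_def by (auto intro!: munit_in_blk)

lemmas sek_bdd = sek_in_blk[THEN blk_bdd]

lemma tensor_in_blk: "a \<in> blk R \<Longrightarrow> b \<in> blk R \<Longrightarrow> a \<otimes>\<^sub>o b \<in> blk RR"
  using otensor_in_ctensor[OF findim_blk findim_blk] ctensor_blk R_per(1) by metis

section \<open>The entries of the comultiplication\<close>

lemma comult_d_in: "sek_comult_d k \<eta> i j \<in> blk RR" and comult_e_in: "sek_comult_e k \<eta> i j \<in> blk RR"
  unfolding sek_comult_d_def sek_comult_e_def
  by (intro ops.subspace_add ops.subspace_scale ops.subspace_sum blk_subspace tensor_in_blk sek_in_blk)+

lemma comult_in: "sek_comult k \<eta> T \<in> blk RR"
  unfolding sek_comult_def
  by (intro ops.subspace_add ops.subspace_scale ops.subspace_sum blk_subspace comult_d_in comult_e_in)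

text \<open>The components of \<open>T\<close> in the commutative summand and in the matrix summand, as periodic functions of
  arbitrary integers. With them \<open>\<Delta> T\<close> has the following four blocks: on the commutative summand it is
  the comultiplication of functions on \<open>\<int>\<^sub>k \<times> \<int>\<^sub>k\<close>, on the two mixed ones it conjugates the matrix with a
  unitary that depends on the point, and on the last one it is a function of the \<open>k\<^sup>2\<close> rank one projections
  onto the vectors \<open>\<Sum>\<^sub>m \<eta>\<^sup>i\<^sup>m e\<^sub>m \<otimes> e\<^sub>m\<^sub>+\<^sub>j\<close>, which form an orthogonal basis.\<close>

definition dpart :: "sek oper \<Rightarrow> int \<Rightarrow> int \<Rightarrow> complex" where
  "dpart T i j = entry T (Inl (i mod K, j mod K)) (Inl (i mod K, j mod K))"

definition epart :: "sek oper \<Rightarrow> int \<Rightarrow> int \<Rightarrow> complex" where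
  "epart T i j = entry T (Inr (i mod K)) (Inr (j mod K))"

lemma part_cong:
  "i mod K = i' mod K \<Longrightarrow> j mod K = j' mod K \<Longrightarrow> dpart T i j = dpart T i' j'"
  "i mod K = i' mod K \<Longrightarrow> j mod K = j' mod K \<Longrightarrow> epart T i j = epart T i' j'"
  by (simp_all add: dpart_def epart_def)

lemmas entry_simps = entry_add entry_scale entry_sum entry_otensor sek_bdd entry_sek_d entry_sek_e

lemma entry_comult:
  "entry (sek_comult k \<eta> T) P Q =
     (\<Sum>i\<in>Zk k. \<Sum>j\<in>Zk k. dpart T i j * entry (sek_comult_d k \<eta> i j) P Q) +
     (\<Sum>i\<in>Zk k. \<Sum>j\<in>Zk k. epart T i j * entry (sek_comult_e k \<eta> i j) P Q)"
  unfolding sek_comult_def entry_add entry_sum entry_scale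
  by (intro arg_cong2[where f = "(+)"] sum.cong refl) (simp_all add: dpart_def epart_def Zk_mod)

lemma mod_shift: "a \<in> Zk k \<Longrightarrow> i \<in> Zk k \<Longrightarrow> a = (i - c) mod K \<longleftrightarrow> i = (a + c) mod K"
  "a \<in> Zk k \<Longrightarrow> i \<in> Zk k \<Longrightarrow> a = (i + c) mod K \<longleftrightarrow> i = (a - c) mod K"
  by (auto simp: mod_simps Zk_mod)

lemma mod_neg: "a \<in> Zk k \<Longrightarrow> i \<in> Zk k \<Longrightarrow> a = (- i) mod K \<longleftrightarrow> i = (- a) mod K"
  by (auto simp: mod_simps Zk_mod)

lemma comult_dd:
  assumes "a \<in> Zk k" "b \<in> Zk k" "c \<in> Zk k" "d \<in> Zk k"
  shows "entry (sek_comult k \<eta> T) (Inl (a, b), Inl (c, d)) (Inl (a, b), Inl (c, d)) = dpart T (a + c) (b + d)"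
proof -
  let ?P = "(Inl (a, b), Inl (c, d)) :: sek \<times> sek"
  have e: "entry (sek_comult_e k \<eta> i j) ?P ?P = 0" for i j
    by (simp add: sek_comult_e_def entry_simps)
  have d: "entry (sek_comult_d k \<eta> i j) ?P ?P = (if i = (a + c) mod K \<and> j = (b + d) mod K then 1 else 0)"
    if ij: "i \<in> Zk k" "j \<in> Zk k" for i j
  proof -
    have "entry (sek_comult_d k \<eta> i j) ?P ?P
      = (\<Sum>m\<in>Zk k. \<Sum>n\<in>Zk k. entry (sek_d k m n \<otimes>\<^sub>o sek_d k (i - m) (j - n)) ?P ?P)"
      by (simp add: sek_comult_d_def entry_simps)
    also have "\<dots> = (if c = (i - a) mod K \<and> d = (j - b) mod K then 1 else 0)"
      by (rule sum_Zk_unique2[OF assms(1,2)]) (auto simp: entry_simps Zk_mod)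
    finally show ?thesis using mod_shift(1)[OF assms(3) ij(1), of a] mod_shift(1)[OF assms(4) ij(2), of b]
      by (simp add: add.commute)
  qed
  have "entry (sek_comult k \<eta> T) ?P ?P = (\<Sum>i\<in>Zk k. \<Sum>j\<in>Zk k. dpart T i j * entry (sek_comult_d k \<eta> i j) ?P ?P)"
    unfolding entry_comult e by simp
  also have "\<dots> = dpart T ((a + c) mod K) ((b + d) mod K)"
    by (rule sum_Zk_unique2[of "(a + c) mod K" k "(b + d) mod K"]) (auto simp: d)
  also have "\<dots> = dpart T (a + c) (b + d)" by (rule part_cong) simp_all
  finally show ?thesis .
qed

lemma comult_de:
  assumes "a \<in> Zk k" "b \<in> Zk k" "x \<in> Zk k" "y \<in> Zk k"
  shows "entry (sek_comult k \<eta> T) (Inl (a, b), Inr x) (Inl (a, b), Inr y)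
    = \<eta> powi (- a * (x - y)) * epart T (x - b) (y - b)"
proof -
  let ?P = "(Inl (a, b), Inr x) :: sek \<times> sek" and ?Q = "(Inl (a, b), Inr y) :: sek \<times> sek"
  have d: "entry (sek_comult_d k \<eta> i j) ?P ?Q = 0" for i j
    by (simp add: sek_comult_d_def entry_simps)
  have e: "entry (sek_comult_e k \<eta> i j) ?P ?Q
      = (if i = (x - b) mod K \<and> j = (y - b) mod K then \<eta> powi (- a * (x - y)) else 0)"
    if ij: "i \<in> Zk k" "j \<in> Zk k" for i j
  proof -
    have "entry (sek_comult_e k \<eta> i j) ?P ?Q
      = (\<Sum>m\<in>Zk k. \<Sum>n\<in>Zk k. \<eta> powi (m * (i - j)) *
          entry (sek_d k (- m) (- n) \<otimes>\<^sub>o sek_e k (i - n) (j - n)) ?P ?Q)"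
      by (simp add: sek_comult_e_def entry_simps)
    also have "\<dots> = (if x = (i - (- b) mod K) mod K \<and> y = (j - (- b) mod K) mod K
        then \<eta> powi (((- a) mod K) * (i - j)) else 0)"
    proof (rule sum_Zk_unique2[of "(- a) mod K" k "(- b) mod K"])
      fix m n assume mn: "m \<in> Zk k" "n \<in> Zk k"
      show "\<eta> powi (m * (i - j)) * entry (sek_d k (- m) (- n) \<otimes>\<^sub>o sek_e k (i - n) (j - n)) ?P ?Q
        = (if m = (- a) mod K \<and> n = (- b) mod K
           then if x = (i - (- b) mod K) mod K \<and> y = (j - (- b) mod K) mod K
             then \<eta> powi (((- a) mod K) * (i - j)) else 0 else 0)"
        using mod_neg[OF assms(1) mn(1)] mod_neg[OF assms(2) mn(2)] by (auto simp: entry_simps)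
    qed auto
    also have "\<dots> = (if i = (x - b) mod K \<and> j = (y - b) mod K then \<eta> powi (((- a) mod K) * (i - j)) else 0)"
      using mod_shift(2)[OF assms(3) ij(1), of b] mod_shift(2)[OF assms(4) ij(2), of b] by (simp add: mod_simps)
    also have "\<dots> = (if i = (x - b) mod K \<and> j = (y - b) mod K then \<eta> powi (- a * (x - y)) else 0)"
    proof (rule if_cong[OF refl _ refl])
      assume ij: "i = (x - b) mod K \<and> j = (y - b) mod K"
      obtain p q r where pqr: "(- a) mod K = - a + K * p" "(x - b) mod K = (x - b) + K * q"
          "(y - b) mod K = (y - b) + K * r"
        using mod_K_ex by meson
      have "((- a) mod K) * (i - j) = - a * (x - y) + K * (- a * (q - r) + p * (i - j))"
        unfolding pqr ij[THEN conjunct1] ij[THEN conjunct2] by (simp add: algebra_simps)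
      then show "\<eta> powi (((- a) mod K) * (i - j)) = \<eta> powi (- a * (x - y))" by (rule powi_shift)
    qed
    finally show ?thesis .
  qed
  have "entry (sek_comult k \<eta> T) ?P ?Q = (\<Sum>i\<in>Zk k. \<Sum>j\<in>Zk k. epart T i j * entry (sek_comult_e k \<eta> i j) ?P ?Q)"
    unfolding entry_comult d by simp
  also have "\<dots> = \<eta> powi (- a * (x - y)) * epart T ((x - b) mod K) ((y - b) mod K)"
    by (rule sum_Zk_unique2[of "(x - b) mod K" k "(y - b) mod K"]) (auto simp: e)
  also have "\<dots> = \<eta> powi (- a * (x - y)) * epart T (x - b) (y - b)"
    by (intro arg_cong2[where f = "(*)"] refl part_cong) simp_all
  finally show ?thesis .
qed

lemma comult_ed:
  assumes "a \<in> Zk k" "b \<in> Zk k" "x \<in> Zk k" "y \<in> Zk k"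
  shows "entry (sek_comult k \<eta> T) (Inr x, Inl (a, b)) (Inr y, Inl (a, b))
    = \<eta> powi (- a * (x - y)) * epart T (x + b) (y + b)"
proof -
  let ?P = "(Inr x, Inl (a, b)) :: sek \<times> sek" and ?Q = "(Inr y, Inl (a, b)) :: sek \<times> sek"
  have d: "entry (sek_comult_d k \<eta> i j) ?P ?Q = 0" for i j
    by (simp add: sek_comult_d_def entry_simps)
  have e: "entry (sek_comult_e k \<eta> i j) ?P ?Q
      = (if i = (x + b) mod K \<and> j = (y + b) mod K then \<eta> powi (- a * (x - y)) else 0)"
    if ij: "i \<in> Zk k" "j \<in> Zk k" for i j
  proof -
    have "entry (sek_comult_e k \<eta> i j) ?P ?Q
      = (\<Sum>m\<in>Zk k. \<Sum>n\<in>Zk k. \<eta> powi (m * (j - i)) *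
          entry (sek_e k (i - n) (j - n) \<otimes>\<^sub>o sek_d k m n) ?P ?Q)"
      by (simp add: sek_comult_e_def entry_simps)
    also have "\<dots> = (if x = (i - b) mod K \<and> y = (j - b) mod K then \<eta> powi (a * (j - i)) else 0)"
      by (rule sum_Zk_unique2[OF assms(1,2)]) (auto simp: entry_simps Zk_mod)
    also have "\<dots> = (if i = (x + b) mod K \<and> j = (y + b) mod K then \<eta> powi (a * (j - i)) else 0)"
      using mod_shift(1)[OF assms(3) ij(1), of b] mod_shift(1)[OF assms(4) ij(2), of b] by simp
    also have "\<dots> = (if i = (x + b) mod K \<and> j = (y + b) mod K then \<eta> powi (- a * (x - y)) else 0)"
    proof (rule if_cong[OF refl _ refl])
      assume ij: "i = (x + b) mod K \<and> j = (y + b) mod K"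
      obtain q r where qr: "(x + b) mod K = (x + b) + K * q" "(y + b) mod K = (y + b) + K * r"
        using mod_K_ex by meson
      have "a * (j - i) = - a * (x - y) + K * (a * (r - q))"
        unfolding qr ij[THEN conjunct1] ij[THEN conjunct2] by (simp add: algebra_simps)
      then show "\<eta> powi (a * (j - i)) = \<eta> powi (- a * (x - y))" by (rule powi_shift)
    qed
    finally show ?thesis .
  qed
  have "entry (sek_comult k \<eta> T) ?P ?Q = (\<Sum>i\<in>Zk k. \<Sum>j\<in>Zk k. epart T i j * entry (sek_comult_e k \<eta> i j) ?P ?Q)"
    unfolding entry_comult d by simp
  also have "\<dots> = \<eta> powi (- a * (x - y)) * epart T ((x + b) mod K) ((y + b) mod K)"
    by (rule sum_Zk_unique2[of "(x + b) mod K" k "(y + b) mod K"]) (auto simp: e)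
  also have "\<dots> = \<eta> powi (- a * (x - y)) * epart T (x + b) (y + b)"
    by (intro arg_cong2[where f = "(*)"] refl part_cong) simp_all
  finally show ?thesis .
qed

lemma comult_ee:
  assumes "m \<in> Zk k" "m' \<in> Zk k" "n \<in> Zk k" "n' \<in> Zk k"
  shows "entry (sek_comult k \<eta> T) (Inr m, Inr m') (Inr n, Inr n')
    = (if (m' - m) mod K = (n' - n) mod K
       then 1 / of_nat k * (\<Sum>i\<in>Zk k. \<eta> powi (i * (m - n)) * dpart T i (m' - m)) else 0)"
proof -
  let ?P = "(Inr m, Inr m') :: sek \<times> sek" and ?Q = "(Inr n, Inr n') :: sek \<times> sek"
  let ?C = "(m' - m) mod K = (n' - n) mod K"
  have e: "entry (sek_comult_e k \<eta> i j) ?P ?Q = 0" for i j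
    by (simp add: sek_comult_e_def entry_simps)
  have d: "entry (sek_comult_d k \<eta> i j) ?P ?Q
      = (if j = (m' - m) mod K \<and> ?C then 1 / of_nat k * \<eta> powi (i * (m - n)) else 0)"
    if ij: "i \<in> Zk k" "j \<in> Zk k" for i j
  proof -
    have "entry (sek_comult_d k \<eta> i j) ?P ?Q
      = 1 / of_nat k * (\<Sum>r\<in>Zk k. \<Sum>s\<in>Zk k. \<eta> powi (i * (r - s)) *
          entry (sek_e k r s \<otimes>\<^sub>o sek_e k (r + j) (s + j)) ?P ?Q)"
      by (simp add: sek_comult_d_def entry_simps)
    also have "(\<Sum>r\<in>Zk k. \<Sum>s\<in>Zk k. \<eta> powi (i * (r - s)) *
          entry (sek_e k r s \<otimes>\<^sub>o sek_e k (r + j) (s + j)) ?P ?Q)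
        = (if m' = (m + j) mod K \<and> n' = (n + j) mod K then \<eta> powi (i * (m - n)) else 0)"
      by (rule sum_Zk_unique2[OF assms(1,3)]) (auto simp: entry_simps Zk_mod)
    finally show ?thesis
      using mod_shift(2)[OF assms(2) ij(2), of m] mod_shift(2)[OF assms(4) ij(2), of n]
      by (auto simp: add.commute)
  qed
  have "entry (sek_comult k \<eta> T) ?P ?Q = (\<Sum>i\<in>Zk k. \<Sum>j\<in>Zk k. dpart T i j * entry (sek_comult_d k \<eta> i j) ?P ?Q)"
    unfolding entry_comult e by simp
  also have "\<dots> = (\<Sum>i\<in>Zk k. if ?C then 1 / of_nat k * (\<eta> powi (i * (m - n)) * dpart T i (m' - m)) else 0)"
  proof (rule sum.cong[OF refl])
    fix i assume i: "i \<in> Zk k"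
    show "(\<Sum>j\<in>Zk k. dpart T i j * entry (sek_comult_d k \<eta> i j) ?P ?Q)
        = (if ?C then 1 / of_nat k * (\<eta> powi (i * (m - n)) * dpart T i (m' - m)) else 0)"
    proof (rule sum_Zk_unique[of "(m' - m) mod K"])
      fix j assume j: "j \<in> Zk k"
      have "dpart T i ((m' - m) mod K) = dpart T i (m' - m)" by (rule part_cong) simp_all
      then show "dpart T i j * entry (sek_comult_d k \<eta> i j) ?P ?Q
        = (if j = (m' - m) mod K then if ?C then 1 / of_nat k * (\<eta> powi (i * (m - n)) * dpart T i (m' - m)) else 0 else 0)"
        by (auto simp: d[OF i j])
    qed simp
  qed
  also have "\<dots> = (if ?C then 1 / of_nat k * (\<Sum>i\<in>Zk k. \<eta> powi (i * (m - n)) * dpart T i (m' - m)) else 0)"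
    by (simp add: sum_distrib_left)
  finally show ?thesis .
qed

end

context sekine_root
begin

abbreviation "\<Delta> \<equiv> sek_comult k \<eta>"

lemma RR_cases [consumes 1, case_names dd de ed ee]:
  assumes "(P, Q) \<in> RR"
  obtains a b c d where "P = (Inl (a, b), Inl (c, d))" "Q = P" "a \<in> Zk k" "b \<in> Zk k" "c \<in> Zk k" "d \<in> Zk k"
    | a b x y where "P = (Inl (a, b), Inr x)" "Q = (Inl (a, b), Inr y)"
        "a \<in> Zk k" "b \<in> Zk k" "x \<in> Zk k" "y \<in> Zk k"
    | a b x y where "P = (Inr x, Inl (a, b))" "Q = (Inr y, Inl (a, b))"
        "a \<in> Zk k" "b \<in> Zk k" "x \<in> Zk k" "y \<in> Zk k"
    | m m' n n' where "P = (Inr m, Inr m')" "Q = (Inr n, Inr n')"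
        "m \<in> Zk k" "m' \<in> Zk k" "n \<in> Zk k" "n' \<in> Zk k"
proof -
  obtain p r q s where PQ: "P = (p, r)" "Q = (q, s)" by (metis surj_pair)
  have "(p, q) \<in> R" "(r, s) \<in> R" using assms PQ by simp_all
  then show ?thesis
    by (elim R_cases) (use that PQ in auto)
qed

lemma R_image: "a \<in> Zk k \<Longrightarrow> b \<in> Zk k \<Longrightarrow> R `` {Inl (a, b)} = {Inl (a, b)}"
  "x \<in> Zk k \<Longrightarrow> R `` {Inr x} = Inr ` Zk k"
  by (auto simp: R_def)

lemma RR_image: "RR `` {(p, r)} = (R `` {p}) \<times> (R `` {r})"
  by (auto simp: Image_def)

lemma inj_Inr: "inj_on Inr X" by (simp add: inj_on_def)

lemma entry_RR_comp:
  assumes "X \<in> blk RR" "Y \<in> blk RR"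
  shows "entry (X \<circ> Y) (p, r) Q = (\<Sum>s\<in>R `` {p}. \<Sum>t\<in>R `` {r}. entry X (p, r) (s, t) * entry Y (s, t) Q)"
  unfolding entry_comp[OF RR_per(1) assms(1) blk_bdd[OF assms(2)]] RR_image
  by (simp add: sum.cartesian_product case_prod_beta)

section \<open>Multiplicativity of the comultiplication\<close>

lemma comult_linear: "\<Delta> (S + T) = \<Delta> S + \<Delta> T" "\<Delta> (oscale c T) = oscale c (\<Delta> T)"
proof -
  show "\<Delta> (S + T) = \<Delta> S + \<Delta> T"
    by (rule blk_eqI[OF comult_in ops.subspace_add[OF blk_subspace comult_in comult_in]])
      (simp add: entry_add entry_comult dpart_def epart_def distrib_right sum.distrib)
  show "\<Delta> (oscale c T) = oscale c (\<Delta> T)"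
    by (rule blk_eqI[OF comult_in ops.subspace_scale[OF blk_subspace comult_in]])
      (simp add: entry_scale entry_comult dpart_def epart_def mult.assoc distrib_left flip: sum_distrib_left)
qed

lemma parts_comp:
  assumes S: "S \<in> blk R" and T: "T \<in> blk R"
  shows "dpart (S \<circ> T) i j = dpart S i j * dpart T i j"
    "epart (S \<circ> T) i j = (\<Sum>r\<in>Zk k. epart S i r * epart T r j)"
  unfolding dpart_def epart_def entry_comp[OF R_per(1) S blk_bdd[OF T]]
  by (simp_all add: R_image sum.reindex[OF inj_Inr] Zk_mod)

lemma parts_adj:
  assumes T: "T \<in> blk R"
  shows "dpart (adj T) i j = cnj (dpart T i j)" "epart (adj T) i j = cnj (epart T j i)"
  unfolding dpart_def epart_def adj_blk(2)[OF R_per(1,2) T] by simp_all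

lemma parts_one: "dpart (blk_one R) i j = 1" "epart (blk_one R) i j = (if i mod K = j mod K then 1 else 0)"
  unfolding dpart_def epart_def blk_one_def entry_of_mat[OF R_per(1)] by simp_all

lemma mod_diff_eq_iff:
  assumes "x \<in> Zk k" "y \<in> Zk k" shows "(x + c) mod K = (y + c) mod K \<longleftrightarrow> x = y"
    "(x - c) mod K = (y - c) mod K \<longleftrightarrow> x = y"
proof -
  have *: "x = y" if "(x + d) mod K = (y + d) mod K" for d
  proof -
    have "((x + d) mod K - d) mod K = ((y + d) mod K - d) mod K" using that by simp
    then show ?thesis using assms by (simp add: mod_simps Zk_mod)
  qed
  show "(x + c) mod K = (y + c) mod K \<longleftrightarrow> x = y" using * by blast
  show "(x - c) mod K = (y - c) mod K \<longleftrightarrow> x = y" using *[of "- c"] by auto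
qed

text \<open>Block by block: the mixed blocks are conjugations by unitaries. In the last block the two Fourier sums
  are multiplied, and summing over the intermediate index leaves only equal frequencies.\<close>

lemma comult_comp:
  assumes S: "S \<in> blk R" and T: "T \<in> blk R"
  shows "\<Delta> (S \<circ> T) = \<Delta> S \<circ> \<Delta> T"
proof (rule blk_eqI[OF comult_in blk_comp[OF RR_per(1,3) comult_in comult_in]])
  fix P Q assume "(P, Q) \<in> RR"
  then show "entry (\<Delta> (S \<circ> T)) P Q = entry (\<Delta> S \<circ> \<Delta> T) P Q"
  proof (cases rule: RR_cases)
    case (dd a b c d)
    then show ?thesis
      by (simp add: entry_RR_comp[OF comult_in comult_in] R_image comult_dd parts_comp[OF S T])
  next
    case (de a b x y)
    have "entry (\<Delta> S \<circ> \<Delta> T) P Q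
        = (\<Sum>w\<in>Zk k. \<eta> powi (- a * (x - w)) * epart S (x - b) (w - b) *
            (\<eta> powi (- a * (w - y)) * epart T (w - b) (y - b)))"
      using de by (simp add: entry_RR_comp[OF comult_in comult_in] R_image comult_de sum.reindex[OF inj_Inr])
    also have "\<dots> = (\<Sum>w\<in>Zk k. \<eta> powi (- a * (x - y)) * (epart S (x - b) (w + - b) * epart T (w + - b) (y - b)))"
    proof (rule sum.cong[OF refl])
      fix w
      have e: "\<eta> powi (- a * (x - y)) = \<eta> powi (- a * (x - w)) * \<eta> powi (- a * (w - y))"
        unfolding powi_add[symmetric] by (simp add: algebra_simps)
      show "\<eta> powi (- a * (x - w)) * epart S (x - b) (w - b) * (\<eta> powi (- a * (w - y)) * epart T (w - b) (y - b))
        = \<eta> powi (- a * (x - y)) * (epart S (x - b) (w + - b) * epart T (w + - b) (y - b))"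
        unfolding e by (simp add: mult_ac)
    qed
    also have "\<dots> = \<eta> powi (- a * (x - y)) * (\<Sum>w\<in>Zk k. epart S (x - b) w * epart T w (y - b))"
      unfolding sum_distrib_left[symmetric]
      by (intro arg_cong2[where f = "(*)"] refl sum_shift) (simp_all add: epart_def)
    finally show ?thesis using de by (simp add: comult_de parts_comp[OF S T])
  next
    case (ed a b x y)
    have "entry (\<Delta> S \<circ> \<Delta> T) P Q
        = (\<Sum>w\<in>Zk k. \<eta> powi (- a * (x - w)) * epart S (x + b) (w + b) *
            (\<eta> powi (- a * (w - y)) * epart T (w + b) (y + b)))"
      using ed by (simp add: entry_RR_comp[OF comult_in comult_in] R_image comult_ed sum.reindex[OF inj_Inr])
    also have "\<dots> = (\<Sum>w\<in>Zk k. \<eta> powi (- a * (x - y)) * (epart S (x + b) (w + b) * epart T (w + b) (y + b)))"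
    proof (rule sum.cong[OF refl])
      fix w
      have e: "\<eta> powi (- a * (x - y)) = \<eta> powi (- a * (x - w)) * \<eta> powi (- a * (w - y))"
        unfolding powi_add[symmetric] by (simp add: algebra_simps)
      show "\<eta> powi (- a * (x - w)) * epart S (x + b) (w + b) * (\<eta> powi (- a * (w - y)) * epart T (w + b) (y + b))
        = \<eta> powi (- a * (x - y)) * (epart S (x + b) (w + b) * epart T (w + b) (y + b))"
        unfolding e by (simp add: mult_ac)
    qed
    also have "\<dots> = \<eta> powi (- a * (x - y)) * (\<Sum>w\<in>Zk k. epart S (x + b) w * epart T w (y + b))"
      unfolding sum_distrib_left[symmetric]
      by (intro arg_cong2[where f = "(*)"] refl sum_shift) (simp_all add: epart_def)
    finally show ?thesis using ed by (simp add: comult_ed parts_comp[OF S T])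
  next
    case (ee m m' n n')
    let ?C = "(m' - m) mod K = (n' - n) mod K"
    let ?S = "\<lambda>i. dpart S i (m' - m)" and ?T = "\<lambda>i. dpart T i (m' - m)"
    have "entry (\<Delta> S \<circ> \<Delta> T) P Q
        = (\<Sum>r\<in>Zk k. \<Sum>r'\<in>Zk k. entry (\<Delta> S) (Inr m, Inr m') (Inr r, Inr r') *
            entry (\<Delta> T) (Inr r, Inr r') (Inr n, Inr n'))"
      using ee by (simp add: entry_RR_comp[OF comult_in comult_in] R_image sum.reindex[OF inj_Inr])
    also have "\<dots> = (\<Sum>r\<in>Zk k. if ?C then (1 / of_nat k * (\<Sum>i\<in>Zk k. \<eta> powi (i * (m - r)) * ?S i)) *
            (1 / of_nat k * (\<Sum>i\<in>Zk k. \<eta> powi (i * (r - n)) * ?T i)) else 0)"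
    proof (rule sum.cong[OF refl])
      fix r assume r: "r \<in> Zk k"
      show "(\<Sum>r'\<in>Zk k. entry (\<Delta> S) (Inr m, Inr m') (Inr r, Inr r') * entry (\<Delta> T) (Inr r, Inr r') (Inr n, Inr n'))
        = (if ?C then (1 / of_nat k * (\<Sum>i\<in>Zk k. \<eta> powi (i * (m - r)) * ?S i)) *
            (1 / of_nat k * (\<Sum>i\<in>Zk k. \<eta> powi (i * (r - n)) * ?T i)) else 0)"
      proof (rule sum_Zk_unique[of "(r + (m' - m)) mod K"])
        fix r' assume r': "r' \<in> Zk k"
        have eq: "(m' - m) mod K = (r' - r) mod K \<longleftrightarrow> r' = (r + (m' - m)) mod K"
        proof
          assume "(m' - m) mod K = (r' - r) mod K"
          then have "(r + (m' - m) mod K) mod K = (r + (r' - r) mod K) mod K" by simp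
          then show "r' = (r + (m' - m)) mod K" using r' by (simp add: mod_simps Zk_mod)
        qed (simp add: mod_simps)
        show "entry (\<Delta> S) (Inr m, Inr m') (Inr r, Inr r') * entry (\<Delta> T) (Inr r, Inr r') (Inr n, Inr n')
          = (if r' = (r + (m' - m)) mod K then
              if ?C then (1 / of_nat k * (\<Sum>i\<in>Zk k. \<eta> powi (i * (m - r)) * ?S i)) *
                (1 / of_nat k * (\<Sum>i\<in>Zk k. \<eta> powi (i * (r - n)) * ?T i)) else 0 else 0)"
        proof (cases "(m' - m) mod K = (r' - r) mod K")
          case True
          then have "dpart T i (r' - r) = ?T i" for i by (intro part_cong) simp_all
          then show ?thesis using True eq ee r r' by (simp add: comult_ee)
        next
          case False
          then show ?thesis using eq ee r r' by (simp add: comult_ee)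
        qed
      qed simp
    qed
    also have "\<dots> = (if ?C then 1 / of_nat k * (\<Sum>i\<in>Zk k. \<eta> powi (i * (m - n)) * (?S i * ?T i)) else 0)"
    proof (cases ?C)
      case True
      have "(\<Sum>r\<in>Zk k. (\<Sum>i\<in>Zk k. \<eta> powi (i * (m - r)) * ?S i) * (\<Sum>i\<in>Zk k. \<eta> powi (i * (r - n)) * ?T i))
        = (\<Sum>r\<in>Zk k. \<Sum>i\<in>Zk k. \<Sum>i'\<in>Zk k. \<eta> powi (i * m - i' * n) * (?S i * ?T i') * \<eta> powi (r * (i' - i)))"
        unfolding sum_product
      proof (intro sum.cong refl)
        fix r i i'
        have e: "\<eta> powi (i * (m - r)) * \<eta> powi (i' * (r - n)) = \<eta> powi (i * m - i' * n) * \<eta> powi (r * (i' - i))"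
          unfolding powi_add[symmetric] by (simp add: algebra_simps)
        have "\<eta> powi (i * (m - r)) * ?S i * (\<eta> powi (i' * (r - n)) * ?T i')
            = (\<eta> powi (i * (m - r)) * \<eta> powi (i' * (r - n))) * (?S i * ?T i')"
          by (simp only: mult_ac)
        then show "\<eta> powi (i * (m - r)) * ?S i * (\<eta> powi (i' * (r - n)) * ?T i')
            = \<eta> powi (i * m - i' * n) * (?S i * ?T i') * \<eta> powi (r * (i' - i))"
          unfolding e by (simp only: mult_ac)
      qed
      also have "\<dots> = (\<Sum>i\<in>Zk k. \<Sum>i'\<in>Zk k. \<Sum>r\<in>Zk k. \<eta> powi (i * m - i' * n) * (?S i * ?T i') * \<eta> powi (r * (i' - i)))"
        by (subst sum.swap, intro sum.cong refl sum.swap)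
      also have "\<dots> = (\<Sum>i\<in>Zk k. of_nat k * (\<eta> powi (i * (m - n)) * (?S i * ?T i)))"
      proof (intro sum.cong refl)
        fix i assume i: "i \<in> Zk k"
        show "(\<Sum>i'\<in>Zk k. \<Sum>r\<in>Zk k. \<eta> powi (i * m - i' * n) * (?S i * ?T i') * \<eta> powi (r * (i' - i)))
            = of_nat k * (\<eta> powi (i * (m - n)) * (?S i * ?T i))"
        proof (rule sum_Zk_unique[OF i])
          fix i' assume i': "i' \<in> Zk k"
          have "(i' - i) mod K = 0 \<longleftrightarrow> i' = i" using mod_diff_eq_iff(2)[OF i' i, of i] by simp
          then show "(\<Sum>r\<in>Zk k. \<eta> powi (i * m - i' * n) * (?S i * ?T i') * \<eta> powi (r * (i' - i)))
            = (if i' = i then of_nat k * (\<eta> powi (i * (m - n)) * (?S i * ?T i)) else 0)"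
            unfolding sum_distrib_left[symmetric] root_sum by (simp add: algebra_simps)
        qed
      qed
      finally have *: "(\<Sum>r\<in>Zk k. (\<Sum>i\<in>Zk k. \<eta> powi (i * (m - r)) * ?S i) * (\<Sum>i\<in>Zk k. \<eta> powi (i * (r - n)) * ?T i))
        = of_nat k * (\<Sum>i\<in>Zk k. \<eta> powi (i * (m - n)) * (?S i * ?T i))" by (simp add: sum_distrib_left)
      have "(\<Sum>r\<in>Zk k. (1 / of_nat k * (\<Sum>i\<in>Zk k. \<eta> powi (i * (m - r)) * ?S i)) *
          (1 / of_nat k * (\<Sum>i\<in>Zk k. \<eta> powi (i * (r - n)) * ?T i)))
        = (1 / of_nat k * (1 / of_nat k)) * (\<Sum>r\<in>Zk k. (\<Sum>i\<in>Zk k. \<eta> powi (i * (m - r)) * ?S i) * (\<Sum>i\<in>Zk k. \<eta> powi (i * (r - n)) * ?T i))"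
        by (subst sum_distrib_left, intro sum.cong refl) (simp only: mult_ac)
      then show ?thesis unfolding * using True k_pos by simp
    qed simp
    finally show ?thesis using ee by (simp add: comult_ee parts_comp[OF S T])
  qed
qed

lemma comult_adj: assumes T: "T \<in> blk R" shows "\<Delta> (adj T) = adj (\<Delta> T)"
proof (rule blk_eqI[OF comult_in adj_blk(1)[OF RR_per(1,2) comult_in]])
  fix P Q assume "(P, Q) \<in> RR"
  then show "entry (\<Delta> (adj T)) P Q = entry (adj (\<Delta> T)) P Q"
    unfolding adj_blk(2)[OF RR_per(1,2) comult_in]
  proof (cases rule: RR_cases)
    case (dd a b c d)
    then show "entry (\<Delta> (adj T)) P Q = cnj (entry (\<Delta> T) Q P)" by (simp add: comult_dd parts_adj[OF T])
  next
    case (de a b x y)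
    have "cnj (\<eta> powi (- a * (y - x))) = \<eta> powi (- a * (x - y))"
      unfolding cnj_powi by (simp add: algebra_simps)
    then show "entry (\<Delta> (adj T)) P Q = cnj (entry (\<Delta> T) Q P)"
      using de by (simp only: comult_de parts_adj[OF T] complex_cnj_mult)
  next
    case (ed a b x y)
    have "cnj (\<eta> powi (- a * (y - x))) = \<eta> powi (- a * (x - y))"
      unfolding cnj_powi by (simp add: algebra_simps)
    then show "entry (\<Delta> (adj T)) P Q = cnj (entry (\<Delta> T) Q P)"
      using ed by (simp only: comult_ed parts_adj[OF T] complex_cnj_mult)
  next
    case (ee m m' n n')
    show "entry (\<Delta> (adj T)) P Q = cnj (entry (\<Delta> T) Q P)"
    proof (cases "(m' - m) mod K = (n' - n) mod K")
      case True
      have "(\<Sum>i\<in>Zk k. \<eta> powi (i * (m - n)) * dpart (adj T) i (m' - m))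
        = cnj (\<Sum>i\<in>Zk k. \<eta> powi (i * (n - m)) * dpart T i (n' - n))"
        unfolding cnj_sum
      proof (intro sum.cong refl)
        fix i
        have "cnj (\<eta> powi (i * (n - m))) = \<eta> powi (i * (m - n))"
          unfolding cnj_powi by (simp add: algebra_simps)
        moreover have "dpart T i (m' - m) = dpart T i (n' - n)" using True by (intro part_cong) simp_all
        ultimately show "\<eta> powi (i * (m - n)) * dpart (adj T) i (m' - m)
            = cnj (\<eta> powi (i * (n - m)) * dpart T i (n' - n))"
          by (simp only: parts_adj[OF T] complex_cnj_mult)
      qed
      moreover have "cnj (1 / of_nat k) = 1 / of_nat k" by simp
      ultimately show ?thesis using True ee by (simp only: comult_ee if_True complex_cnj_mult simp_thms)
    next
      case False
      then show ?thesis using ee by (simp add: comult_ee)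
    qed
  qed
qed

lemma comult_one: "\<Delta> (blk_one R) = blk_one RR"
proof (rule blk_eqI[OF comult_in])
  show "blk_one RR \<in> blk RR" unfolding blk_one_def by (rule of_mat_in_blk)
  fix P Q assume PQ: "(P, Q) \<in> RR"
  then have "entry (blk_one RR) P Q = (if P = Q then 1 else 0)"
    unfolding blk_one_def entry_of_mat[OF RR_per(1)] by simp
  also have "\<dots> = entry (\<Delta> (blk_one R)) P Q"
    using PQ
  proof (cases rule: RR_cases)
    case (dd a b c d)
    then show ?thesis by (simp add: comult_dd parts_one)
  next
    case (de a b x y)
    then show ?thesis by (simp add: comult_de parts_one mod_diff_eq_iff)
  next
    case (ed a b x y)
    then show ?thesis by (simp add: comult_ed parts_one mod_diff_eq_iff)
  next
    case (ee m m' n n')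
    have mn: "(m - n) mod K = 0 \<longleftrightarrow> m = n" using mod_diff_eq_iff(2)[OF ee(3,5), of n] by simp
    show ?thesis
      using ee mn mod_diff_eq_iff(2)[OF ee(4,6), of n] k_pos by (auto simp: comult_ee parts_one root_sum)
  qed
  finally show "entry (\<Delta> (blk_one R)) P Q = entry (blk_one RR) P Q" by simp
qed

lemma star_hom_comult: "star_hom (blk R) (blk RR) \<Delta>"
  unfolding star_hom_def unit_of_blk[OF R_per] unit_of_blk[OF RR_per]
  using comult_in comult_linear comult_comp comult_adj comult_one by blast

end

section \<open>Tensor products of homomorphisms of block algebras\<close>

lemma star_hom_id: "star_hom A A (\<lambda>a. a)"
  by (auto simp: star_hom_def)

lemma blk_one_otensor:
  assumes "finite R" "sym R" "trans R" "finite S" "sym S" "trans S"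
  shows "blk_one R \<otimes>\<^sub>o blk_one S = blk_one (R \<otimes>\<^sub>R S)"
proof -
  have "is_unit_of (blk (R \<otimes>\<^sub>R S)) (blk_one R \<otimes>\<^sub>o blk_one S)"
    using is_unit_of_ctensor[OF findim_blk findim_blk is_unit_of_blk is_unit_of_blk] assms ctensor_blk by metis
  moreover have "is_unit_of (blk (R \<otimes>\<^sub>R S)) (blk_one (R \<otimes>\<^sub>R S))"
    using assms by (intro is_unit_of_blk relprod_props)
  ultimately show ?thesis by (metis unit_of_eqI)
qed

lemma lin_on_blk_expand:
  assumes h: "lin_on (blk X) h" and X: "finite X" and c: "c \<in> blk X"
  shows "h c = (\<Sum>(p, q)\<in>X. oscale (entry c p q) (h (munit p q)))"
proof -
  have "h c = h (\<Sum>a\<in>X. case a of (p, q) \<Rightarrow> oscale (entry c p q) (munit p q))"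
    using blk_expand[OF X c, unfolded of_mat_def] by (rule arg_cong)
  also have "\<dots> = (\<Sum>a\<in>X. h (case a of (p, q) \<Rightarrow> oscale (entry c p q) (munit p q)))"
    by (rule lin_on_sum[OF blk_subspace h]) (auto intro!: ops.subspace_scale blk_subspace munit_in_blk)
  also have "\<dots> = (\<Sum>(p, q)\<in>X. oscale (entry c p q) (h (munit p q)))"
  proof (intro sum.cong refl, clarify)
    fix p q assume "(p, q) \<in> X"
    then show "h (oscale (entry c p q) (munit p q)) = oscale (entry c p q) (h (munit p q))"
      by (intro lin_onD(2)[OF h] munit_in_blk)
  qed
  finally show ?thesis .
qed

lemma star_hom_blk_one:
  assumes h: "star_hom (blk X) (blk Y) h" and X: "finite X" "sym X" "trans X" and Y: "finite Y" "sym Y" "trans Y"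
  shows "(\<Sum>(p, q)\<in>X. if p = q then h (munit p p) else 0) = blk_one Y"
proof -
  have l: "lin_on (blk X) h" using h by (rule star_homD)
  have oX: "blk_one X \<in> blk X" unfolding blk_one_def by (rule of_mat_in_blk)
  have "blk_one Y = h (blk_one X)" using star_homD(4)[OF h] unit_of_blk[OF X] unit_of_blk[OF Y] by simp
  also have "\<dots> = (\<Sum>(p, q)\<in>X. oscale (entry (blk_one X) p q) (h (munit p q)))"
    by (rule lin_on_blk_expand[OF l X(1) oX])
  also have "\<dots> = (\<Sum>(p, q)\<in>X. if p = q then h (munit p p) else 0)"
  proof (intro sum.cong refl, clarify)
    fix p q assume "(p, q) \<in> X"
    then show "oscale (entry (blk_one X) p q) (h (munit p q)) = (if p = q then h (munit p p) else 0)"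
      by (cases "p = q") (simp_all only: blk_one_def entry_of_mat[OF X(1)] if_True if_False ops.scale_one
          ops.scale_zero_left simp_thms)
  qed
  finally show ?thesis by (rule sym)
qed

text \<open>The tensor products of the images of matrix units are again a system of matrix units.\<close>

lemma tensor_hom_blk_exists:
  fixes R :: "'a rel" and S :: "'b rel" and R' :: "'c rel" and S' :: "'d rel"
  assumes R: "finite R" "sym R" "trans R" and S: "finite S" "sym S" "trans S"
    and R': "finite R'" "sym R'" "trans R'" and S': "finite S'" "sym S'" "trans S'"
    and f: "star_hom (blk R) (blk R') f" and g: "star_hom (blk S) (blk S') g"
  shows "\<exists>F. is_tensor_hom (blk R) (blk S) (blk R') (blk S') f g F"
proof -
  define \<Phi> where "\<Phi> P Q = f (munit (fst P) (fst Q)) \<otimes>\<^sub>o g (munit (snd P) (snd Q))" for P Q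
  define F where "F T = (\<Sum>(P, Q)\<in>R \<otimes>\<^sub>R S. oscale (entry T P Q) (\<Phi> P Q))" for T
  have fi: "f (munit p q) \<in> blk R'" if "(p, q) \<in> R" for p q using f that by (simp add: star_hom_def munit_in_blk)
  have gi: "g (munit p q) \<in> blk S'" if "(p, q) \<in> S" for p q using g that by (simp add: star_hom_def munit_in_blk)
  have f0: "f 0 = 0" and g0: "g 0 = 0"
    using lin_on_zero[OF blk_subspace star_homD(1)[OF f]] lin_on_zero[OF blk_subspace star_homD(1)[OF g]] .
  have adj_munit: "adj (munit p q) = munit q p" for p q :: 'z
  proof -
    let ?U = "{(p, q), (q, p)}"
    have U: "finite ?U" "sym ?U" by (auto simp: sym_def)
    have m: "munit p q \<in> blk ?U" "munit q p \<in> blk ?U" by (auto intro: munit_in_blk)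
    show ?thesis
      by (rule blk_eqI[OF adj_blk(1)[OF U m(1)] m(2)]) (auto simp: adj_blk(2)[OF U m(1)] entry_munit)
  qed
  have tin: "a \<otimes>\<^sub>o b \<in> blk (R' \<otimes>\<^sub>R S')" if "a \<in> blk R'" "b \<in> blk S'" for a b
    using that otensor_in_ctensor[OF findim_blk[OF R'(1)] findim_blk[OF S'(1)]] ctensor_blk[OF R'(1) S'(1)] by simp
  have hom: "star_hom (blk (R \<otimes>\<^sub>R S)) (blk (R' \<otimes>\<^sub>R S')) F"
    unfolding F_def[abs_def]
  proof (rule star_hom_blkI)
    show "\<Phi> P Q \<in> blk (R' \<otimes>\<^sub>R S')" if "(P, Q) \<in> R \<otimes>\<^sub>R S" for P Q
      using that fi gi unfolding \<Phi>_def by (cases P; cases Q) (auto intro: tin)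
    show "\<Phi> P Q \<circ> \<Phi> P' Q' = (if Q = P' then \<Phi> P Q' else 0)"
      if PQ: "(P, Q) \<in> R \<otimes>\<^sub>R S" "(P', Q') \<in> R \<otimes>\<^sub>R S" for P Q P' Q'
    proof -
      obtain p r q s p' r' q' s' where e: "P = (p, r)" "Q = (q, s)" "P' = (p', r')" "Q' = (q', s')"
        by (metis surj_pair)
      have r: "(p, q) \<in> R" "(r, s) \<in> S" "(p', q') \<in> R" "(r', s') \<in> S" using PQ e by simp_all
      have "\<Phi> P Q \<circ> \<Phi> P' Q' = (f (munit p q) \<circ> f (munit p' q')) \<otimes>\<^sub>o (g (munit r s) \<circ> g (munit r' s'))"
        unfolding \<Phi>_def e fst_conv snd_conv
        by (intro otensor_comp blk_bdd[OF fi] blk_bdd[OF gi] r)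
      also have "\<dots> = f (munit p q \<circ> munit p' q') \<otimes>\<^sub>o g (munit r s \<circ> munit r' s')"
        using star_homD(3)[OF f munit_in_blk[OF r(1)] munit_in_blk[OF r(3)]]
          star_homD(3)[OF g munit_in_blk[OF r(2)] munit_in_blk[OF r(4)]] by simp
      also have "\<dots> = (if Q = P' then \<Phi> P Q' else 0)"
      proof (cases "q = p'")
        case qp: True
        then have pq': "(p, q') \<in> R" using r R(3) by (blast dest: transD)
        show ?thesis
        proof (cases "s = r'")
          case True
          then show ?thesis using qp by (simp only: munit_comp if_True e \<Phi>_def fst_conv snd_conv simp_thms)
        next
          case False
          then show ?thesis using qp
            by (simp only: munit_comp if_True if_False e g0 otensor_zero(2)[OF blk_bdd[OF fi[OF pq']]] prod.inject simp_thms)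
        qed
      next
        case qp: False
        have "bounded_oper (g (munit r s \<circ> munit r' s'))"
          using star_homD(2)[OF g blk_comp[OF S(1,3) munit_in_blk[OF r(2)] munit_in_blk[OF r(4)]]] by (rule blk_bdd)
        then show ?thesis using qp
          by (simp only: munit_comp[of p q p' q'] if_False e f0 otensor_zero(1) prod.inject simp_thms)
      qed
      finally show ?thesis .
    qed
    show "adj (\<Phi> P Q) = \<Phi> Q P" if PQ: "(P, Q) \<in> R \<otimes>\<^sub>R S" for P Q
    proof -
      obtain p r q s where e: "P = (p, r)" "Q = (q, s)" by (metis surj_pair)
      have r: "(p, q) \<in> R" "(r, s) \<in> S" "(q, p) \<in> R" "(s, r) \<in> S"
        using PQ e R(2) S(2) by (auto dest: symD)
      have fa: "adj (f (munit p q)) = f (munit q p)" and ga: "adj (g (munit r s)) = g (munit s r)"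
        using f g munit_in_blk[OF r(1)] munit_in_blk[OF r(2)] adj_munit unfolding star_hom_def by metis+
      have t: "finite (R' \<otimes>\<^sub>R S')" "sym (R' \<otimes>\<^sub>R S')" by (intro relprod_props R' S')+
      show ?thesis
        unfolding \<Phi>_def e fst_conv snd_conv
      proof (rule blk_eqI[OF adj_blk(1)[OF t tin[OF fi gi]] tin[OF fi gi]])
        fix X Y :: "'c \<times> 'd"
        obtain x x' y y' where xy: "X = (x, x')" "Y = (y, y')" by (metis surj_pair)
        show "entry (adj (f (munit p q) \<otimes>\<^sub>o g (munit r s))) X Y = entry (f (munit q p) \<otimes>\<^sub>o g (munit s r)) X Y"
          unfolding xy adj_blk(2)[OF t tin[OF fi[OF r(1)] gi[OF r(2)]]]
            entry_otensor[OF blk_bdd[OF fi[OF r(1)]] blk_bdd[OF gi[OF r(2)]]]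
            entry_otensor[OF blk_bdd[OF fi[OF r(3)]] blk_bdd[OF gi[OF r(4)]]]
          using adj_blk(2)[OF R'(1,2) fi[OF r(1)], of x y] adj_blk(2)[OF S'(1,2) gi[OF r(2)], of x' y'] fa ga
          by simp
      qed (use r in auto)
    qed
    show "(\<Sum>(P, Q)\<in>R \<otimes>\<^sub>R S. if P = Q then \<Phi> P P else 0) = blk_one (R' \<otimes>\<^sub>R S')"
    proof -
      have oS: "blk_one S' \<in> blk S'" unfolding blk_one_def by (rule of_mat_in_blk)
      have lt1: "lin_on (blk R') (\<lambda>x. x \<otimes>\<^sub>o blk_one S')"
        unfolding lin_on_def using otensor_linear(1,3)[OF blk_bdd blk_bdd blk_bdd[OF oS] blk_bdd[OF oS]] by blast
      have lt2: "lin_on (blk S') (\<lambda>x. y \<otimes>\<^sub>o x)" if "y \<in> blk R'" for y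
        unfolding lin_on_def using otensor_linear(2,4)[OF blk_bdd[OF that] blk_bdd[OF that] blk_bdd blk_bdd] by blast
      have RS: "R \<otimes>\<^sub>R S = (\<lambda>((p, q), (r, s)). ((p, r), (q, s))) ` (R \<times> S)" by (force simp: relprod_def)
      have inj: "inj_on (\<lambda>((p, q), (r, s)). ((p, r), (q, s))) (R \<times> S)" by (auto simp: inj_on_def)
      have "blk_one (R' \<otimes>\<^sub>R S') = blk_one R' \<otimes>\<^sub>o blk_one S'"
        by (rule blk_one_otensor[OF R' S', symmetric])
      also have "\<dots> = (\<Sum>(p, q)\<in>R. if p = q then f (munit p p) else 0) \<otimes>\<^sub>o blk_one S'"
        by (simp only: star_hom_blk_one[OF f R R'])
      also have "\<dots> = (\<Sum>a\<in>R. (case a of (p, q) \<Rightarrow> if p = q then f (munit p p) else 0) \<otimes>\<^sub>o blk_one S')"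
        by (rule lin_on_sum[OF blk_subspace lt1]) (auto intro: fi ops.subspace_0[OF blk_subspace])
      also have "\<dots> = (\<Sum>a\<in>R. \<Sum>b\<in>S. (case a of (p, q) \<Rightarrow> if p = q then f (munit p p) else 0) \<otimes>\<^sub>o
          (case b of (r, s) \<Rightarrow> if r = s then g (munit r r) else 0))"
      proof (rule sum.cong[OF refl])
        fix a assume a: "a \<in> R"
        have "(case a of (p, q) \<Rightarrow> if p = q then f (munit p p) else 0) \<in> blk R'"
          using a fi ops.subspace_0[OF blk_subspace, of R'] by (cases a) auto
        from lin_on_sum[OF blk_subspace lt2[OF this], of S "\<lambda>b. case b of (r, s) \<Rightarrow> if r = s then g (munit r r) else 0"]
        show "(case a of (p, q) \<Rightarrow> if p = q then f (munit p p) else 0) \<otimes>\<^sub>o blk_one S'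
          = (\<Sum>b\<in>S. (case a of (p, q) \<Rightarrow> if p = q then f (munit p p) else 0) \<otimes>\<^sub>o
              (case b of (r, s) \<Rightarrow> if r = s then g (munit r r) else 0))"
          unfolding star_hom_blk_one[OF g S S'] using gi ops.subspace_0[OF blk_subspace, of S'] by fastforce
      qed
      also have "\<dots> = (\<Sum>(a, b)\<in>R \<times> S. (case a of (p, q) \<Rightarrow> if p = q then f (munit p p) else 0) \<otimes>\<^sub>o
          (case b of (r, s) \<Rightarrow> if r = s then g (munit r r) else 0))"
        by (rule sum.cartesian_product)
      also have "\<dots> = (\<Sum>(P, Q)\<in>R \<otimes>\<^sub>R S. if P = Q then \<Phi> P P else 0)"
        unfolding RS sum.reindex[OF inj] o_def
      proof (intro sum.cong refl, goal_cases)
        case (1 x)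
        obtain p q r s where x: "x = ((p, q), (r, s))" by (metis surj_pair)
        have pq: "(p, q) \<in> R" and rs: "(r, s) \<in> S" using 1 x by simp_all
        have z: "f (munit p p) \<otimes>\<^sub>o 0 = (0 :: (_ \<times> 'd) oper)" if "p = q"
          using fi[of p p] pq that by (intro otensor_zero blk_bdd) auto
        have z': "0 \<otimes>\<^sub>o g (munit r r) = (0 :: ('c \<times> _) oper)" if "r = s"
          using gi[of r r] rs that by (intro otensor_zero blk_bdd) auto
        have z'': "0 \<otimes>\<^sub>o 0 = (0 :: ('c \<times> 'd) oper)" by (intro otensor_zero bounded_oper_zero)
        show ?case unfolding x \<Phi>_def using z z' z'' by (cases "p = q"; cases "r = s") simp_all
      qed
      finally show ?thesis by (rule sym)
    qed
  qed (intro relprod_props R S R' S')+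
  have lf: "lin_on (blk R) f" and lg: "lin_on (blk S) g" using star_homD(1)[OF f] star_homD(1)[OF g] .
  have Ftens: "F (a \<otimes>\<^sub>o b) = f a \<otimes>\<^sub>o g b" if a: "a \<in> blk R" and b: "b \<in> blk S" for a b
  proof -
    have RS: "R \<otimes>\<^sub>R S = (\<lambda>((p, q), (r, s)). ((p, r), (q, s))) ` (R \<times> S)" by (force simp: relprod_def)
    have inj: "inj_on (\<lambda>((p, q), (r, s)). ((p, r), (q, s))) (R \<times> S)" by (auto simp: inj_on_def)
    let ?f = "\<lambda>x. case x of (p, q) \<Rightarrow> oscale (entry a p q) (f (munit p q))"
    let ?g = "\<lambda>x. case x of (p, q) \<Rightarrow> oscale (entry b p q) (g (munit p q))"
    have fin: "?f x \<in> blk R'" if "x \<in> R" for x using that by (cases x) (auto intro!: ops.subspace_scale[OF blk_subspace] fi)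
    have gin: "?g x \<in> blk S'" if "x \<in> S" for x using that by (cases x) (auto intro!: ops.subspace_scale[OF blk_subspace] gi)
    have gb: "g b \<in> blk S'" using star_homD(2)[OF g b] .
    have lt1: "lin_on (blk R') (\<lambda>x. x \<otimes>\<^sub>o g b)"
      unfolding lin_on_def using otensor_linear(1,3)[OF blk_bdd blk_bdd blk_bdd[OF gb] blk_bdd[OF gb]] by blast
    have lt2: "lin_on (blk S') (\<lambda>x. y \<otimes>\<^sub>o x)" if "y \<in> blk R'" for y
      unfolding lin_on_def using otensor_linear(2,4)[OF blk_bdd[OF that] blk_bdd[OF that] blk_bdd blk_bdd] by blast
    have "f a \<otimes>\<^sub>o g b = (\<Sum>x\<in>R. ?f x) \<otimes>\<^sub>o g b" using lin_on_blk_expand[OF lf R(1) a] by (rule arg_cong)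
    also have "\<dots> = (\<Sum>x\<in>R. ?f x \<otimes>\<^sub>o g b)" by (rule lin_on_sum[OF blk_subspace lt1 fin])
    also have "\<dots> = (\<Sum>x\<in>R. \<Sum>y\<in>S. ?f x \<otimes>\<^sub>o ?g y)"
    proof (rule sum.cong[OF refl])
      fix x assume x: "x \<in> R"
      have "?f x \<otimes>\<^sub>o g b = ?f x \<otimes>\<^sub>o (\<Sum>y\<in>S. ?g y)" using lin_on_blk_expand[OF lg S(1) b] by (rule arg_cong)
      also have "\<dots> = (\<Sum>y\<in>S. ?f x \<otimes>\<^sub>o ?g y)" by (rule lin_on_sum[OF blk_subspace lt2[OF fin[OF x]] gin])
      finally show "?f x \<otimes>\<^sub>o g b = (\<Sum>y\<in>S. ?f x \<otimes>\<^sub>o ?g y)" .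
    qed
    also have "\<dots> = (\<Sum>(x, y)\<in>R \<times> S. ?f x \<otimes>\<^sub>o ?g y)" by (rule sum.cartesian_product)
    also have "\<dots> = F (a \<otimes>\<^sub>o b)"
      unfolding F_def RS sum.reindex[OF inj] o_def
    proof (intro sum.cong refl, goal_cases)
      case (1 x)
      obtain p q r s where x: "x = ((p, q), (r, s))" by (metis surj_pair)
      have pq: "(p, q) \<in> R" and rs: "(r, s) \<in> S" using 1 x by simp_all
      have bd: "bounded_oper (f (munit p q))" "bounded_oper (g (munit r s))" using blk_bdd fi[OF pq] gi[OF rs] by blast+
      have "oscale (entry a p q) (f (munit p q)) \<otimes>\<^sub>o oscale (entry b r s) (g (munit r s))
          = oscale (entry a p q * entry b r s) (f (munit p q) \<otimes>\<^sub>o g (munit r s))"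
        using bd by (simp only: otensor_linear(3)[OF bd(1) bd(1) bounded_oper_scale[OF bd(2)] bd(2)]
            otensor_linear(4)[OF bd(1) bd(1) bd(2) bd(2)] ops.scale_scale)
      then show ?case unfolding x \<Phi>_def by (simp add: entry_otensor[OF blk_bdd[OF a] blk_bdd[OF b]])
    qed
    finally show ?thesis by (rule sym)
  qed
  show ?thesis
    unfolding is_tensor_hom_def ctensor_blk[OF R(1) S(1)] ctensor_blk[OF R'(1) S'(1)]
    using hom Ftens by blast
qed

context sekine_root
begin

section \<open>Coassociativity\<close>

lemma dvd_mod: "x mod K = y mod K \<longleftrightarrow> K dvd x - y"
  by (rule mod_eq_dvd_iff)

lemma comult_dd':
  "entry (\<Delta> T) (Inl (a mod K, b mod K), Inl (c mod K, d mod K)) (Inl (a mod K, b mod K), Inl (c mod K, d mod K))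
    = dpart T (a + c) (b + d)"
  unfolding comult_dd[OF mod_Zk mod_Zk mod_Zk mod_Zk] by (rule part_cong) (simp_all add: mod_simps)

lemma powi_twist: "\<eta> powi (- (a mod K) * (x mod K - y mod K)) = \<eta> powi (- a * (x - y))"
proof -
  obtain p q r where e: "a mod K = a + K * p" "x mod K = x + K * q" "y mod K = y + K * r"
    using mod_K_ex by meson
  show ?thesis
    by (rule powi_shift[of _ _ "- p * (x - y) - (a + K * p) * (q - r)"]) (simp add: e algebra_simps)
qed

lemma powi_twist': "\<eta> powi (i * (x mod K - y mod K)) = \<eta> powi (i * (x - y))"
proof -
  obtain q r where e: "x mod K = x + K * q" "y mod K = y + K * r"
    using mod_K_ex by meson
  show ?thesis
    by (rule powi_shift[of _ _ "i * (q - r)"]) (simp add: e algebra_simps)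
qed

lemma comult_de':
  "entry (\<Delta> T) (Inl (a mod K, b mod K), Inr (x mod K)) (Inl (a mod K, b mod K), Inr (y mod K))
    = \<eta> powi (- a * (x - y)) * epart T (x - b) (y - b)"
  unfolding comult_de[OF mod_Zk mod_Zk mod_Zk mod_Zk] powi_twist
  by (intro arg_cong2[where f = "(*)"] refl part_cong) (simp_all add: mod_simps)

lemma comult_ed':
  "entry (\<Delta> T) (Inr (x mod K), Inl (a mod K, b mod K)) (Inr (y mod K), Inl (a mod K, b mod K))
    = \<eta> powi (- a * (x - y)) * epart T (x + b) (y + b)"
  unfolding comult_ed[OF mod_Zk mod_Zk mod_Zk mod_Zk] powi_twist
  by (intro arg_cong2[where f = "(*)"] refl part_cong) (simp_all add: mod_simps)

lemma comult_ee':
  "entry (\<Delta> T) (Inr (m mod K), Inr (m' mod K)) (Inr (n mod K), Inr (n' mod K))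
    = (if K dvd (m' - m) - (n' - n)
       then 1 / of_nat k * (\<Sum>i\<in>Zk k. \<eta> powi (i * (m - n)) * dpart T i (m' - m)) else 0)"
proof -
  have "dpart T i (m' mod K - m mod K) = dpart T i (m' - m)" for i
    by (rule part_cong) (simp_all add: mod_simps)
  then show ?thesis
    unfolding comult_ee[OF mod_Zk mod_Zk mod_Zk mod_Zk] powi_twist'
    by (simp add: mod_simps dvd_mod)
qed

text \<open>For \<open>X = a \<otimes> b\<close> these are \<open>a\<close> and \<open>b\<close>, scaled by an entry of the other factor. The entries of
  \<open>(\<Delta> \<otimes> id) X\<close> and of \<open>(id \<otimes> \<Delta>) X\<close> are entries of \<open>\<Delta>\<close> applied to such slices, which turns
  coassociativity into an identity between explicit formulas.\<close>

definition rslice :: "(sek \<times> sek) oper \<Rightarrow> sek \<Rightarrow> sek \<Rightarrow> sek oper" where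
  "rslice X s s' = of_mat R (\<lambda>p q. entry X (p, s) (q, s'))"

definition lslice :: "(sek \<times> sek) oper \<Rightarrow> sek \<Rightarrow> sek \<Rightarrow> sek oper" where
  "lslice X p q = of_mat R (\<lambda>s s'. entry X (p, s) (q, s'))"

lemma slice_parts:
  "dpart (rslice X s s') i j = entry X (Inl (i mod K, j mod K), s) (Inl (i mod K, j mod K), s')"
  "epart (rslice X s s') i j = entry X (Inr (i mod K), s) (Inr (j mod K), s')"
  "dpart (lslice X p q) i j = entry X (p, Inl (i mod K, j mod K)) (q, Inl (i mod K, j mod K))"
  "epart (lslice X p q) i j = entry X (p, Inr (i mod K)) (q, Inr (j mod K))"
  unfolding dpart_def epart_def rslice_def lslice_def entry_of_mat[OF R_per(1)] by simp_all

lemma slice_in: "rslice X s s' \<in> blk R" "lslice X s s' \<in> blk R"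
  unfolding rslice_def lslice_def by (rule of_mat_in_blk)+

lemma slice_linear:
  "rslice (X + Y) s s' = rslice X s s' + rslice Y s s'" "lslice (X + Y) s s' = lslice X s s' + lslice Y s s'"
  "rslice (oscale c X) s s' = oscale c (rslice X s s')" "lslice (oscale c X) s s' = oscale c (lslice X s s')"
  "rslice 0 s s' = 0" "lslice 0 s s' = 0"
  by (rule blk_eqI[of _ R]; (intro slice_in ops.subspace_add ops.subspace_scale ops.subspace_0 blk_subspace)?;
      simp add: rslice_def lslice_def entry_add entry_scale entry_zero entry_of_mat[OF R_per(1)])+

lemma slice_otensor:
  assumes "a \<in> blk R" "b \<in> blk R"
  shows "rslice (a \<otimes>\<^sub>o b) s s' = oscale (entry b s s') a" "lslice (a \<otimes>\<^sub>o b) s s' = oscale (entry a s s') b"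
  by (rule blk_eqI[of _ R]; (intro slice_in ops.subspace_scale blk_subspace assms)?;
      simp add: rslice_def lslice_def entry_scale entry_of_mat[OF R_per(1)] entry_otensor[OF assms[THEN blk_bdd]])+

lemma entry_tensor_hom_left:
  assumes F: "is_tensor_hom (blk R) (blk R) (blk RR) (blk R) \<Delta> (\<lambda>a. a) F" and X: "X \<in> blk RR"
  shows "entry (F X) (P, s) (Q, s') = entry (\<Delta> (rslice X s s')) P Q"
proof -
  have lin: "lin_on (blk R \<otimes>\<^sub>C blk R) F" and tens: "\<And>a b. a \<in> blk R \<Longrightarrow> b \<in> blk R \<Longrightarrow> F (a \<otimes>\<^sub>o b) = \<Delta> a \<otimes>\<^sub>o b"
    using F star_homD(1) unfolding is_tensor_hom_def by blast+
  have fin: "findim (blk R)" by (rule findim_blk[OF R_per(1)])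
  have X': "X \<in> blk R \<otimes>\<^sub>C blk R" using X ctensor_blk[OF R_per(1) R_per(1)] by simp
  show ?thesis using fin fin X'
  proof (induction rule: ctensor_induct)
    case (tensor a b)
    then show ?case
      by (simp only: tens slice_otensor comult_linear entry_scale entry_otensor[OF blk_bdd[OF comult_in] blk_bdd]
          mult.commute)
  next
    case zero
    have "F 0 = 0" by (rule lin_on_zero[OF findim_subspace[OF ctensor_findim(1)[OF fin fin]] lin])
    moreover have "\<Delta> 0 = 0" using comult_linear(2)[of 0 0] by simp
    ultimately show ?case by (simp only: slice_linear entry_zero)
  next
    case (add S T)
    then have "F (S + T) = F S + F T" using lin unfolding lin_on_def by blast
    then show ?case using add by (simp only: slice_linear comult_linear entry_add)
  next
    case (scale c T)
    then have "F (oscale c T) = oscale c (F T)" using lin unfolding lin_on_def by blast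
    then show ?case using scale by (simp only: slice_linear comult_linear entry_scale)
  qed
qed

lemma entry_tensor_hom_right:
  assumes F: "is_tensor_hom (blk R) (blk R) (blk R) (blk RR) (\<lambda>a. a) \<Delta> F" and X: "X \<in> blk RR"
  shows "entry (F X) (s, P) (s', Q) = entry (\<Delta> (lslice X s s')) P Q"
proof -
  have lin: "lin_on (blk R \<otimes>\<^sub>C blk R) F" and tens: "\<And>a b. a \<in> blk R \<Longrightarrow> b \<in> blk R \<Longrightarrow> F (a \<otimes>\<^sub>o b) = a \<otimes>\<^sub>o \<Delta> b"
    using F star_homD(1) unfolding is_tensor_hom_def by blast+
  have fin: "findim (blk R)" by (rule findim_blk[OF R_per(1)])
  have X': "X \<in> blk R \<otimes>\<^sub>C blk R" using X ctensor_blk[OF R_per(1) R_per(1)] by simp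
  show ?thesis using fin fin X'
  proof (induction rule: ctensor_induct)
    case (tensor a b)
    then show ?case
      by (simp only: tens slice_otensor comult_linear entry_scale entry_otensor[OF blk_bdd blk_bdd[OF comult_in]])
  next
    case zero
    have "F 0 = 0" by (rule lin_on_zero[OF findim_subspace[OF ctensor_findim(1)[OF fin fin]] lin])
    moreover have "\<Delta> 0 = 0" using comult_linear(2)[of 0 0] by simp
    ultimately show ?case by (simp only: slice_linear entry_zero)
  next
    case (add S T)
    then have "F (S + T) = F S + F T" using lin unfolding lin_on_def by blast
    then show ?case using add by (simp only: slice_linear comult_linear entry_add)
  next
    case (scale c T)
    then have "F (oscale c T) = oscale c (F T)" using lin unfolding lin_on_def by blast
    then show ?case using scale by (simp only: slice_linear comult_linear entry_scale)
  qed
qed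

lemma entry_oassoc: "entry (oassoc Y) (p, q, r) (p', q', r') = entry Y ((p, q), r) ((p', q'), r')"
proof -
  have "(\<lambda>((i', j'), k'). ket (p', q', r') (i', j', k')) = ket ((p', q'), r')"
    by (auto simp: ket_def fun_eq_iff)
  then show ?thesis by (simp add: entry_ket oassoc_def)
qed

lemma oassoc_in_blk:
  assumes "Y \<in> blk (RR \<otimes>\<^sub>R R)" shows "oassoc Y \<in> blk (R \<otimes>\<^sub>R RR)"
proof -
  have "blk (RR \<otimes>\<^sub>R R) \<subseteq> {Y. oassoc Y \<in> blk (R \<otimes>\<^sub>R RR)}"
    unfolding blk_def[of "RR \<otimes>\<^sub>R R"]
  proof (rule ops.span_minimal)
    show "(\<lambda>(p, q). munit p q) ` (RR \<otimes>\<^sub>R R) \<subseteq> {Y. oassoc Y \<in> blk (R \<otimes>\<^sub>R RR)}"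
    proof clarify
      fix p q r p' q' r' assume "(((p, q), r), (p', q'), r') \<in> RR \<otimes>\<^sub>R R"
      then have "(p, p') \<in> R" "(q, q') \<in> R" "(r, r') \<in> R" by simp_all
      moreover have "oassoc (munit ((p, q), r) ((p', q'), r')) = munit (p, q, r) (p', q', r')"
        unfolding munit_otensor[symmetric] by (intro oassoc_otensor bounded_munit)
      ultimately show "oassoc (munit ((p, q), r) ((p', q'), r')) \<in> blk (R \<otimes>\<^sub>R RR)"
        by (simp add: munit_in_blk)
    qed
    have "oassoc (0 :: ((sek \<times> sek) \<times> sek) oper) = 0" by (auto simp: oassoc_def fun_eq_iff)
    then show "ops.subspace {Y. oassoc Y \<in> blk (R \<otimes>\<^sub>R RR)}"
      unfolding ops.subspace_def mem_Collect_eq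
      by (simp only: oassoc_linear ops.subspace_0[OF blk_subspace]) 
        (blast intro: ops.subspace_add[OF blk_subspace] ops.subspace_scale[OF blk_subspace])
  qed
  then show ?thesis using assms by blast
qed

text \<open>Translating a function on \<open>\<int>\<^sub>k\<close> multiplies its Fourier transform by a character.\<close>

lemma sum_Zk_shift: "(\<Sum>i\<in>Zk k. \<eta> powi (i * t) * dpart T (i + a) j)
    = \<eta> powi (- a * t) * (\<Sum>i\<in>Zk k. \<eta> powi (i * t) * dpart T i j)"
proof -
  have "(\<Sum>i\<in>Zk k. \<eta> powi (i * t) * dpart T (i + a) j)
      = (\<Sum>i\<in>Zk k. \<eta> powi (- a * t) * (\<eta> powi ((i + a) * t) * dpart T (i + a) j))"
  proof (intro sum.cong refl)
    fix i
    have "\<eta> powi (i * t) = \<eta> powi (- a * t) * \<eta> powi ((i + a) * t)"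
      unfolding powi_add[symmetric] by (simp add: algebra_simps)
    then show "\<eta> powi (i * t) * dpart T (i + a) j = \<eta> powi (- a * t) * (\<eta> powi ((i + a) * t) * dpart T (i + a) j)"
      by (simp only: mult.assoc)
  qed
  also have "\<dots> = \<eta> powi (- a * t) * (\<Sum>i\<in>Zk k. \<eta> powi ((i + a) * t) * dpart T (i + a) j)"
    by (rule sum_distrib_left[symmetric])
  also have "(\<Sum>i\<in>Zk k. \<eta> powi ((i + a) * t) * dpart T (i + a) j) = (\<Sum>i\<in>Zk k. \<eta> powi (i * t) * dpart T i j)"
  proof (rule sum_shift[of "\<lambda>i. \<eta> powi (i * t) * dpart T i j"])
    fix w
    have "\<eta> powi ((w mod K) * t) = \<eta> powi (w * t)" by (rule powi_cong) (simp add: mod_simps)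
    then show "\<eta> powi ((w mod K) * t) * dpart T (w mod K) j = \<eta> powi (w * t) * dpart T w j"
      by (simp add: dpart_def)
  qed
  finally show ?thesis .
qed

text \<open>According to whether each of the three indices belongs to the commutative summand or to the matrix
  summand there are eight cases, each a comparison of phases and index shifts. With two matrix
  indices both sides are Fourier sums, compared by a translation of the frequency or by the congruence
  under which they do not vanish. With three matrix indices orthogonality evaluates the sums over
  all frequencies and leaves equivalent pairs of congruences.\<close>

lemma comult_coassociative_entries:
  assumes "(p, p') \<in> R" "(q, q') \<in> R" "(r, r') \<in> R"
  shows "entry (\<Delta> (rslice (\<Delta> T) r r')) (p, q) (p', q') = entry (\<Delta> (lslice (\<Delta> T) p p')) (q, r) (q', r')"
proof -
  \<comment> \<open>Writing every index as a residue makes the formulas for arbitrary integer indices apply, so that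
    the eight cases compare expressions without side conditions on the ranges of indices.\<close>
  have R_mod: "(\<exists>a b. x = Inl (a mod K, b mod K) \<and> y = x) \<or> (\<exists>a b. x = Inr (a mod K) \<and> y = Inr (b mod K))"
    if "(x, y) \<in> R" for x y
    using that
  proof (cases rule: R_cases)
    case (d a b)
    then show ?thesis using Zk_mod by metis
  next
    case (e x y)
    then show ?thesis using Zk_mod by metis
  qed
  note entries = comult_dd' comult_de' comult_ed' comult_ee' slice_parts
  show ?thesis
    using R_mod[OF assms(1)]
  proof (elim disjE exE conjE)
    fix a b assume p: "p = Inl (a mod K, b mod K)" "p' = p"
    show ?thesis using R_mod[OF assms(2)]
    proof (elim disjE exE conjE)
      fix c d assume q: "q = Inl (c mod K, d mod K)" "q' = q"
      show ?thesis using R_mod[OF assms(3)]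
      proof (elim disjE exE conjE)
        fix e f assume r: "r = Inl (e mod K, f mod K)" "r' = r"
        show ?thesis unfolding p q r entries by (simp only: add.assoc)
      next
        fix x y assume r: "r = Inr (x mod K)" "r' = Inr (y mod K)"
        have "\<eta> powi (- (a + c) * (x - y)) = \<eta> powi (- c * (x - y)) * \<eta> powi (- a * ((x - d) - (y - d)))"
          unfolding powi_add[symmetric] by (simp add: algebra_simps)
        then show ?thesis unfolding p q r entries by (simp add: algebra_simps)
      qed
    next
      fix x y assume q: "q = Inr (x mod K)" "q' = Inr (y mod K)"
      show ?thesis using R_mod[OF assms(3)]
      proof (elim disjE exE conjE)
        fix c d assume r: "r = Inl (c mod K, d mod K)" "r' = r"
        have "\<eta> powi (- a * (x - y)) * \<eta> powi (- c * ((x - b) - (y - b)))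
            = \<eta> powi (- c * (x - y)) * \<eta> powi (- a * ((x + d) - (y + d)))"
          unfolding powi_add[symmetric] by (simp add: algebra_simps)
        moreover have "x - b + d = x + d - b" "y - b + d = y + d - b" by simp_all
        ultimately show ?thesis unfolding p q r entries by (simp only: mult.assoc[symmetric])
      next
        fix m' n' assume r: "r = Inr (m' mod K)" "r' = Inr (n' mod K)"
        have c: "m' - (x - b) - (n' - (y - b)) = m' - x - (n' - y)"
          and d: "m' - (x - b) = m' - x + b" "x - b - (y - b) = x - y" by simp_all
        show ?thesis unfolding p q r entries c unfolding d
          using sum_Zk_shift[of "x - y" T a "m' - x + b"] by (simp add: add.commute)
      qed
    qed
  next
    fix x y assume p: "p = Inr (x mod K)" "p' = Inr (y mod K)"
    show ?thesis using R_mod[OF assms(2)]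
    proof (elim disjE exE conjE)
      fix a b assume q: "q = Inl (a mod K, b mod K)" "q' = q"
      show ?thesis using R_mod[OF assms(3)]
      proof (elim disjE exE conjE)
        fix c d assume r: "r = Inl (c mod K, d mod K)" "r' = r"
        have "\<eta> powi (- a * (x - y)) * \<eta> powi (- c * ((x + b) - (y + b))) = \<eta> powi (- (a + c) * (x - y))"
          unfolding powi_add[symmetric] by (simp add: algebra_simps)
        then show ?thesis unfolding p q r entries by (simp only: mult.assoc[symmetric] add.assoc)
      next
        fix m' n' assume r: "r = Inr (m' mod K)" "r' = Inr (n' mod K)"
        have c: "m' - (x + b) - (n' - (y + b)) = m' - b - x - (n' - b - y)"
          and d: "m' - (x + b) = m' - b - x" "x + b - (y + b) = x - y" by simp_all
        have "\<eta> powi (- a * (x - y)) = \<eta> powi (- a * (m' - n'))" if dv: "K dvd m' - b - x - (n' - b - y)"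
        proof -
          obtain t where "m' - b - x - (n' - b - y) = K * t" using dv by (auto simp: dvd_def)
          then have e: "x - y = m' - n' - K * t" by simp
          show ?thesis by (rule powi_shift[of _ _ "a * t"]) (simp only: e, simp add: algebra_simps)
        qed
        then show ?thesis unfolding p q r entries c unfolding d by simp
      qed
    next
      fix u v assume q: "q = Inr (u mod K)" "q' = Inr (v mod K)"
      show ?thesis using R_mod[OF assms(3)]
      proof (elim disjE exE conjE)
        fix a b assume r: "r = Inl (a mod K, b mod K)" "r' = r"
        have c: "u + b - x - (v + b - y) = u - x - (v - y)" and d: "u + b - x = u - x + b" by simp_all
        have "\<eta> powi (- a * (x - y)) = \<eta> powi (- a * (u - v))" if dv: "K dvd u - x - (v - y)"
        proof -
          obtain t where "u - x - (v - y) = K * t" using dv by (auto simp: dvd_def)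
          then have e: "x - y = u - v - K * t" by simp
          show ?thesis by (rule powi_shift[of _ _ "a * t"]) (simp only: e, simp add: algebra_simps)
        qed
        then show ?thesis unfolding p q r entries c unfolding d sum_Zk_shift by simp
      next
        fix w z assume r: "r = Inr (w mod K)" "r' = Inr (z mod K)"
        have s1: "(\<Sum>i\<in>Zk k. \<eta> powi (i * (x - y)) * (\<eta> powi (- i * (w - z)) * epart T (w - (u - x)) (z - (u - x))))
            = (if K dvd x - y - (w - z) then of_nat k else 0) * epart T (w - (u - x)) (z - (u - x))"
        proof -
          have "\<eta> powi (i * (x - y)) * (\<eta> powi (- i * (w - z)) * c) = \<eta> powi (i * (x - y - (w - z))) * c" for i c
            unfolding mult.assoc[symmetric] powi_add[symmetric] by (simp add: algebra_simps)
          then show ?thesis by (simp only: sum_distrib_right[symmetric] root_sum mod_eq_0_iff_dvd)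
        qed
        have s2: "(\<Sum>i\<in>Zk k. \<eta> powi (i * (u - v)) * (\<eta> powi (- i * (x - y)) * epart T (x + (w - u)) (y + (w - u))))
            = (if K dvd u - v - (x - y) then of_nat k else 0) * epart T (x + (w - u)) (y + (w - u))"
        proof -
          have "\<eta> powi (i * (u - v)) * (\<eta> powi (- i * (x - y)) * c) = \<eta> powi (i * (u - v - (x - y))) * c" for i c
            unfolding mult.assoc[symmetric] powi_add[symmetric] by (simp add: algebra_simps)
          then show ?thesis by (simp only: sum_distrib_right[symmetric] root_sum mod_eq_0_iff_dvd)
        qed
        have c1: "K dvd u - v - (x - y) \<longleftrightarrow> K dvd u - x - (v - y)" by (simp add: algebra_simps)
        have c2: "K dvd x - y - (w - z) \<longleftrightarrow> K dvd w - u - (z - v)" if "K dvd u - x - (v - y)"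
        proof -
          have e: "w - u - (z - v) = - (x - y - (w - z)) + - (u - x - (v - y))" by simp
          have "K dvd - (u - x - (v - y))" using that by (simp only: dvd_minus_iff)
          then show ?thesis unfolding e by (simp only: dvd_add_left_iff dvd_minus_iff)
        qed
        have ep: "epart T (w - (u - x)) (z - (u - x)) = epart T (x + (w - u)) (y + (w - u))" if dv: "K dvd x - y - (w - z)"
        proof (rule part_cong)
          show "(z - (u - x)) mod K = (y + (w - u)) mod K"
            unfolding dvd_mod using dv by (simp add: algebra_simps)
        qed (simp add: algebra_simps)
        show ?thesis unfolding p q r entries s1 s2 using c1 c2 ep k_pos by auto
      qed
    qed
  qed
qed

lemma coassociative_sekine: "coassociative (sekine k \<eta>)"
proof -
  have s: "star_hom (blk R) (blk RR) \<Delta>" by (rule star_hom_comult)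
  obtain F where F: "is_tensor_hom (blk R) (blk R) (blk RR) (blk R) \<Delta> (\<lambda>a. a) F"
    using tensor_hom_blk_exists[OF R_per R_per RR_per R_per s star_hom_id] by blast
  obtain F' where F': "is_tensor_hom (blk R) (blk R) (blk R) (blk RR) (\<lambda>a. a) \<Delta> F'"
    using tensor_hom_blk_exists[OF R_per R_per R_per RR_per star_hom_id s] by blast
  have "oassoc (F (\<Delta> T)) = F' (\<Delta> T)" for T
  proof -
    have "F (\<Delta> T) \<in> blk (RR \<otimes>\<^sub>R R)" "F' (\<Delta> T) \<in> blk (R \<otimes>\<^sub>R RR)"
      using F F' comult_in ctensor_blk[OF R_per(1) R_per(1)] ctensor_blk[OF RR_per(1) R_per(1)]
        ctensor_blk[OF R_per(1) RR_per(1)]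
      unfolding is_tensor_hom_def star_hom_def by simp_all
    then show ?thesis
    proof (intro blk_eqI[OF oassoc_in_blk])
      fix P Q assume PQ: "(P, Q) \<in> R \<otimes>\<^sub>R RR"
      obtain p q r p' q' r' where e: "P = (p, q, r)" "Q = (p', q', r')" by (metis surj_pair)
      have "(p, p') \<in> R" "(q, q') \<in> R" "(r, r') \<in> R" using PQ e by simp_all
      then show "entry (oassoc (F (\<Delta> T))) P Q = entry (F' (\<Delta> T)) P Q"
        unfolding e entry_oassoc entry_tensor_hom_left[OF F comult_in] entry_tensor_hom_right[OF F' comult_in]
        by (rule comult_coassociative_entries)
    qed
  qed
  then show ?thesis
    unfolding coassociative_def Let_def sekine_def using F F'
    by (auto simp: sek_alg_blk ctensor_blk[OF R_per(1) R_per(1)])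
qed

end

section \<open>Cancellation\<close>

lemma munit_apply_ket: "munit p q (ket r) = (if r = q then ket p else 0)"
proof (rule ext)
  fix i show "munit p q (ket r) i = (if r = q then ket p else 0) i"
    unfolding munit_ket by (simp add: ket_def)
qed

lemma sum_if_const: "(\<Sum>p\<in>X. if C then F p else 0) = (if C then \<Sum>p\<in>X. F p else (0 :: complex))"
  by simp

lemma tvec_zero: "tvec 0 y = 0" "tvec x 0 = 0"
  by (auto simp: tvec_def fun_eq_iff)

context sekine_root
begin

lemma one_ket: "(q, q) \<in> R \<Longrightarrow> blk_one R (ket q) = ket q"
  using entry_of_mat[OF R_per(1), of "\<lambda>p q. if p = q then 1 else 0" _ q]
  by (intro ext) (simp add: blk_one_def entry_ket, simp add: ket_def)

lemma one_in: "blk_one R \<in> blk R"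
  unfolding blk_one_def by (rule of_mat_in_blk)

lemma entry_comp_left_leg:
  assumes X: "X \<in> blk RR" and s: "(s, s) \<in> R"
  shows "entry (X \<circ> (munit p q \<otimes>\<^sub>o blk_one R)) P (r, s) = (if r = q then entry X P (p, s) else 0)"
  using otensor_tvec[OF blk_bdd[OF one_in] bounded_munit[of p q] ket_l2[of r] ket_l2[of s]]
    bdd_zero[OF blk_bdd[OF X]]
  by (cases "r = q") (simp_all add: entry_ket ket_pair munit_apply_ket one_ket[OF s] tvec_zero)

lemma entry_comp_right_leg:
  assumes X: "X \<in> blk RR" and s: "(s, s) \<in> R"
  shows "entry (X \<circ> (blk_one R \<otimes>\<^sub>o munit p q)) P (s, r) = (if r = q then entry X P (s, p) else 0)"
  using otensor_tvec[OF bounded_munit[of p q] blk_bdd[OF one_in] ket_l2[of s] ket_l2[of r]]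
    bdd_zero[OF blk_bdd[OF X]]
  by (cases "r = q") (simp_all add: entry_ket ket_pair munit_apply_ket one_ket[OF s] tvec_zero)

lemma parts_sek:
  "dpart (sek_d k i j) i' j' = (if i' mod K = i mod K \<and> j' mod K = j mod K then 1 else 0)"
  "epart (sek_d k i j) i' j' = 0" "dpart (sek_e k i j) i' j' = 0"
  "epart (sek_e k i j) i' j' = (if i' mod K = i mod K \<and> j' mod K = j mod K then 1 else 0)"
  by (auto simp: dpart_def epart_def entry_sek_d entry_sek_e)

lemma comult_ee_sek_d:
  assumes "m \<in> Zk k" "m' \<in> Zk k" "n \<in> Zk k" "n' \<in> Zk k" and i: "i \<in> Zk k"
  shows "entry (\<Delta> (sek_d k i j)) (Inr m, Inr m') (Inr n, Inr n')
    = (if (m' - m) mod K = j mod K \<and> (n' - n) mod K = j mod K then 1 / of_nat k * \<eta> powi (i * (m - n)) else 0)"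
proof -
  have "(\<Sum>i'\<in>Zk k. \<eta> powi (i' * (m - n)) * dpart (sek_d k i j) i' (m' - m))
      = (if (m' - m) mod K = j mod K then \<eta> powi (i * (m - n)) else 0)"
    by (rule sum_Zk_unique[OF i]) (auto simp: parts_sek Zk_mod[OF i] Zk_mod)
  then show ?thesis using assms by (auto simp: comult_ee)
qed

lemma powi_sum_cancel:
  assumes "a \<in> Zk k" "b \<in> Zk k"
  shows "(\<Sum>p\<in>Zk k. \<eta> powi (a * (x - p)) * \<eta> powi (- b * (x - p))) = (if a = b then of_nat k else 0)"
proof -
  have "\<eta> powi (a * (x - p)) * \<eta> powi (- b * (x - p)) = \<eta> powi ((a - b) * x) * \<eta> powi (p * (b - a))" for p
    unfolding powi_add[symmetric] by (simp add: algebra_simps)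
  then show ?thesis
    using mod_diff_eq_iff(2)[OF assms(2,1), of a]
    by (simp add: sum_distrib_left[symmetric] root_sum)
qed

text \<open>The two spans in the cancellation property. That they contain all matrix units of the tensor square
  is checked separately for the four kinds of blocks.\<close>

definition Vl :: "(sek \<times> sek) oper set" where
  "Vl = ops.span {\<Delta> a \<circ> (b \<otimes>\<^sub>o blk_one R) |a b. a \<in> blk R \<and> b \<in> blk R}"

definition Vr :: "(sek \<times> sek) oper set" where
  "Vr = ops.span {\<Delta> a \<circ> (blk_one R \<otimes>\<^sub>o b) |a b. a \<in> blk R \<and> b \<in> blk R}"

lemma V_gen:
  "a \<in> blk R \<Longrightarrow> (p, q) \<in> R \<Longrightarrow> \<Delta> a \<circ> (munit p q \<otimes>\<^sub>o blk_one R) \<in> Vl"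
  "a \<in> blk R \<Longrightarrow> (p, q) \<in> R \<Longrightarrow> \<Delta> a \<circ> (blk_one R \<otimes>\<^sub>o munit p q) \<in> Vr"
  unfolding Vl_def Vr_def by (rule ops.span_base, blast intro: munit_in_blk)+

lemma V_subspace: "ops.subspace Vl" "ops.subspace Vr"
  unfolding Vl_def Vr_def by (rule ops.subspace_span)+

lemma V_sub: "Vl \<subseteq> blk RR" "Vr \<subseteq> blk RR"
  unfolding Vl_def Vr_def
  by (rule ops.span_minimal[OF _ blk_subspace],
      blast intro: blk_comp[OF RR_per(1,3) comult_in] tensor_in_blk one_in)+

lemma mem_by_entries:
  assumes V: "V \<subseteq> blk RR" and X: "X \<in> V" and PQ: "(P, Q) \<in> RR"
    and e: "\<And>P' Q'. (P', Q') \<in> RR \<Longrightarrow> entry X P' Q' = (if P' = P \<and> Q' = Q then 1 else 0)"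
  shows "munit P Q \<in> V"
proof -
  have "munit P Q = X"
    using X V by (intro blk_eqI[OF munit_in_blk[OF PQ]]) (auto simp: e entry_munit)
  then show ?thesis using X by simp
qed

lemma diag_R: "(p, q) \<in> R \<Longrightarrow> (p, p) \<in> R \<and> (q, q) \<in> R"
  by (auto simp: R_def)

lemma entry_left_gen:
  assumes "(P', (r, s)) \<in> RR"
  shows "entry (\<Delta> a \<circ> (munit p q \<otimes>\<^sub>o blk_one R)) P' (r, s) = (if r = q then entry (\<Delta> a) P' (p, s) else 0)"
  using assms diag_R by (intro entry_comp_left_leg comult_in) (cases P', auto)

lemma entry_right_gen:
  assumes "(P', (r, s)) \<in> RR"
  shows "entry (\<Delta> a \<circ> (blk_one R \<otimes>\<^sub>o munit p q)) P' (r, s) = (if s = q then entry (\<Delta> a) P' (r, p) else 0)"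
  using assms diag_R by (intro entry_comp_right_leg comult_in) (cases P', auto)

lemma comult_RR_zero: "(P, Q) \<notin> RR \<Longrightarrow> entry (\<Delta> a) P Q = 0"
  by (rule entry_outside[OF comult_in])

lemma comult_off_block:
  "entry (\<Delta> (sek_e k i j)) (Inr m, Inr m') (Inr n, Inr n') = 0"
  "entry (\<Delta> (sek_d k i j)) (Inr x, Inl (a, b)) (Inr y, Inl (a, b)) = 0"
  "entry (\<Delta> (sek_d k i j)) (Inl (a, b), Inr x) (Inl (a, b), Inr y) = 0"
proof -
  show "entry (\<Delta> (sek_e k i j)) (Inr m, Inr m') (Inr n, Inr n') = 0"
    by (cases "((Inr m, Inr m'), (Inr n, Inr n')) \<in> RR") (simp_all add: comult_ee parts_sek comult_RR_zero)
  show "entry (\<Delta> (sek_d k i j)) (Inr x, Inl (a, b)) (Inr y, Inl (a, b)) = 0"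
    by (cases "((Inr x, Inl (a, b)), (Inr y, Inl (a, b))) \<in> RR")
      (simp_all add: comult_ed parts_sek comult_RR_zero)
  show "entry (\<Delta> (sek_d k i j)) (Inl (a, b), Inr x) (Inl (a, b), Inr y) = 0"
    by (cases "((Inl (a, b), Inr x), (Inl (a, b), Inr y)) \<in> RR")
      (simp_all add: comult_de parts_sek comult_RR_zero)
qed

lemma mod_add_left_eq_iff: "x \<in> Zk k \<Longrightarrow> y \<in> Zk k \<Longrightarrow> (c + x) mod K = (c + y) mod K \<longleftrightarrow> x = y"
  using mod_diff_eq_iff(1)[of x y c] by (simp add: add.commute)

lemma mod_diff_left_eq_iff: 
  assumes "x \<in> Zk k" "y \<in> Zk k" shows "(c - x) mod K = (c - y) mod K \<longleftrightarrow> x = y"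
proof
  assume "(c - x) mod K = (c - y) mod K"
  then have "(c - (c - x) mod K) mod K = (c - (c - y) mod K) mod K" by simp
  then show "x = y" using assms by (simp add: mod_simps Zk_mod)
qed simp

lemma powi_cancel: "\<eta> powi t * \<eta> powi (- t) = 1"
  unfolding powi_add[symmetric] by simp

lemma munit_dd:
  assumes "a \<in> Zk k" "b \<in> Zk k" "c \<in> Zk k" "d \<in> Zk k"
  shows "munit (Inl (a, b), Inl (c, d)) (Inl (a, b), Inl (c, d)) \<in> Vl"
    "munit (Inl (a, b), Inl (c, d)) (Inl (a, b), Inl (c, d)) \<in> Vr"
proof -
  let ?P = "(Inl (a, b), Inl (c, d)) :: sek \<times> sek"
  have PP: "(?P, ?P) \<in> RR" using assms by simp
  show "munit ?P ?P \<in> Vl"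
  proof (rule mem_by_entries[OF V_sub(1) _ PP])
    show "\<Delta> (sek_d k (a + c) (b + d)) \<circ> (munit (Inl (a, b)) (Inl (a, b)) \<otimes>\<^sub>o blk_one R) \<in> Vl"
      by (intro V_gen(1) sek_in_blk) (simp add: assms)
    fix P' Q' assume PQ: "(P', Q') \<in> RR"
    then show "entry (\<Delta> (sek_d k (a + c) (b + d)) \<circ> (munit (Inl (a, b)) (Inl (a, b)) \<otimes>\<^sub>o blk_one R)) P' Q'
        = (if P' = ?P \<and> Q' = ?P then 1 else 0)"
      by (cases rule: RR_cases)
        (use PQ assms in \<open>auto simp: entry_left_gen comult_dd comult_de parts_sek mod_add_left_eq_iff\<close>)
  qed
  show "munit ?P ?P \<in> Vr"
  proof (rule mem_by_entries[OF V_sub(2) _ PP])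
    show "\<Delta> (sek_d k (a + c) (b + d)) \<circ> (blk_one R \<otimes>\<^sub>o munit (Inl (c, d)) (Inl (c, d))) \<in> Vr"
      by (intro V_gen(2) sek_in_blk) (simp add: assms)
    fix P' Q' assume PQ: "(P', Q') \<in> RR"
    then show "entry (\<Delta> (sek_d k (a + c) (b + d)) \<circ> (blk_one R \<otimes>\<^sub>o munit (Inl (c, d)) (Inl (c, d)))) P' Q'
        = (if P' = ?P \<and> Q' = ?P then 1 else 0)"
      by (cases rule: RR_cases)
        (use PQ assms in \<open>auto simp: entry_right_gen comult_dd comult_ed parts_sek mod_diff_eq_iff\<close>)
  qed
qed

lemma munit_de_left:
  assumes "a \<in> Zk k" "b \<in> Zk k" "x \<in> Zk k" "y \<in> Zk k"
  shows "munit (Inl (a, b), Inr x) (Inl (a, b), Inr y) \<in> Vl"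
proof (rule mem_by_entries[OF V_sub(1)])
  show "oscale (\<eta> powi (a * (x - y)))
      (\<Delta> (sek_e k (x - b) (y - b)) \<circ> (munit (Inl (a, b)) (Inl (a, b)) \<otimes>\<^sub>o blk_one R)) \<in> Vl"
    by (intro V_gen(1) sek_in_blk ops.subspace_scale V_subspace) (simp add: assms)
  show "((Inl (a, b), Inr x), Inl (a, b), Inr y) \<in> RR" using assms by simp
  fix P' Q' assume PQ: "(P', Q') \<in> RR"
  then show "entry (oscale (\<eta> powi (a * (x - y)))
      (\<Delta> (sek_e k (x - b) (y - b)) \<circ> (munit (Inl (a, b)) (Inl (a, b)) \<otimes>\<^sub>o blk_one R))) P' Q'
      = (if P' = (Inl (a, b), Inr x) \<and> Q' = (Inl (a, b), Inr y) then 1 else 0)"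
    by (cases rule: RR_cases)
      (use PQ assms powi_cancel in \<open>auto simp: entry_scale entry_left_gen comult_dd comult_de parts_sek mod_diff_eq_iff\<close>)
qed

lemma munit_ed_right:
  assumes "a \<in> Zk k" "b \<in> Zk k" "x \<in> Zk k" "y \<in> Zk k"
  shows "munit (Inr x, Inl (a, b)) (Inr y, Inl (a, b)) \<in> Vr"
proof (rule mem_by_entries[OF V_sub(2)])
  show "oscale (\<eta> powi (a * (x - y)))
      (\<Delta> (sek_e k (x + b) (y + b)) \<circ> (blk_one R \<otimes>\<^sub>o munit (Inl (a, b)) (Inl (a, b)))) \<in> Vr"
    by (intro V_gen(2) sek_in_blk ops.subspace_scale V_subspace) (simp add: assms)
  show "((Inr x, Inl (a, b)), Inr y, Inl (a, b)) \<in> RR" using assms by simp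
  fix P' Q' assume PQ: "(P', Q') \<in> RR"
  then show "entry (oscale (\<eta> powi (a * (x - y)))
      (\<Delta> (sek_e k (x + b) (y + b)) \<circ> (blk_one R \<otimes>\<^sub>o munit (Inl (a, b)) (Inl (a, b))))) P' Q'
      = (if P' = (Inr x, Inl (a, b)) \<and> Q' = (Inr y, Inl (a, b)) then 1 else 0)"
    by (cases rule: RR_cases)
      (use PQ assms powi_cancel in \<open>auto simp: entry_scale entry_right_gen comult_dd comult_ed parts_sek mod_diff_eq_iff\<close>)
qed

text \<open>Here \<open>\<Delta> e\<^sub>i\<^sub>j\<close> cut down by a matrix unit is a sum over all \<open>d\<^sub>m\<^sub>,\<^sub>b\<close> with phases depending on \<open>m\<close>; Fourier
  inversion in the free index \<open>p\<close> isolates the single term with \<open>m = a\<close>.\<close>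

lemma munit_ed_left:
  assumes "a \<in> Zk k" "b \<in> Zk k" "x \<in> Zk k" "y \<in> Zk k"
  shows "munit (Inr x, Inl (a, b)) (Inr y, Inl (a, b)) \<in> Vl"
proof (rule mem_by_entries[OF V_sub(1)])
  let ?X = "oscale (1 / of_nat k) (\<Sum>p\<in>Zk k. oscale (\<eta> powi (a * (x - p)))
      (\<Delta> (sek_e k (x + b) (p + b)) \<circ> (munit (Inr p) (Inr y) \<otimes>\<^sub>o blk_one R)))"
  show "?X \<in> Vl"
    by (intro V_gen(1) sek_in_blk ops.subspace_scale ops.subspace_sum V_subspace) (simp add: assms)
  show "((Inr x, Inl (a, b)), Inr y, Inl (a, b)) \<in> RR" using assms by simp
  fix P' Q' assume PQ: "(P', Q') \<in> RR"
  then show "entry ?X P' Q' = (if P' = (Inr x, Inl (a, b)) \<and> Q' = (Inr y, Inl (a, b)) then 1 else 0)"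
  proof (cases rule: RR_cases)
    case (ed a' b' x' y')
    have "(\<Sum>p\<in>Zk k. \<eta> powi (a * (x - p)) * entry (\<Delta> (sek_e k (x + b) (p + b)) \<circ> (munit (Inr p) (Inr y) \<otimes>\<^sub>o blk_one R)) P' Q')
        = (\<Sum>p\<in>Zk k. if y' = y \<and> x' = x \<and> b' = b then \<eta> powi (a * (x - p)) * \<eta> powi (- a' * (x - p)) else 0)"
      using PQ ed assms mod_diff_eq_iff(1)
      by (intro sum.cong refl) (auto simp: entry_left_gen comult_ed parts_sek mod_add_left_eq_iff)
    then show ?thesis
      using ed assms k_pos powi_sum_cancel[OF assms(1) ed(3), of x] by (auto simp: entry_scale entry_sum sum_if_const)
  qed (use PQ assms in \<open>auto simp: entry_scale entry_sum entry_left_gen comult_off_block cong: if_cong\<close>)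
qed

lemma munit_de_right:
  assumes "a \<in> Zk k" "b \<in> Zk k" "x \<in> Zk k" "y \<in> Zk k"
  shows "munit (Inl (a, b), Inr x) (Inl (a, b), Inr y) \<in> Vr"
proof (rule mem_by_entries[OF V_sub(2)])
  let ?X = "oscale (1 / of_nat k) (\<Sum>p\<in>Zk k. oscale (\<eta> powi (a * (x - p)))
      (\<Delta> (sek_e k (x - b) (p - b)) \<circ> (blk_one R \<otimes>\<^sub>o munit (Inr p) (Inr y))))"
  show "?X \<in> Vr"
    by (intro V_gen(2) sek_in_blk ops.subspace_scale ops.subspace_sum V_subspace) (simp add: assms)
  show "((Inl (a, b), Inr x), Inl (a, b), Inr y) \<in> RR" using assms by simp
  fix P' Q' assume PQ: "(P', Q') \<in> RR"
  then show "entry ?X P' Q' = (if P' = (Inl (a, b), Inr x) \<and> Q' = (Inl (a, b), Inr y) then 1 else 0)"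
  proof (cases rule: RR_cases)
    case (de a' b' x' y')
    have "(\<Sum>p\<in>Zk k. \<eta> powi (a * (x - p)) * entry (\<Delta> (sek_e k (x - b) (p - b)) \<circ> (blk_one R \<otimes>\<^sub>o munit (Inr p) (Inr y))) P' Q')
        = (\<Sum>p\<in>Zk k. if y' = y \<and> x' = x \<and> b' = b then \<eta> powi (a * (x - p)) * \<eta> powi (- a' * (x - p)) else 0)"
      using PQ de assms mod_diff_eq_iff(2)
      by (intro sum.cong refl) (auto simp: entry_right_gen comult_de parts_sek mod_diff_left_eq_iff)
    then show ?thesis
      using de assms k_pos powi_sum_cancel[OF assms(1) de(3), of x] by (auto simp: entry_scale entry_sum sum_if_const)
  qed (use PQ assms in \<open>auto simp: entry_scale entry_sum entry_right_gen comult_off_block cong: if_cong\<close>)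
qed

text \<open>Fourier inversion in the first index \<open>i\<close> of \<open>\<Delta> d\<^sub>i\<^sub>j\<close> extracts the matrix units of the rank one projections.
  The index \<open>p\<close> is forced by the required columns: the difference of the two column indices is \<open>j\<close>.\<close>

lemma munit_ee:
  assumes "r \<in> Zk k" "u \<in> Zk k" "q \<in> Zk k" "v \<in> Zk k"
  shows "munit (Inr r, Inr u) (Inr q, Inr v) \<in> Vl" "munit (Inr u, Inr r) (Inr v, Inr q) \<in> Vr"
proof -
  show "munit (Inr r, Inr u) (Inr q, Inr v) \<in> Vl"
  proof (rule mem_by_entries[OF V_sub(1)])
    let ?p = "(v - (u - r)) mod K"
    let ?X = "\<Sum>i\<in>Zk k. oscale (\<eta> powi (- i * (r - ?p)))
        (\<Delta> (sek_d k i (u - r)) \<circ> (munit (Inr ?p) (Inr q) \<otimes>\<^sub>o blk_one R))"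
    show "?X \<in> Vl"
      by (intro V_gen(1) sek_in_blk ops.subspace_scale ops.subspace_sum V_subspace) (simp add: assms)
    show "((Inr r, Inr u), Inr q, Inr v) \<in> RR" using assms by simp
    fix P' Q' assume PQ: "(P', Q') \<in> RR"
    then show "entry ?X P' Q' = (if P' = (Inr r, Inr u) \<and> Q' = (Inr q, Inr v) then 1 else 0)"
    proof (cases rule: RR_cases)
      case (ee m m' n n')
      let ?C = "n = q \<and> (m' - m) mod K = (u - r) mod K \<and> n' = v"
      have n': "(n' - ?p) mod K = (u - r) mod K \<longleftrightarrow> n' = v"
      proof -
        have "(n' - ?p) mod K = (u - r) mod K \<longleftrightarrow> K dvd n' - v"
          by (simp add: mod_simps dvd_mod algebra_simps)
        then show ?thesis using dvd_mod[of n' v] ee assms by (simp add: Zk_mod)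
      qed
      have "entry ?X P' Q' = (\<Sum>i\<in>Zk k. if ?C then 1 / of_nat k * \<eta> powi (i * (m - r)) else 0)"
        unfolding entry_sum entry_scale
      proof (intro sum.cong refl)
        fix i assume i: "i \<in> Zk k"
        have "\<eta> powi (- i * (r - ?p)) * \<eta> powi (i * (m - ?p)) = \<eta> powi (i * (m - r))"
          unfolding powi_add[symmetric] by (simp add: algebra_simps)
        then show "\<eta> powi (- i * (r - ?p)) * entry (\<Delta> (sek_d k i (u - r)) \<circ> (munit (Inr ?p) (Inr q) \<otimes>\<^sub>o blk_one R)) P' Q'
            = (if ?C then 1 / of_nat k * \<eta> powi (i * (m - r)) else 0)"
          using PQ ee i n' by (auto simp: entry_left_gen comult_ee_sek_d)
      qed
      also have "\<dots> = (if ?C \<and> m = r then 1 else 0)"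
      proof -
        have "(\<Sum>i\<in>Zk k. 1 / of_nat k * \<eta> powi (i * (m - r))) = (if m = r then 1 else 0)"
          unfolding sum_distrib_left[symmetric] root_sum
          using mod_diff_eq_iff(2)[OF ee(3) assms(1), of r] k_pos by simp
        then show ?thesis unfolding sum_if_const by auto
      qed
      also have "\<dots> = (if P' = (Inr r, Inr u) \<and> Q' = (Inr q, Inr v) then 1 else 0)"
        using ee mod_diff_eq_iff(2)[OF ee(4) assms(2), of r] by auto
      finally show ?thesis .
    qed (use PQ assms in \<open>auto simp: entry_scale entry_sum entry_left_gen comult_off_block cong: if_cong\<close>)
  qed
  show "munit (Inr u, Inr r) (Inr v, Inr q) \<in> Vr"
  proof (rule mem_by_entries[OF V_sub(2)])
    let ?p = "(v + (r - u)) mod K"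
    let ?X = "\<Sum>i\<in>Zk k. oscale (\<eta> powi (- i * (u - v)))
        (\<Delta> (sek_d k i (r - u)) \<circ> (blk_one R \<otimes>\<^sub>o munit (Inr ?p) (Inr q)))"
    show "?X \<in> Vr"
      by (intro V_gen(2) sek_in_blk ops.subspace_scale ops.subspace_sum V_subspace) (simp add: assms)
    show "((Inr u, Inr r), Inr v, Inr q) \<in> RR" using assms by simp
    fix P' Q' assume PQ: "(P', Q') \<in> RR"
    then show "entry ?X P' Q' = (if P' = (Inr u, Inr r) \<and> Q' = (Inr v, Inr q) then 1 else 0)"
    proof (cases rule: RR_cases)
      case (ee m m' n n')
      let ?C = "n' = q \<and> (m' - m) mod K = (r - u) mod K \<and> n = v"
      have n: "(?p - n) mod K = (r - u) mod K \<longleftrightarrow> n = v"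
      proof -
        have "(?p - n) mod K = (r - u) mod K \<longleftrightarrow> K dvd v - n"
          by (simp add: mod_simps dvd_mod algebra_simps)
        then show ?thesis using dvd_mod[of v n] ee assms by (auto simp: Zk_mod)
      qed
      have "entry ?X P' Q' = (\<Sum>i\<in>Zk k. if ?C then 1 / of_nat k * \<eta> powi (i * (m - u)) else 0)"
        unfolding entry_sum entry_scale
      proof (intro sum.cong refl)
        fix i assume i: "i \<in> Zk k"
        have "\<eta> powi (- i * (u - v)) * \<eta> powi (i * (m - v)) = \<eta> powi (i * (m - u))"
          unfolding powi_add[symmetric] by (simp add: algebra_simps)
        then show "\<eta> powi (- i * (u - v)) * entry (\<Delta> (sek_d k i (r - u)) \<circ> (blk_one R \<otimes>\<^sub>o munit (Inr ?p) (Inr q))) P' Q'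
            = (if ?C then 1 / of_nat k * \<eta> powi (i * (m - u)) else 0)"
          using PQ ee i n by (auto simp: entry_right_gen comult_ee_sek_d)
      qed
      also have "\<dots> = (if ?C \<and> m = u then 1 else 0)"
      proof -
        have "(\<Sum>i\<in>Zk k. 1 / of_nat k * \<eta> powi (i * (m - u))) = (if m = u then 1 else 0)"
          unfolding sum_distrib_left[symmetric] root_sum
          using mod_diff_eq_iff(2)[OF ee(3) assms(2), of u] k_pos by simp
        then show ?thesis unfolding sum_if_const by auto
      qed
      also have "\<dots> = (if P' = (Inr u, Inr r) \<and> Q' = (Inr v, Inr q) then 1 else 0)"
        using ee mod_diff_eq_iff(2)[OF ee(4) assms(1), of u] by auto
      finally show ?thesis .
    qed (use PQ assms in \<open>auto simp: entry_scale entry_sum entry_right_gen comult_off_block cong: if_cong\<close>)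
  qed
qed

lemma V_eq: "Vl = blk RR" "Vr = blk RR"
proof -
  have "(\<lambda>(P, Q). munit P Q) ` RR \<subseteq> Vl"
  proof clarify
    fix p q r s assume "((p, q), r, s) \<in> RR"
    then show "munit (p, q) (r, s) \<in> Vl"
      by (cases rule: RR_cases) (simp_all add: munit_dd munit_de_left munit_ed_left munit_ee)
  qed
  then have "blk RR \<subseteq> Vl" unfolding blk_def[of RR] by (rule ops.span_minimal[OF _ V_subspace(1)])
  then show "Vl = blk RR" using V_sub(1) by blast
  have "(\<lambda>(P, Q). munit P Q) ` RR \<subseteq> Vr"
  proof clarify
    fix p q r s assume "((p, q), r, s) \<in> RR"
    then show "munit (p, q) (r, s) \<in> Vr"
      by (cases rule: RR_cases) (simp_all add: munit_dd munit_de_right munit_ed_right munit_ee)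
  qed
  then have "blk RR \<subseteq> Vr" unfolding blk_def[of RR] by (rule ops.span_minimal[OF _ V_subspace(2)])
  then show "Vr = blk RR" using V_sub(2) by blast
qed

lemma sekine_compact_quantum_group: "compact_quantum_group (sekine k \<eta>)"
proof -
  have nc: "norm_closure (blk RR) = blk RR"
    by (rule findim_norm_closure[OF findim_blk[OF RR_per(1)] order_refl blk_subspace])
  have "cancellation (sekine k \<eta>)"
    unfolding cancellation_def Let_def
    using V_eq nc unfolding Vl_def Vr_def
    by (simp add: sekine_def sek_alg_blk ctensor_blk[OF R_per(1) R_per(1)] unit_of_blk[OF R_per])
  then show ?thesis
    unfolding compact_quantum_group_def
    using coassociative_sekine cstar_algebra_blk[OF R_per] star_hom_comult
    by (simp add: sekine_def sek_alg_blk ctensor_blk[OF R_per(1) R_per(1)])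
qed

end

section \<open>Strangeness\<close>

lemma (in group_dual_subgroup) card_Gamma_ge_independent:
  assumes "ops.independent W" "finite W" "W \<subseteq> B" shows "card W \<le> card \<Gamma>"
  using ops.independent_span_bound[OF Gamma_finite assms(1)] assms(3) Gamma_span by simp

lemma (in group_dual_subgroup) eps_zero: "eps 0 = 0"
  using eps_scale[of 0 0] by simp

lemma nonclassical_unit_nonzero:
  assumes "compact_quantum_group H" "\<not> classical H" shows "unit_of (alg H) \<noteq> 0"
proof
  assume e: "unit_of (alg H) = 0"
  have "is_unit_of (alg H) (unit_of (alg H))"
    using assms(1) cstar_algebraD(4) unfolding compact_quantum_group_def by blast
  then have u: "0 \<circ> b = b" if "b \<in> alg H" for b using that unfolding is_unit_of_def e by blast
  have "b = 0" if "b \<in> alg H" for b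
  proof -
    have "b = 0 \<circ> b" using u[OF that] by simp
    also have "\<dots> = 0" by (simp add: fun_eq_iff)
    finally show ?thesis .
  qed
  then have "classical H" unfolding classical_def by metis
  then show False using assms(2) by blast
qed

text \<open>A non-classical group dual subgroup has \<open>|\<Gamma>| \<ge> 5\<close>, and \<open>8 < 2 \<cdot> 5\<close> would make \<open>G\<close> cocommutative.\<close>

lemma kac_paljutkin_strange:
  assumes "kac_paljutkin G" shows "strange TYPE('g) TYPE('j) (G :: 'i quantum_group)"
proof -
  have G: "compact_quantum_group G" "ops.dim (alg G) = 8" "\<not> classical G" "\<not> cocommutative G"
    using assms by (simp_all add: kac_paljutkin_def)
  have A: "cstar_algebra (alg G)" using G(1) by (simp add: compact_quantum_group_def)
  have "\<exists>b. ops.independent b \<and> ops.span b = ops.span (alg G)"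
    using ops.maximal_independent_subset[of "alg G"] ops.span_eq ops.span_superset
    by (metis ops.span_mono ops.span_span subset_antisym)
  then obtain S where S: "ops.independent S" "ops.span S = ops.span (alg G)" by blast
  have "card S = 8" using ops.dim_eq_card[OF S(2,1)] G(2) by simp
  then have fS: "finite S" by (metis card.infinite zero_neq_numeral)
  have AS: "alg G = ops.span S"
    using S(2) ops.span_eq_iff[THEN iffD2, OF cstar_algebraD(2)[OF A]] by simp
  have fin: "findim (alg G)"
    unfolding findim_def using fS AS cstar_algebraD(1)[OF A] ops.span_superset by blast
  have "classical H" if H: "group_dual \<Lambda> u H" "quantum_subgroup G H \<pi>"
    for \<Lambda> :: "'g monoid" and u :: "'g \<Rightarrow> 'j oper" and H \<pi>
  proof (rule ccontr)
    assume nc: "\<not> classical H"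
    have "compact_quantum_group H" using H(1) by (simp add: group_dual_def)
    then interpret group_dual_subgroup \<Lambda> u H G \<pi>
      using H fin nonclassical_unit_nonzero nc by unfold_locales
    have "card S < 2 * card (u ` carrier \<Lambda>)" using card_Gamma_ge_5[OF nc] \<open>card S = 8\<close> by simp
    then show False using cocommutative_if_small[OF fS AS] G(4) by blast
  qed
  then show ?thesis unfolding strange_def using G by blast
qed

context sekine_root
begin

lemma sekine_simps: "alg (sekine k \<eta>) = blk R" "comult (sekine k \<eta>) = \<Delta>"
  by (simp_all add: sekine_def sek_alg_blk)

lemma card_R: "card R \<le> 2 * k\<^sup>2"
proof -
  have "card R \<le> card ((\<lambda>(i, j). (Inl (i, j), Inl (i, j)) :: sek \<times> sek) ` (Zk k \<times> Zk k))
      + card ((\<lambda>(i, j). (Inr i, Inr j) :: sek \<times> sek) ` (Zk k \<times> Zk k))"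
    unfolding R_def by (rule card_Un_le)
  also have "\<dots> \<le> card (Zk k \<times> Zk k) + card (Zk k \<times> Zk k)"
    by (intro add_mono card_image_le) simp_all
  finally show ?thesis by (simp add: card_cartesian_product Zk_def power2_eq_square)
qed

lemma sekine_nonclassical: assumes "2 \<le> k" shows "\<not> classical (sekine k \<eta>)"
proof
  assume "classical (sekine k \<eta>)"
  moreover have "munit (Inr 0) (Inr 1) \<in> blk R" "munit (Inr 1) (Inr 0) \<in> blk R"
    using assms by (auto intro!: munit_in_blk simp: Zk_iff)
  ultimately have "(munit (Inr 0) (Inr 1) :: sek oper) \<circ> munit (Inr 1) (Inr 0)
      = munit (Inr 1) (Inr 0) \<circ> munit (Inr 0) (Inr 1)"
    unfolding classical_def sekine_simps by blast
  then have "(munit (Inr 0) (Inr 0) :: sek oper) = munit (Inr 1) (Inr 1)" by (simp only: munit_comp if_True refl)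
  then have "entry (munit (Inr 0) (Inr 0) :: sek oper) (Inr 0) (Inr 0)
      = entry (munit (Inr 1) (Inr 1) :: sek oper) (Inr 0) (Inr 0)"
    by (rule arg_cong[where f = "\<lambda>T. entry T (Inr 0) (Inr 0)"])
  then show False by (simp add: entry_munit)
qed

lemma entry_oflip: "entry (oflip T) (p, q) (r, s) = entry T (q, p) (s, r)"
proof -
  have "(\<lambda>(i', j'). ket (r, s) (j', i')) = ket (s, r)" by (auto simp: ket_def fun_eq_iff)
  then show ?thesis by (simp add: entry_ket oflip_def)
qed

text \<open>On the last block the flip carries \<open>\<Delta> d\<^sub>0\<^sub>,\<^sub>1\<close> to \<open>\<Delta> d\<^sub>0\<^sub>,\<^sub>-\<^sub>1\<close>, and \<open>1 \<noteq> -1\<close> modulo \<open>k \<ge> 3\<close>.\<close>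

lemma sekine_noncocommutative: assumes "3 \<le> k" shows "\<not> cocommutative (sekine k \<eta>)"
proof
  assume "cocommutative (sekine k \<eta>)"
  then have "oflip (\<Delta> (sek_d k 0 1)) = \<Delta> (sek_d k 0 1)"
    unfolding cocommutative_def sekine_simps using sek_in_blk(1) by blast
  then have "entry (\<Delta> (sek_d k 0 1)) (Inr 1, Inr 0) (Inr 1, Inr 0) = entry (\<Delta> (sek_d k 0 1)) (Inr 0, Inr 1) (Inr 0, Inr 1)"
    using entry_oflip[of "\<Delta> (sek_d k 0 1)" "Inr 0" "Inr 1" "Inr 0" "Inr 1"] by simp
  moreover have z: "0 \<in> Zk k" "1 \<in> Zk k" using assms by (simp_all add: Zk_iff)
  moreover have "(- 1) mod K \<noteq> 1 mod K"
  proof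
    assume "(- 1) mod K = 1 mod K"
    then have "K dvd - 1 - 1" by (simp only: dvd_mod)
    then have "K dvd 2" by simp
    then have "K \<le> 2" by (rule zdvd_imp_le) simp
    then show False using assms by simp
  qed
  ultimately show False using k_pos by (simp add: comult_ee_sek_d)
qed

text \<open>The images of the \<open>k\<^sup>2\<close> matrix units of \<open>M\<^sub>k(\<complex>)\<close> are linearly independent, since \<open>M\<^sub>k(\<complex>)\<close> is simple and is not
  killed when the image is non-commutative. The unit is independent of them because the character
  \<open>eps\<close> takes the value 1 on it and vanishes on \<open>M\<^sub>k(\<complex>)\<close>.\<close>

lemma sekine_card_Gamma:
  fixes \<Lambda> :: "'g monoid" and u :: "'g \<Rightarrow> 'j oper"
  assumes loc: "group_dual_subgroup \<Lambda> u H (sekine k \<eta>) \<pi>" and nc: "\<not> classical H" and k2: "2 \<le> k"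
  shows "k\<^sup>2 < card (u ` carrier \<Lambda>)"
proof -
  interpret L: group_dual_subgroup \<Lambda> u H "sekine k \<eta>" \<pi> by (rule loc)
  let ?B = "alg H"
  have lin: "lin_on (blk R) \<pi>" using L.pi_lin by (simp only: sekine_simps)
  have comp: "\<pi> (a \<circ> b) = \<pi> a \<circ> \<pi> b" if "a \<in> blk R" "b \<in> blk R" for a b
    using that L.pi_comp by (simp only: sekine_simps)
  have pin: "\<pi> a \<in> ?B" if "a \<in> blk R" for a using that L.pi_in by (simp only: sekine_simps)
  have surj: "\<pi> ` blk R = ?B" using L.pi_surj by (simp only: sekine_simps)
  have pi0: "\<pi> 0 = 0" by (rule lin_on_zero[OF blk_subspace lin])
  define v where "v x y = \<pi> (munit (Inr x) (Inr y))" for x y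
  have m_in: "munit (Inr x) (Inr y) \<in> blk R" if "x \<in> Zk k" "y \<in> Zk k" for x y
    using that by (intro munit_in_blk) simp
  have v_in: "v x y \<in> ?B" if "x \<in> Zk k" "y \<in> Zk k" for x y
    unfolding v_def by (rule pin[OF m_in[OF that]])
  have v_comp: "v x y \<circ> v x' y' = (if y = x' then v x y' else 0)"
    if "x \<in> Zk k" "y \<in> Zk k" "x' \<in> Zk k" "y' \<in> Zk k" for x y x' y'
  proof -
    have "v x y \<circ> v x' y' = \<pi> (munit (Inr x) (Inr y) \<circ> munit (Inr x') (Inr y'))"
      unfolding v_def using comp m_in that by simp
    then show ?thesis by (cases "y = x'") (simp_all only: munit_comp v_def pi0 if_True if_False sum.inject simp_thms)
  qed
  have zero_comp: "0 \<circ> b = (0 :: 'j oper)" for b :: "'j oper" by (simp add: fun_eq_iff)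
  have comp_zero: "b \<circ> 0 = (0 :: 'j oper)" if "b \<in> ?B" for b
    using bdd_zero[OF L.B_bdd[OF that]] by (simp add: fun_eq_iff)
  \<comment> \<open>\<open>M\<^sub>k(\<complex>)\<close> is simple: if \<open>\<pi>\<close> killed one matrix unit it would kill all of them, and its image would be
    a quotient of the commutative summand.\<close>
  have v_nz: "v x y \<noteq> 0" if xy: "x \<in> Zk k" "y \<in> Zk k" for x y
  proof
    assume v0: "v x y = 0"
    have all0: "v x' y' = 0" if xy': "x' \<in> Zk k" "y' \<in> Zk k" for x' y'
    proof -
      have "v x' y' = v x' x \<circ> (v x y \<circ> v y y')" using xy xy' by (simp only: v_comp if_True simp_thms)
      then show ?thesis using comp_zero[OF v_in[OF xy'(1) xy(1)]] by (simp only: v0 zero_comp)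
    qed
    have ST: "\<pi> (S \<circ> T) = \<pi> (T \<circ> S)" if S: "S \<in> blk R" and T: "T \<in> blk R" for S T
    proof -
      have "\<pi> (S \<circ> T) = (\<Sum>(p, q)\<in>R. oscale (entry (S \<circ> T) p q) (\<pi> (munit p q)))"
        by (rule lin_on_blk_expand[OF lin R_per(1) blk_comp[OF R_per(1,3) S T]])
      also have "\<dots> = (\<Sum>(p, q)\<in>R. oscale (entry (T \<circ> S) p q) (\<pi> (munit p q)))"
      proof (intro sum.cong refl, clarify)
        fix p q assume pq: "(p, q) \<in> R"
        then show "oscale (entry (S \<circ> T) p q) (\<pi> (munit p q)) = oscale (entry (T \<circ> S) p q) (\<pi> (munit p q))"
        proof (cases rule: R_cases)
          case (d a b)
          have "entry (S \<circ> T) p q = entry (T \<circ> S) p q"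
            using parts_comp(1)[OF S T, of a b] parts_comp(1)[OF T S, of a b] d
            by (simp add: dpart_def Zk_mod mult.commute)
          then show ?thesis by simp
        next
          case (e x' y')
          then have "\<pi> (munit p q) = 0" using all0[of x' y'] by (simp add: v_def)
          then show ?thesis by (simp only: ops.scale_zero_right)
        qed
      qed
      also have "\<dots> = \<pi> (T \<circ> S)"
        by (rule lin_on_blk_expand[OF lin R_per(1) blk_comp[OF R_per(1,3) T S], symmetric])
      finally show ?thesis .
    qed
    have "a \<circ> b = b \<circ> a" if ab: "a \<in> ?B" "b \<in> ?B" for a b
    proof -
      have "a \<in> \<pi> ` blk R" "b \<in> \<pi> ` blk R" using ab surj by simp_all
      then obtain S T where st: "S \<in> blk R" "T \<in> blk R" "a = \<pi> S" "b = \<pi> T" by (elim imageE)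
      show ?thesis unfolding st(3,4) comp[OF st(1,2), symmetric] comp[OF st(2,1), symmetric] by (rule ST[OF st(1,2)])
    qed
    then show False using nc unfolding classical_def by blast
  qed
  \<comment> \<open>Off the diagonal the matrix units are nilpotent, and a diagonal one is a product of two
    off-diagonal ones, so a character kills them all.\<close>
  have eps_v: "L.eps (v x y) = 0" if xy: "x \<in> Zk k" "y \<in> Zk k" for x y
  proof -
    have off: "L.eps (v x y) = 0" if "x \<noteq> y" "x \<in> Zk k" "y \<in> Zk k" for x y
    proof -
      have "L.eps (v x y \<circ> v x y) = L.eps (v x y) * L.eps (v x y)" using that by (intro L.eps_comp v_in)
      moreover have "v x y \<circ> v x y = 0"
        using v_comp[OF that(2,3,2,3)] that(1) by simp
      ultimately show ?thesis using L.eps_zero by simp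
    qed
    show ?thesis
    proof (cases "x = y")
      case True
      obtain z where z: "z \<in> Zk k" "z \<noteq> x"
      proof (cases "x = 0")
        case True
        then show ?thesis using that[of 1] k2 by (simp add: Zk_iff)
      next
        case False
        then show ?thesis using that[of 0] k2 by (simp add: Zk_iff)
      qed
      have "v x y = v x z \<circ> v z x" using z xy True by (simp only: v_comp if_True simp_thms)
      then have "L.eps (v x y) = L.eps (v x z) * L.eps (v z x)" using z xy by (simp only: L.eps_comp v_in)
      then show ?thesis using off[OF z(2)[symmetric] xy(1) z(1)] by simp
    qed (use off xy in blast)
  qed
  let ?v = "\<lambda>p. v (fst p) (snd p)"
  define W where "W = ?v ` (Zk k \<times> Zk k)"
  have finW: "finite W" by (simp add: W_def)
  have cut: "v x x \<circ> (v x' y' \<circ> v y y) = (if x' = x \<and> y' = y then v x y else 0)"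
    if "x \<in> Zk k" "y \<in> Zk k" "x' \<in> Zk k" "y' \<in> Zk k" for x y x' y'
  proof (cases "y' = y")
    case True
    then show ?thesis
      using that by (cases "x' = x") (simp_all only: v_comp if_True if_False simp_thms eq_commute[of x x'])
  next
    case False
    then show ?thesis using that by (simp only: v_comp if_False comp_zero[OF v_in] simp_thms)
  qed
  have inj: "inj_on ?v (Zk k \<times> Zk k)"
  proof (rule inj_onI)
    fix p q assume p: "p \<in> Zk k \<times> Zk k" and q: "q \<in> Zk k \<times> Zk k" and e: "?v p = ?v q"
    obtain x y where xy: "p = (x, y)" by (metis surj_pair)
    obtain x' y' where xy': "q = (x', y')" by (metis surj_pair)
    have z: "x \<in> Zk k" "y \<in> Zk k" "x' \<in> Zk k" "y' \<in> Zk k" using p q xy xy' by simp_all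
    have "v x y = (if x' = x \<and> y' = y then v x y else 0)"
      using cut[OF z(1,2,1,2)] cut[OF z(1,2,3,4)] e xy xy' by (simp only: fst_conv snd_conv simp_thms if_True)
    then have "x' = x \<and> y' = y" using v_nz[OF z(1,2)] by presburger
    then show "p = q" using xy xy' by simp
  qed
  have cut_lin: "lin_on ?B (\<lambda>b. v x x \<circ> (b \<circ> v y y))" if "x \<in> Zk k" "y \<in> Zk k" for x y
    unfolding lin_on_def
  proof (intro conjI ballI allI)
    have vb: "bounded_oper (v x x)" by (rule L.B_bdd[OF v_in[OF that(1) that(1)]])
    have vy: "v y y \<in> ?B" by (rule v_in[OF that(2) that(2)])
    show "v x x \<circ> ((a + b) \<circ> v y y) = (v x x \<circ> (a \<circ> v y y)) + (v x x \<circ> (b \<circ> v y y))" if "a \<in> ?B" "b \<in> ?B" for a b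
      unfolding add_comp using that vy by (intro oper_comp_add vb L.B_bdd L.B_comp)
    show "v x x \<circ> (oscale c a \<circ> v y y) = oscale c (v x x \<circ> (a \<circ> v y y))" if "a \<in> ?B" for a c
      unfolding scale_comp using that vy by (intro oper_comp_scale vb L.B_bdd L.B_comp)
  qed
  have scalars: "f w = 0" if sum: "(\<Sum>w\<in>W. oscale (f w) w) = 0" and w: "w \<in> W" for f w
  proof -
    obtain x y where xy: "x \<in> Zk k" "y \<in> Zk k" "w = v x y" using w by (auto simp: W_def)
    have "v x x \<circ> ((\<Sum>w\<in>W. oscale (f w) w) \<circ> v y y) = (\<Sum>w\<in>W. v x x \<circ> (oscale (f w) w \<circ> v y y))"
      by (rule lin_on_sum[OF L.B_sub cut_lin[OF xy(1,2)]])
        (auto simp: W_def intro!: ops.subspace_scale[OF L.B_sub] v_in)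
    also have "\<dots> = (\<Sum>w'\<in>W. if w' = w then oscale (f w) w else 0)"
    proof (rule sum.cong[OF refl])
      fix w' assume w': "w' \<in> W"
      obtain x' y' where xy': "x' \<in> Zk k" "y' \<in> Zk k" "w' = v x' y'" using w' by (auto simp: W_def)
      have eq: "w' = w \<longleftrightarrow> x' = x \<and> y' = y"
        using inj_onD[OF inj, of "(x', y')" "(x, y)"] xy xy' by auto
      have "v x x \<circ> (oscale (f w') w' \<circ> v y y) = oscale (f w') (v x x \<circ> (w' \<circ> v y y))"
        using lin_onD(2)[OF cut_lin[OF xy(1,2)] v_in[OF xy'(1,2)]] xy'(3) by simp
      also have "\<dots> = oscale (f w') (if w' = w then w else 0)"
        unfolding eq unfolding xy'(3) xy(3) cut[OF xy(1,2) xy'(1,2)] ..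
      also have "\<dots> = (if w' = w then oscale (f w) w else 0)"
        by (cases "w' = w") (simp_all only: if_True if_False ops.scale_zero_right simp_thms)
      finally show "v x x \<circ> (oscale (f w') w' \<circ> v y y) = (if w' = w then oscale (f w) w else 0)" .
    qed
    also have "\<dots> = oscale (f w) w" using w finW by (simp only: sum.delta if_True)
    finally have "oscale (f w) w = v x x \<circ> (0 \<circ> v y y)" unfolding sum by (rule sym)
    also have "\<dots> = 0" using comp_zero[OF v_in[OF xy(1) xy(1)]] by (simp only: zero_comp)
    finally have "f w = 0 \<or> w = 0" unfolding ops.scale_eq_0_iff .
    then show ?thesis using v_nz[OF xy(1,2)] xy(3) by metis
  qed
  have indW: "ops.independent W"
  proof
    assume "ops.dependent W"
    then have "\<exists>f. (\<exists>w\<in>W. f w \<noteq> 0) \<and> (\<Sum>w\<in>W. oscale (f w) w) = 0"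
      using ops.dependent_finite[OF finW] by simp
    then obtain f where f: "(\<exists>w\<in>W. f w \<noteq> 0) \<and> (\<Sum>w\<in>W. oscale (f w) w) = 0" by (rule exE)
    then obtain w where w: "w \<in> W" "f w \<noteq> 0" by blast
    show False using scalars[OF conjunct2[OF f] w(1)] w(2) by (rule notE[rotated])
  qed
  have "unit_of ?B \<notin> ops.span W"
  proof
    assume "unit_of ?B \<in> ops.span W"
    moreover have "ops.span W \<subseteq> {b. L.eps b = 0}"
    proof (rule ops.span_minimal)
      show "W \<subseteq> {b. L.eps b = 0}" using eps_v by (auto simp: W_def)
      show "ops.subspace {b. L.eps b = 0}"
        unfolding ops.subspace_def
        by (intro conjI ballI allI) (simp_all only: mem_Collect_eq L.eps_zero L.eps_add L.eps_scale
            add_0_left mult_zero_right)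
    qed
    ultimately have "L.eps (unit_of ?B) = 0" by blast
    then show False using L.eps_Gamma[OF L.Gamma_one] by simp
  qed
  then have ind: "ops.independent (insert (unit_of ?B) W)" and new: "unit_of ?B \<notin> W"
    using ops.independent_insertI[OF _ indW] ops.span_base by blast+
  have "insert (unit_of ?B) W \<subseteq> ?B" using L.eB_in v_in by (auto simp: W_def)
  then have "card (insert (unit_of ?B) W) \<le> card (u ` carrier \<Lambda>)"
    using L.card_Gamma_ge_independent[OF ind] finW by simp
  moreover have "card W = k\<^sup>2"
    unfolding W_def card_image[OF inj] by (simp add: card_cartesian_product Zk_def power2_eq_square)
  ultimately show ?thesis using new finW by simp
qed

lemma sekine_strange:
  assumes k3: "3 \<le> k" shows "strange TYPE('g) TYPE('j) (sekine k \<eta>)"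
proof -
  let ?S = "(\<lambda>(p, q). munit p q) ` R"
  have S: "finite ?S" "alg (sekine k \<eta>) = ops.span ?S"
    using R_per(1) by (simp_all add: sekine_simps blk_def)
  have "card ?S \<le> 2 * k\<^sup>2" using card_image_le[OF R_per(1)] card_R order_trans by blast
  moreover have fin: "findim (alg (sekine k \<eta>))" by (simp add: sekine_simps findim_blk R_per)
  moreover have k2: "2 \<le> k" using k3 by simp
  ultimately have "classical H" if H: "group_dual \<Lambda> u H" "quantum_subgroup (sekine k \<eta>) H \<pi>"
    for \<Lambda> :: "'g monoid" and u :: "'g \<Rightarrow> 'j oper" and H \<pi>
  proof -
    show ?thesis
    proof (rule ccontr)
      assume nc: "\<not> classical H"
      have "compact_quantum_group H" using H(1) by (simp add: group_dual_def)
      then interpret L: group_dual_subgroup \<Lambda> u H "sekine k \<eta>" \<pi>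
        using H fin nonclassical_unit_nonzero nc by unfold_locales
      have "card ?S < 2 * card (u ` carrier \<Lambda>)"
        using sekine_card_Gamma[OF L.group_dual_subgroup_axioms nc k2] \<open>card ?S \<le> 2 * k\<^sup>2\<close> by simp
      then show False using L.cocommutative_if_small[OF S] sekine_noncocommutative[OF k3] by blast
    qed
  qed
  then show ?thesis
    unfolding strange_def using sekine_compact_quantum_group sekine_nonclassical[OF k2] by blast
qed

end

theorem theorem3p6:
  shows "(\<forall>G :: 'i quantum_group. kac_paljutkin G \<longrightarrow> strange TYPE('g) TYPE('j) G) \<and>
         (\<forall>k \<eta>. 3 \<le> k \<and> primitive_root_of_unity k \<eta> \<longrightarrow>
                strange TYPE('g) TYPE('j) (sekine k \<eta>))"
  using kac_paljutkin_strange sekine_root.sekine_strange unfolding sekine_root_def by blast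

end
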